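(* Let $d\ge 2$ be an integer, $0<\beta<1$, $0<\alpha<2$, and $p_0=\frac{(d-1)(1-\beta)+\alpha}{\alpha\beta}$. There is a constant $C>0$ depending only on $d,\alpha,\beta$ such that for all $s\ge1$ and all $x=(x_1,\tilde x)\in\mathbb{R}^d$ with $x_1\le s/2$, $$\mathbf{P}_x\{X_{\tau_s}\in\mathcal{P}_\beta\}\le C\,(x_1\vee 1)^{\alpha\beta}\,s^{-\alpha\beta p_0}.$$
   Context: The parabola-shaped region is $\mathcal{P}_\beta=\{x=(x_1,\tilde x)\in\mathbb{R}^d: x_1>0,\ \tilde x\in\mathbb{R}^{d-1},\ |\tilde x|<x_1^\beta\}$, where $|\cdot|$ is the Euclidean norm. For $0\le u<v\le\infty$, $\mathcal{P}_\beta^{u,v}=\mathcal{P}_\beta\cap\{(x_1,\tilde x): u\le x_1<v\}$. $\{X_t\}_{t\ge0}$ denotes the isotropic $\alpha$-stable $\mathbb{R}^d$-valued Lévy process: it is time-homogeneous, has right-continuous trajectories with left limits, has independent, rotation invariant $\alpha$-stable increments, and satisfies $\mathbf{E}_x e^{i\xi\cdot(X_t-x)}=e^{-t|\xi|^\alpha}$ for $x,\xi\in\mathbb{R}^d$, $t\ge0$. Here $\mathbf{P}_x$ is the distribution of the process starting from $x\in\mathbb{R}^d$ and $\mathbf{E}_x$ the corresponding expectation. For an open set $U\subset\mathbb{R}^d$, $\tau_U=\inf\{t\ge0: X_t\notin U\}$ is the first exit time from $U$. For $0<s<\infty$, $\tau_s=\tau_{\mathcal{P}_\beta^{0,s}}$.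 The notation $a\vee b$ means $\max(a,b)$. *)

theory Defs
  imports "HOL-Probability.Probability"
begin

text \<open>The Euclidean space of dimension \<open>d \<ge> 2\<close> is modelled as \<open>real \<times> real ^ 'n\<close> with
  \<open>d = 1 + CARD('n)\<close>, so that a point is literally a pair \<open>(x\<^sub>1, x')\<close>; the norm
  of the product type is the Euclidean one.\<close>

definition parabola :: "real \<Rightarrow> (real \<times> 'a::real_normed_vector) set" where
  "parabola \<beta> = {x. fst x > 0 \<and> norm (snd x) < fst x powr \<beta>}"

definition parabola_between ::
    "real \<Rightarrow> real \<Rightarrow> ereal \<Rightarrow> (real \<times> 'a::real_normed_vector) set" where
  "parabola_between \<beta> u v = parabola \<beta> \<inter> {x. u \<le> fst x \<and> ereal (fst x) < v}"

definition cadlag :: "(real \<Rightarrow> 'b::topological_space) \<Rightarrow> bool" where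
  "cadlag \<omega> \<longleftrightarrow> (\<forall>t\<ge>0. (\<omega> \<longlongrightarrow> \<omega> t) (at_right t)) \<and> (\<forall>t>0. \<exists>l. (\<omega> \<longlongrightarrow> l) (at_left t))"

text \<open>Canonical path space on the time set \<open>{0..}\<close>. The underlying set of paths is not
  measurable in the product space; \<^const>\<open>restrict_space\<close> yields the trace, that is, the
  sigma-algebra generated by the coordinates.\<close>

definition path_space :: "(real \<Rightarrow> 'b::topological_space) measure" where
  "path_space = restrict_space (\<Pi>\<^sub>M t\<in>{0..}. borel) {\<omega>. cadlag \<omega>}"

text \<open>\<open>isotropic_stable_law P \<alpha> x\<close>: \<open>P\<close> is the distribution, on path space, of the isotropic
  \<open>\<alpha>\<close>-stable process started at \<open>x\<close>; the process is \<open>X\<^sub>t(\<omega>) = \<omega> t\<close>. Rotation invariance and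
  \<open>\<alpha>\<close>-stability of the increments are consequences of the last two conditions.\<close>

locale isotropic_stable_law = prob_space P
  for P :: "(real \<Rightarrow> 'b::euclidean_space) measure" and \<alpha> :: real and x :: 'b +
  assumes sets_eq: "sets P = sets path_space"
    and start: "AE \<omega> in P. \<omega> 0 = x"
    and independent_increments:
      "\<And>n (t :: nat \<Rightarrow> real). 0 \<le> t 0 \<Longrightarrow> (\<And>k. k < n \<Longrightarrow> t k < t (Suc k)) \<Longrightarrow>
         indep_vars (\<lambda>_. borel) (\<lambda>k \<omega>. \<omega> (t (Suc k)) - \<omega> (t k)) {..<n}"
    and stationary_increments:
      "\<And>s t. 0 \<le> s \<Longrightarrow> 0 \<le> t \<Longrightarrow>
         distr P borel (\<lambda>\<omega>. \<omega> (s + t) - \<omega> s) = distr P borel (\<lambda>\<omega>. \<omega> t - \<omega> 0)"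
    and characteristic_function:
      "\<And>t \<xi>. 0 \<le> t \<Longrightarrow>
         (\<integral>\<omega>. exp (\<i> * complex_of_real (\<xi> \<bullet> (\<omega> t - x))) \<partial>P)
           = complex_of_real (exp (- (t * norm \<xi> powr \<alpha>)))"

text \<open>The infimum over the empty set is \<open>\<infinity>\<close>.\<close>

definition exit_time :: "'b set \<Rightarrow> (real \<Rightarrow> 'b) \<Rightarrow> ereal" where
  "exit_time U \<omega> = Inf (ereal ` {t. 0 \<le> t \<and> \<omega> t \<notin> U})"

text \<open>The event that the process leaves \<open>U\<close> in finite time and is in \<open>V\<close> at the exit time.\<close>

definition exit_into ::
    "(real \<Rightarrow> 'b) measure \<Rightarrow> 'b set \<Rightarrow> 'b set \<Rightarrow> (real \<Rightarrow> 'b) set" where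
  "exit_into P U V =
     {\<omega> \<in> space P. exit_time U \<omega> < \<infinity> \<and> \<omega> (real_of_ereal (exit_time U \<omega>)) \<in> V}"

text \<open>First hitting times of closed sets by right-continuous paths with left limits are in
  general only measurable with respect to the completed sigma-algebra, so that probabilities
  of events defined through \<open>exit_time\<close> have to be taken in the completion.\<close>

definition exit_prob :: "(real \<Rightarrow> 'b) measure \<Rightarrow> 'b set \<Rightarrow> 'b set \<Rightarrow> real" where
  "exit_prob P U V = measure (completion P) (exit_into P U V)"

definition p0 :: "nat \<Rightarrow> real \<Rightarrow> real \<Rightarrow> real" where
  "p0 d \<alpha> \<beta> = ((real d - 1) * (1 - \<beta>) + \<alpha>) / (\<alpha> * \<beta>)"

end

theory Submission
  imports Defs
begin

text \<open>The proof is a barrier argument. Let \<open>\<mu>\<^sub>h\<close> be the law of an increment over time \<open>h\<close>. Its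
  characteristic function gives two-sided tail bounds \<open>h R\<^bsup>-\<alpha>\<^esup>\<close> for one-dimensional projections, and
  rotation invariance (a packing of congruent cones) gives the bound
  \<open>h w\<^bsup>d-1\<^esup> R\<^bsup>-(d-1)-\<alpha>\<^esup>\<close> for a jump of length about \<open>R\<close> which stays in a tube of width \<open>w\<close>. A process at
  height \<open>t\<close> of the parabola leaves it sideways at rate \<open>t\<^bsup>-\<alpha>\<beta>\<^esup>\<close>, which dominates the gain from jumps along
  the parabola if heights are shifted by a large constant and the barrier carries a large factor. Hence a
  function on a slightly fattened parabola, equal to \<open>1\<close> beyond height \<open>s\<close> and comparable to
  \<open>t\<^bsup>\<alpha>\<beta>\<^esup> s\<^bsup>-((d-1)(1-\<beta>)+\<alpha>)\<^esup>\<close> up to height \<open>2s/3\<close>, is superharmonic for every random walk obtained by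
  sampling the process along a grid of mesh at most \<open>1\<close>. It bounds the probability that the walk
  leaves the truncated parabola within the parabola. By right-continuity, exit at a slightly larger height
  implies this for all sufficiently fine grids, and Fatou's lemma concludes.\<close>

section \<open>Uniqueness of characteristic functions on Euclidean spaces\<close>

text \<open>Sampling replaces the generator and the strong Markov property: superharmonicity becomes
  an inequality for one increment, and stopping a walk is Fubini. The price is that all estimates
  must be linear in the mesh h and uniform in 0 < h \<le> 1. A lower bound of order h w^(-\<alpha>)
  for jumps over a width w needs h \<le> w^\<alpha>, which fails at the tip of the parabola;
  shifting heights by r \<ge> 1 makes all radii at least 1. The characteristic function is the only
  information about the increments. Rotation invariance has to be derived from it, hence the
  uniqueness theorem in several dimensions, obtained from the one-dimensional one coordinate by
  coordinate. Every term is measured in units of the sideways probability h (r +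
  t)^(-\<alpha>\<beta>). In these units jumps beyond the scale of the profile cost
  \<Lambda>^(-\<alpha>), jumps along the tube r^(-(1-\<beta>)(d-1+\<alpha>)), jumps to the top 1/A,
  up to constants. Close to height s, where the tube is not thin compared with s - t, no such
  comparison is made: A is so large that the barrier equals 1 there.\<close>

lemma borel_measurable_cis_inner [measurable]:
  "(\<lambda>y::'a::euclidean_space. cis (\<xi> \<bullet> y)) \<in> borel_measurable borel"
  by (intro borel_measurable_continuous_onI continuous_intros)

text \<open>The two masses agree, being the values of the transforms at 0, and division by them
  reduces the claim to \<open>Levy_uniqueness\<close>. The weighted projections to which this is
  applied below are not normalised.\<close>

lemma finite_measure_char_unique:
  fixes M N :: "real measure"
  assumes "finite_measure M" "finite_measure N" "sets M = sets borel" "sets N = sets borel"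
    and char_eq: "\<And>t. (\<integral>x. iexp (t * x) \<partial>M) = (\<integral>x. iexp (t * x) \<partial>N)"
  shows "M = N"
proof -
  interpret M: finite_measure M by fact
  interpret N: finite_measure N by fact
  define c where "c = measure M UNIV"
  have sp: "space M = UNIV" "space N = UNIV"
    using sets_eq_imp_space_eq[OF assms(3)] sets_eq_imp_space_eq[OF assms(4)] by simp_all
  have cN: "measure N UNIV = c"
    using char_eq[of 0] by (simp add: sp c_def scaleR_conv_of_real)
  have eM: "emeasure M UNIV = ennreal c" "emeasure N UNIV = ennreal c"
    using cN by (simp_all add: c_def M.emeasure_eq_measure N.emeasure_eq_measure)
  show ?thesis
  proof (cases "c = 0")
    case True
    have "emeasure M A = emeasure N A" if "A \<in> sets M" for A
      using emeasure_mono[of A UNIV M] emeasure_mono[of A UNIV N] eM True assms by simp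
    then show ?thesis by (intro measure_eqI) (simp_all add: assms)
  next
    case False
    have c: "c > 0" using False by (simp add: c_def order_less_le)
    define M' N' where "M' = scale_measure (ennreal (1/c)) M" and "N' = scale_measure (ennreal (1/c)) N"
    have MM: "M = scale_measure (ennreal c) M'" "N = scale_measure (ennreal c) N'"
      unfolding M'_def N'_def using c
      by (simp_all add: ennreal_mult'[symmetric])
    have rd: "real_distribution M'" "real_distribution N'"
      using c assms(3,4) sp
      by (auto simp: real_distribution_def real_distribution_axioms_def M'_def N'_def
          eM ennreal_mult'[symmetric] space_scale_measure intro!: prob_spaceI)
    have d: "M' = density M (\<lambda>_. ennreal (1/c))" "N' = density N (\<lambda>_. ennreal (1/c))"
      by (auto intro!: measure_eqI simp: M'_def N'_def emeasure_density_const mult.commute)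
    have "char M' = char N'"
    proof
      fix t
      have "char M' t = (1/c) *\<^sub>R (\<integral>x. iexp (t * x) \<partial>M)"
        unfolding char_def d(1) using c assms(3) 
        by (subst integral_density) (auto simp: measurable_cong_sets[OF assms(3) refl])
      moreover have "char N' t = (1/c) *\<^sub>R (\<integral>x. iexp (t * x) \<partial>N)"
        unfolding char_def d(2) using c
        by (subst integral_density) (auto simp: measurable_cong_sets[OF assms(4) refl])
      ultimately show "char M' t = char N' t" using char_eq by simp
    qed
    with Levy_uniqueness[OF rd] MM show ?thesis by simp
  qed
qed

text \<open>The weights \<open>1 + cos\<close> make the measures in the induction step nonnegative.\<close>

lemma char_determines_boxes:
  fixes M N :: "'a::euclidean_space measure"
  assumes M: "finite_measure M" "sets M = sets borel" and N: "finite_measure N" "sets N = sets borel"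
    and char_eq: "\<And>\<xi>. (\<integral>y. cis (\<xi> \<bullet> y) \<partial>M) = (\<integral>y. cis (\<xi> \<bullet> y) \<partial>N)"
    and J: "finite J"
    and B: "\<And>b. b \<in> J \<Longrightarrow> B b \<in> sets borel"
  shows "(\<integral>y. indicator {y. \<forall>b\<in>J. y \<bullet> b \<in> B b} y *\<^sub>R cis (\<xi> \<bullet> y) \<partial>M)
       = (\<integral>y. indicator {y. \<forall>b\<in>J. y \<bullet> b \<in> B b} y *\<^sub>R cis (\<xi> \<bullet> y) \<partial>N)"
  using J B
proof (induction arbitrary: \<xi> rule: finite_induct)
  case empty
  then show ?case using char_eq by simp
next
  case (insert c J)
  have B: "\<And>b. b \<in> J \<Longrightarrow> B b \<in> sets borel" and Bc[measurable]: "B c \<in> sets borel"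
    using insert.prems by auto
  define I where "I = {y. \<forall>b\<in>J. y \<bullet> b \<in> B b}"
  define I' where "I' = {y. \<forall>b\<in>insert c J. y \<bullet> b \<in> B b}"
  have I_eq: "I = (\<Inter>b\<in>J. (\<lambda>y. y \<bullet> b) -` B b \<inter> space borel)" by (auto simp: I_def)
  have [measurable]: "I \<in> sets borel"
  proof (cases "J = {}")
    case False
    have "(\<lambda>y. y \<bullet> b) -` B b \<inter> space borel \<in> sets borel" if "b \<in> J" for b
      by (rule measurable_sets[OF _ B[OF that]]) measurable
    then show ?thesis
      unfolding I_eq using insert.hyps(1) False by (intro sets.finite_INT) auto
  qed (simp add: I_def)
  have IH: "(\<integral>y. indicator I y *\<^sub>R cis (\<xi> \<bullet> y) \<partial>M) = (\<integral>y. indicator I y *\<^sub>R cis (\<xi> \<bullet> y) \<partial>N)" for \<xi>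
    unfolding I_def by (rule insert.IH[OF B])
  have int: "integrable L (\<lambda>y. indicator I y *\<^sub>R cis (\<xi> \<bullet> y))"
    if "finite_measure L" "sets L = sets borel" for L \<xi>
  proof -
    interpret finite_measure L by fact
    note [measurable_cong] = that(2)
    show ?thesis
      by (rule integrable_const_bound[where B=1]) (auto simp: indicator_def)
  qed
  define w where "w \<xi> \<theta> y = (indicator I y * (1 + cos (\<xi> \<bullet> y + \<theta>)) :: real)" for \<xi> \<theta> y
  have w0: "0 \<le> w \<xi> \<theta> y" for \<xi> \<theta> y
    using cos_ge_minus_one[of "\<xi> \<bullet> y + \<theta>"] by (simp add: w_def indicator_def del: cos_ge_minus_one)
  have [measurable]: "w \<xi> \<theta> \<in> borel_measurable borel" for \<xi> \<theta>
    unfolding w_def by measurable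
  \<comment> \<open>By 2 cos u = cis u + cis (-u), the transform of the weighted projection onto
    \<open>c\<close> is a combination of transforms over \<open>I\<close> at shifted frequencies, to
    which the induction hypothesis applies because it holds for every \<xi>.\<close>
  have expand: "w \<xi> \<theta> y *\<^sub>R iexp (t * (y \<bullet> c)) =
      indicator I y *\<^sub>R cis ((t *\<^sub>R c) \<bullet> y) + ((cis \<theta> / 2) * (indicator I y *\<^sub>R cis ((\<xi> + t *\<^sub>R c) \<bullet> y))
        + (cis (-\<theta>) / 2) * (indicator I y *\<^sub>R cis ((t *\<^sub>R c - \<xi>) \<bullet> y)))" for \<xi> \<theta> t y
  proof -
    have c: "complex_of_real (cos u) = (cis u + cis (-u)) / 2" for u
      by (simp add: complex_eq_iff)
    have e: "iexp v = cis v" for v by (simp add: cis_conv_exp)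
    have 1: "cis \<theta> * cis ((\<xi> + t *\<^sub>R c) \<bullet> y) = cis (\<xi> \<bullet> y + \<theta>) * cis (t * (y \<bullet> c))"
      by (simp add: cis_mult inner_add_left inner_commute[of y c] add_ac)
    have 2: "cis (-\<theta>) * cis ((t *\<^sub>R c - \<xi>) \<bullet> y) = cis (- (\<xi> \<bullet> y + \<theta>)) * cis (t * (y \<bullet> c))"
      by (simp add: cis_mult inner_diff_left inner_commute[of y c] algebra_simps)
    have alg: "i * (1 + (p + q) / 2) * r = i * r + (i * (p * r) / 2 + i * (q * r) / 2)" for i p q r :: complex
      by (simp add: field_simps)
    have "w \<xi> \<theta> y *\<^sub>R iexp (t * (y \<bullet> c)) = indicator I y *\<^sub>R cis (t * (y \<bullet> c)) +
       (indicator I y *\<^sub>R (cis (\<xi> \<bullet> y + \<theta>) * cis (t * (y \<bullet> c))) / 2 +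
        indicator I y *\<^sub>R (cis (- (\<xi> \<bullet> y + \<theta>)) * cis (t * (y \<bullet> c))) / 2)"
      unfolding e w_def
      unfolding scaleR_conv_of_real of_real_mult of_real_add c of_real_1
      by (rule alg)
    then show ?thesis
      unfolding 1[symmetric] 2[symmetric] by (simp add: inner_commute[of y c] scaleR_conv_of_real mult_ac)
  qed
  define D where "D L \<xi> \<theta> = distr (density L (w \<xi> \<theta>)) borel (\<lambda>y. y \<bullet> c)" for L \<xi> \<theta>
  have intw: "integrable L (w \<xi> \<theta>)" if "finite_measure L" "sets L = sets borel" for L \<xi> \<theta>
  proof -
    interpret finite_measure L by fact
    note [measurable_cong] = that(2)
    show ?thesis
    proof (rule integrable_const_bound[where B=2])
      have "\<bar>1 + cos u\<bar> \<le> 2" for u :: real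
        using cos_le_one[of u] cos_ge_minus_one[of u] by linarith
      then have "norm (w \<xi> \<theta> x) \<le> 2" for x
        by (auto simp: w_def indicator_def)
      then show "AE x in L. norm (w \<xi> \<theta> x) \<le> 2" by simp
    qed simp
  qed
  have D_fin: "finite_measure (D L \<xi> \<theta>)" if "finite_measure L" "sets L = sets borel" for L \<xi> \<theta>
  proof -
    interpret finite_measure L by fact
    note [measurable_cong] = that(2)
    have "emeasure (D L \<xi> \<theta>) UNIV = (\<integral>\<^sup>+y. w \<xi> \<theta> y \<partial>L)"
      unfolding D_def using sets_eq_imp_space_eq[OF that(2)]
      by (subst emeasure_distr) (auto simp: emeasure_density that intro!: nn_integral_cong)
    also have "\<dots> = ennreal (\<integral>y. w \<xi> \<theta> y \<partial>L)"
      by (rule nn_integral_eq_integral) (use intw[OF that] w0 in auto)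
    finally show ?thesis by (intro finite_measureI) (simp add: D_def)
  qed
  have D_char: "(\<integral>x. iexp (t * x) \<partial>D L \<xi> \<theta>) =
      (\<integral>y. indicator I y *\<^sub>R cis ((t *\<^sub>R c) \<bullet> y) \<partial>L) +
        ((cis \<theta> / 2) * (\<integral>y. indicator I y *\<^sub>R cis ((\<xi> + t *\<^sub>R c) \<bullet> y) \<partial>L)
        + (cis (-\<theta>) / 2) * (\<integral>y. indicator I y *\<^sub>R cis ((t *\<^sub>R c - \<xi>) \<bullet> y) \<partial>L))"
    if L: "finite_measure L" "sets L = sets borel" for L \<xi> \<theta> t
  proof -
    note [measurable_cong] = L(2)
    have "(\<integral>x. iexp (t * x) \<partial>D L \<xi> \<theta>) = (\<integral>y. w \<xi> \<theta> y *\<^sub>R iexp (t * (y \<bullet> c)) \<partial>L)"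
      unfolding D_def by (subst integral_distr) (auto simp: integral_density w0)
    then show ?thesis
      unfolding expand
      by (simp only: Bochner_Integration.integral_add Bochner_Integration.integrable_add
          integral_mult_right_zero integrable_mult_right int[OF L])
  qed
  \<comment> \<open>Equality of these measures on the line is what admits an arbitrary Borel
    constraint \<open>B c\<close> on the new coordinate.\<close>
  have D_eq: "D M \<xi> \<theta> = D N \<xi> \<theta>" for \<xi> \<theta>
  proof (rule finite_measure_char_unique)
    show "(\<integral>x. iexp (t * x) \<partial>D M \<xi> \<theta>) = (\<integral>x. iexp (t * x) \<partial>D N \<xi> \<theta>)" for t
      unfolding D_char[OF M] D_char[OF N] IH ..
  qed (use D_fin M N in \<open>auto simp: D_def\<close>)
  have w_eq: "(\<integral>y. indicator (B c) (y \<bullet> c) * w \<xi> \<theta> y \<partial>M) = (\<integral>y. indicator (B c) (y \<bullet> c) * w \<xi> \<theta> y \<partial>N)" for \<xi> \<theta>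
  proof -
    have "(\<integral>y. indicator (B c) (y \<bullet> c) * w \<xi> \<theta> y \<partial>L) = (\<integral>x. indicator (B c) x \<partial>D L \<xi> \<theta>)"
      if L: "sets L = sets borel" for L
    proof -
      note [measurable_cong] = L
      show ?thesis
        unfolding D_def
        by (subst integral_distr) (auto simp: integral_density w0 mult.commute)
    qed
    then show ?thesis using M N D_eq by metis
  qed
  have ind: "indicator (B c) (y \<bullet> c) * indicator I y = (indicator I' y :: real)" for y
    by (auto simp: I_def I'_def indicator_def)
  have [measurable]: "I' \<in> sets borel"
  proof -
    have "I' = I \<inter> ((\<lambda>y. y \<bullet> c) -` B c \<inter> space borel)" by (auto simp: I_def I'_def)
    then show ?thesis by (simp add: measurable_sets)
  qed
  have intc: "integrable L (\<lambda>y. indicator I' y * cos (\<xi> \<bullet> y + \<theta>))" "integrable L (\<lambda>y. indicator I' y :: real)"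
    if "finite_measure L" "sets L = sets borel" for L \<xi> \<theta>
  proof -
    interpret finite_measure L by fact
    note [measurable_cong] = that(2)
    show "integrable L (\<lambda>y. indicator I' y * cos (\<xi> \<bullet> y + \<theta>))"
         "integrable L (\<lambda>y. indicator I' y :: real)"
      by (rule integrable_const_bound[where B=1]; auto simp: indicator_def)+
  qed
  have wI: "(\<integral>y. indicator (B c) (y \<bullet> c) * w \<xi> \<theta> y \<partial>L) =
      (\<integral>y. indicator I' y \<partial>L) + (\<integral>y. indicator I' y * cos (\<xi> \<bullet> y + \<theta>) \<partial>L)"
    if "finite_measure L" "sets L = sets borel" for L \<xi> \<theta>
    unfolding w_def mult.assoc[symmetric] ind using intc[OF that]
    by (simp add: distrib_left)
  have s: "(\<integral>y. indicator I' y \<partial>M) + (\<integral>y. indicator I' y * cos (\<xi> \<bullet> y + \<theta>) \<partial>M) =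
      (\<integral>y. indicator I' y \<partial>N) + (\<integral>y. indicator I' y * cos (\<xi> \<bullet> y + \<theta>) \<partial>N)" for \<xi> \<theta>
    using w_eq wI M N by simp
  \<comment> \<open>At \<xi> = 0 and \<theta> = 0 the weight is 2 on \<open>I\<close>, which
    isolates the contribution of the 1 in 1 + cos, so that it can be subtracted in general.\<close>
  have base: "(\<integral>y. indicator I' y \<partial>M) = (\<integral>y. indicator I' y \<partial>N :: real)"
    using s[of 0 0] by simp
  have cos_eq: "(\<integral>y. indicator I' y * cos (\<xi> \<bullet> y + \<theta>) \<partial>M) = (\<integral>y. indicator I' y * cos (\<xi> \<bullet> y + \<theta>) \<partial>N)" for \<xi> \<theta>
    using s base by simp
  \<comment> \<open>The phases 0 and -pi/2 turn the cosine into the real and the imaginary part of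
    \<open>cis\<close>.\<close>
  have cpx: "(\<integral>y. indicator I' y *\<^sub>R cis (\<xi> \<bullet> y) \<partial>L) =
     Complex (\<integral>y. indicator I' y * cos (\<xi> \<bullet> y + 0) \<partial>L) (\<integral>y. indicator I' y * cos (\<xi> \<bullet> y + (-pi/2)) \<partial>L)"
    if L: "finite_measure L" "sets L = sets borel" for L
  proof -
    interpret finite_measure L by fact
    note [measurable_cong] = that(2)
    have i: "integrable L (\<lambda>y. indicator I' y *\<^sub>R cis (\<xi> \<bullet> y))"
      by (rule integrable_const_bound[where B=1]) (auto simp: indicator_def)
    have "cos (u - pi / 2) = sin u" for u :: real by (simp add: cos_diff)
    then show ?thesis
      by (simp add: complex_eq_iff integral_Re[OF i, symmetric] integral_Im[OF i, symmetric])
  qed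
  show ?case
    unfolding I'_def[symmetric] cpx[OF M] cpx[OF N] cos_eq ..
qed

text \<open>With the whole basis as index set and frequency 0, the preceding lemma gives equal mass
  to every open box, and boxes form an intersection-stable generator exhausted by cubes.\<close>

theorem euclidean_char_unique:
  fixes M N :: "'a::euclidean_space measure"
  assumes M: "finite_measure M" "sets M = sets borel" and N: "finite_measure N" "sets N = sets borel"
    and char_eq: "\<And>\<xi>. (\<integral>y. cis (\<xi> \<bullet> y) \<partial>M) = (\<integral>y. cis (\<xi> \<bullet> y) \<partial>N)"
  shows "M = N"
proof (rule measure_eqI_generator_eq[where \<Omega>=UNIV and E="range (\<lambda>(a, b). box a b)"
      and A="\<lambda>n. box (- (real n *\<^sub>R One)) (real n *\<^sub>R One)"])
  interpret M: finite_measure M by fact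
  interpret N: finite_measure N by fact
  note [measurable_cong] = M(2) N(2)
  fix X assume "X \<in> range (\<lambda>(a, b). box a b :: 'a set)"
  then obtain a b where X: "X = box a b" by auto
  let ?I = "{y::'a. \<forall>i\<in>Basis. y \<bullet> i \<in> {a \<bullet> i <..< b \<bullet> i}}"
  have I: "?I = X" by (auto simp: X box_def)
  have "(\<integral>y. indicator X y *\<^sub>R cis (0 \<bullet> y) \<partial>M) = (\<integral>y. indicator X y *\<^sub>R cis (0 \<bullet> y) \<partial>N)"
    using char_determines_boxes[OF M N char_eq finite_Basis, of "\<lambda>i. {a \<bullet> i <..< b \<bullet> i}" 0]
    unfolding I by simp
  then have "measure M X = measure N X"
    using M N X by (simp add: scaleR_conv_of_real sets_eq_imp_space_eq[OF M(2)] sets_eq_imp_space_eq[OF N(2)] del: of_bool_eq_iff)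
  then show "emeasure M X = emeasure N X"
    by (simp add: M.emeasure_eq_measure N.emeasure_eq_measure)
next
  show "Int_stable (range (\<lambda>(a, b). box a b :: 'a set))"
    by (force simp: Int_stable_def box_Int_box)
  show "sets M = sigma_sets UNIV (range (\<lambda>(a, b). box a b :: 'a set))"
       "sets N = sigma_sets UNIV (range (\<lambda>(a, b). box a b :: 'a set))"
    using M N by (simp_all add: borel_eq_box)
  show "(\<Union>i. box (- (real i *\<^sub>R One)) (real i *\<^sub>R One)) = (UNIV :: 'a set)"
    using UN_box_eq_UNIV by simp
  show "emeasure M (box (- (real i *\<^sub>R One)) (real i *\<^sub>R One)) \<noteq> \<infinity>" for i
    using finite_measure.emeasure_finite[OF M(1)] by simp
qed auto

section \<open>Isotropic stable distributions\<close>

text \<open>The Taylor remainder is at most t^4/24, hence at most t^2/6 for |t| \<le> 2, which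
  lowers 1/2 to 1/3. Reaching up to 2 lets a single frequency cover a whole dyadic shell.\<close>

lemma one_minus_cos_bounds:
  fixes t :: real
  shows "\<bar>t\<bar> \<le> 2 \<Longrightarrow> t\<^sup>2 / 3 \<le> 1 - cos t" and "1 - cos t \<le> t\<^sup>2 / 2"
proof -
  have c: "1 - cos t = 2 * (sin (t/2))\<^sup>2"
    using cos_double_sin[of "t/2"] by simp
  have "(sin (t/2))\<^sup>2 \<le> (t/2)\<^sup>2"
    using abs_sin_x_le_abs_x[of "t/2"] unfolding abs_le_square_iff .
  then show "1 - cos t \<le> t\<^sup>2 / 2" unfolding c by (simp add: power2_eq_square)
  assume t: "\<bar>t\<bar> \<le> 2"
  obtain u where u: "cos t = (\<Sum>m<4. cos_coeff m * t ^ m) + cos (u + 1/2 * real 4 * pi) / fact 4 * t ^ 4"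
    using Maclaurin_cos_expansion[of t 4] by blast
  have "(\<Sum>m<4. cos_coeff m * t ^ m) = 1 - t\<^sup>2 / 2"
  proof -
    have "{..<4::nat} = {0, 1, 2, 3}" by auto
    then show ?thesis by (simp add: cos_coeff_def fact_numeral)
  qed
  moreover have "cos (u + 1/2 * real 4 * pi) / fact 4 * t ^ 4 \<le> 1 / 24 * t ^ 4"
    by (intro mult_right_mono) (auto simp: fact_numeral)
  moreover have "t ^ 4 \<le> 4 * t\<^sup>2"
  proof -
    have "t\<^sup>2 \<le> 2\<^sup>2" using t abs_le_square_iff[of t 2] by simp
    then have "t\<^sup>2 * t\<^sup>2 \<le> 4 * t\<^sup>2" by (intro mult_right_mono) auto
    then show ?thesis by (simp add: power2_eq_square power4_eq_xxxx mult_ac)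
  qed
  ultimately show "t\<^sup>2 / 3 \<le> 1 - cos t" using u by linarith
qed

text \<open>The constant 3 of one dyadic shell, summed over the shells of inner radius 2^k R, whose
  bounds form a geometric series of ratio 2^(-\<alpha>).\<close>

definition tail_const :: "real \<Rightarrow> real" where
  "tail_const \<alpha> = 3 / (1 - 2 powr (-\<alpha>))"

lemma tail_const_pos: "0 < \<alpha> \<Longrightarrow> tail_const \<alpha> > 0"
  by (simp add: tail_const_def powr_less_one)

text \<open>The law of an increment over time \<open>h\<close>. The estimates depend on the law only
  through \<alpha> and \<open>h\<close>, which makes them uniform over starting points and
  grids.\<close>

locale stable_distribution = prob_space M
  for M :: "'b::euclidean_space measure" and \<alpha> h :: real +
  assumes sets_M: "sets M = sets borel"
    and index: "0 < \<alpha>" "\<alpha> < 2" and time: "0 < h"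
    and char: "\<And>\<xi>. (\<integral>y. cis (\<xi> \<bullet> y) \<partial>M) = complex_of_real (exp (- (h * norm \<xi> powr \<alpha>)))"
begin

declare sets_M [measurable_cong]

lemma space_M [simp]: "space M = UNIV"
  using sets_eq_imp_space_eq[OF sets_M] by simp

section \<open>Tails and truncated moments of one-dimensional projections\<close>

lemma integral_one_minus_cos: "(\<integral>y. 1 - cos (\<xi> \<bullet> y) \<partial>M) = 1 - exp (- (h * norm \<xi> powr \<alpha>))"
proof -
  have "integrable M (\<lambda>y. cis (\<xi> \<bullet> y))"
    by (rule integrable_const_bound[where B=1]) auto
  from integral_Re[OF this] have "(\<integral>y. cos (\<xi> \<bullet> y) \<partial>M) = exp (- (h * norm \<xi> powr \<alpha>))"
    by (simp add: char)
  moreover have "integrable M (\<lambda>y. cos (\<xi> \<bullet> y))"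
    by (rule integrable_const_bound[where B=1]) auto
  ultimately show ?thesis by (simp add: prob_space[simplified])
qed

lemma integrable_one_minus_cos: "integrable M (\<lambda>y. 1 - cos (\<xi> \<bullet> y))"
proof -
  have "integrable M (\<lambda>y. cos (\<xi> \<bullet> y))"
    by (rule integrable_const_bound[where B=1]) auto
  then show ?thesis by simp
qed

lemma integral_one_minus_cos_le: "(\<integral>y. 1 - cos (\<xi> \<bullet> y) \<partial>M) \<le> h * norm \<xi> powr \<alpha>"
  using exp_ge_add_one_self[of "- (h * norm \<xi> powr \<alpha>)"] by (simp add: integral_one_minus_cos)

lemma integrable_trunc_square:
  assumes "R > 0"
  shows "integrable M (\<lambda>y. indicator {y. \<bar>y \<bullet> b\<bar> \<le> R} y * (y \<bullet> b)\<^sup>2)"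
proof (rule integrable_const_bound[where B="R\<^sup>2"])
  have "\<bar>y \<bullet> b\<bar> \<le> R \<Longrightarrow> (y \<bullet> b)\<^sup>2 \<le> R\<^sup>2" for y
    using assms abs_le_square_iff[of "y \<bullet> b" R] by simp
  then show "AE y in M. norm (indicator {y. \<bar>y \<bullet> b\<bar> \<le> R} y * (y \<bullet> b)\<^sup>2) \<le> R\<^sup>2"
    by (auto simp: indicator_def)
qed simp

text \<open>At frequency 2/R the argument of the cosine stays in [-2, 2] on the whole slab, so 1 -
  cos dominates a multiple of the square there, while its expectation is at most h
  (2/R)^\<alpha>.\<close>

lemma trunc_square_le:
  assumes R: "R > 0" and b: "norm b = 1"
  shows "(\<integral>y. indicator {y. \<bar>y \<bullet> b\<bar> \<le> R} y * (y \<bullet> b)\<^sup>2 \<partial>M) \<le> 3 * h * R powr (2 - \<alpha>)"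
proof -
  have "(4 / (3 * R\<^sup>2)) * (\<integral>y. indicator {y. \<bar>y \<bullet> b\<bar> \<le> R} y * (y \<bullet> b)\<^sup>2 \<partial>M)
      = (\<integral>y. (4 / (3 * R\<^sup>2)) * (indicator {y. \<bar>y \<bullet> b\<bar> \<le> R} y * (y \<bullet> b)\<^sup>2) \<partial>M)"
    by simp
  also have "\<dots> \<le> (\<integral>y. 1 - cos (((2 / R) *\<^sub>R b) \<bullet> y) \<partial>M)"
  proof (rule integral_mono)
    fix y
    show "(4 / (3 * R\<^sup>2)) * (indicator {y. \<bar>y \<bullet> b\<bar> \<le> R} y * (y \<bullet> b)\<^sup>2) \<le> 1 - cos (((2 / R) *\<^sub>R b) \<bullet> y)"
    proof (cases "\<bar>y \<bullet> b\<bar> \<le> R")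
      case True
      then have "\<bar>2 / R * (y \<bullet> b)\<bar> \<le> 2" using R by (simp add: abs_mult field_simps)
      from one_minus_cos_bounds(1)[OF this] True R show ?thesis
        by (simp add: power2_eq_square inner_commute field_simps)
    qed simp
  qed (intro integrable_mult_right integrable_trunc_square R integrable_one_minus_cos)+
  also have "\<dots> \<le> h * (2 / R) powr \<alpha>"
    using integral_one_minus_cos_le[of "(2 / R) *\<^sub>R b"] R b by simp
  finally have "(\<integral>y. indicator {y. \<bar>y \<bullet> b\<bar> \<le> R} y * (y \<bullet> b)\<^sup>2 \<partial>M) \<le> (3 * R\<^sup>2 / 4) * (h * (2 / R) powr \<alpha>)"
    using R by (simp add: field_simps)
  also have "\<dots> = 3 / 4 * 2 powr \<alpha> * (h * R powr (2 - \<alpha>))"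
    using R by (simp add: powr_divide powr_diff)
  also have "\<dots> \<le> 3 * (h * R powr (2 - \<alpha>))"
  proof (rule mult_right_mono)
    show "3 / 4 * 2 powr \<alpha> \<le> (3::real)"
      using powr_mono[of \<alpha> 2 2] index by simp
  qed (use time in simp)
  finally show ?thesis by simp
qed

text \<open>At frequency 1/R the argument of the cosine has modulus between 1 and 2 on the shell, so
  1 - cos is at least 1/3 there.\<close>

lemma dyadic_le:
  assumes R: "R > 0" and b: "norm b = 1"
  shows "measure M {y. R \<le> \<bar>y \<bullet> b\<bar> \<and> \<bar>y \<bullet> b\<bar> \<le> 2 * R} \<le> 3 * h * R powr (-\<alpha>)"
proof -
  have "(1/3) * measure M {y. R \<le> \<bar>y \<bullet> b\<bar> \<and> \<bar>y \<bullet> b\<bar> \<le> 2 * R}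
     = (\<integral>y. (1/3) * indicator {y. R \<le> \<bar>y \<bullet> b\<bar> \<and> \<bar>y \<bullet> b\<bar> \<le> 2 * R} y \<partial>M)"
    by simp
  also have "\<dots> \<le> (\<integral>y. 1 - cos (((1 / R) *\<^sub>R b) \<bullet> y) \<partial>M)"
  proof (rule integral_mono)
    show "integrable M (\<lambda>y. (1/3) * indicator {y. R \<le> \<bar>y \<bullet> b\<bar> \<and> \<bar>y \<bullet> b\<bar> \<le> 2 * R} y :: real)"
      by (intro integrable_mult_right integrable_real_indicator) (auto simp: emeasure_eq_measure)
    fix y
    show "(1/3) * indicator {y. R \<le> \<bar>y \<bullet> b\<bar> \<and> \<bar>y \<bullet> b\<bar> \<le> 2 * R} y \<le> 1 - cos (((1 / R) *\<^sub>R b) \<bullet> y)"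
    proof (cases "R \<le> \<bar>y \<bullet> b\<bar> \<and> \<bar>y \<bullet> b\<bar> \<le> 2 * R")
      case True
      then have *: "\<bar>1 / R * (y \<bullet> b)\<bar> \<le> 2" "1 \<le> \<bar>1 / R * (y \<bullet> b)\<bar>" using R by (simp_all add: abs_mult field_simps)
      from *(2) have "1 \<le> (1 / R * (y \<bullet> b))\<^sup>2" using abs_le_square_iff[of 1 "1 / R * (y \<bullet> b)"] by simp
      with one_minus_cos_bounds(1)[OF *(1)] True show ?thesis
        by (simp add: inner_commute)
    qed simp
  qed (rule integrable_one_minus_cos)
  also have "\<dots> \<le> h * (1 / R) powr \<alpha>"
    using integral_one_minus_cos_le[of "(1 / R) *\<^sub>R b"] R b by simp
  finally show ?thesis using R by (simp add: powr_divide powr_minus field_simps)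
qed

lemma tail_le:
  assumes R: "R > 0" and b: "norm b = 1"
  shows "measure M {y. R \<le> \<bar>y \<bullet> b\<bar>} \<le> tail_const \<alpha> * h * R powr (-\<alpha>)"
proof -
  define A where "A k = {y. 2^k * R \<le> \<bar>y \<bullet> b\<bar> \<and> \<bar>y \<bullet> b\<bar> \<le> 2 * (2^k * R)}" for k :: nat
  have [measurable]: "A k \<in> sets M" for k
    unfolding A_def by measurable
  have sub: "{y. R \<le> \<bar>y \<bullet> b\<bar>} \<subseteq> (\<Union>k. A k)"
  proof
    fix y assume "y \<in> {y. R \<le> \<bar>y \<bullet> b\<bar>}"
    then have 1: "1 \<le> \<bar>y \<bullet> b\<bar> / R" using R by simp
    obtain n where n: "\<bar>y \<bullet> b\<bar> / R < 2 ^ n" using real_arch_pow[of 2 "\<bar>y \<bullet> b\<bar> / R"] by auto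
    \<comment> \<open>The shell of \<open>y\<close> is the predecessor of the least exponent whose
      power of two exceeds the ratio; this exponent is not 0 because the ratio is at least
      1.\<close>
    define m where "m = (LEAST n. \<bar>y \<bullet> b\<bar> / R < 2 ^ n)"
    have m: "\<bar>y \<bullet> b\<bar> / R < 2 ^ m" unfolding m_def by (rule LeastI[of _ n]) (rule n)
    have "m \<noteq> 0" using m 1 by (intro notI) simp
    then obtain k where k: "m = Suc k" using not0_implies_Suc by blast
    have "\<not> \<bar>y \<bullet> b\<bar> / R < 2 ^ k" 
      using not_less_Least[of k "\<lambda>n. \<bar>y \<bullet> b\<bar> / R < 2 ^ n"] k unfolding m_def by simp
    then have "y \<in> A k" using m k R by (auto simp: A_def field_simps)
    then show "y \<in> (\<Union>k. A k)" by blast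
  qed
  have le: "measure M (A k) \<le> 3 * h * R powr (-\<alpha>) * (2 powr (-\<alpha>)) ^ k" for k
  proof -
    have "measure M (A k) \<le> 3 * h * (2^k * R) powr (-\<alpha>)"
      unfolding A_def by (rule dyadic_le) (use R b in auto)
    also have "\<dots> = 3 * h * R powr (-\<alpha>) * (2 powr (-\<alpha>)) ^ k"
      using R by (simp add: powr_mult powr_realpow[symmetric] powr_powr mult.commute)
    finally show ?thesis .
  qed
  have q: "2 powr (-\<alpha>) < (1::real)" using index by (simp add: powr_less_one)
  have sm: "(\<lambda>k. 3 * h * R powr (-\<alpha>) * (2 powr (-\<alpha>)) ^ k) sums (3 * h * R powr (-\<alpha>) * (1 / (1 - 2 powr (-\<alpha>))))"
    by (intro sums_mult geometric_sums) (use q in simp)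
  have sA: "summable (\<lambda>k. measure M (A k))"
    by (rule summable_comparison_test'[OF sums_summable[OF sm], where N=0]) (use le in auto)
  have "measure M {y. R \<le> \<bar>y \<bullet> b\<bar>} \<le> measure M (\<Union>k. A k)"
    by (rule finite_measure_mono[OF sub]) measurable
  also have "\<dots> \<le> (\<Sum>k. measure M (A k))"
    by (rule finite_measure_subadditive_countably) (use sA in auto)
  also have "\<dots> \<le> 3 * h * R powr (-\<alpha>) * (1 / (1 - 2 powr (-\<alpha>)))"
    unfolding sums_unique[OF sm] by (intro suminf_le le sA sums_summable[OF sm])
  finally show ?thesis by (simp add: tail_const_def mult_ac)
qed

text \<open>The norm is at most the sum of the moduli of the coordinates, so some coordinate reaches
  R divided by the dimension. In the cube, one factor counts coordinates and two bound the dimension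
  to the power \<alpha> < 2.\<close>

lemma norm_tail_le:
  assumes R: "R > 0"
  shows "measure M {y. R \<le> norm y} \<le> real DIM('b) ^ 3 * tail_const \<alpha> * h * R powr (-\<alpha>)"
proof -
  let ?D = "real DIM('b)"
  have D: "?D \<ge> 1" by (simp add: Suc_leI)
  have "{y::'b. R \<le> norm y} \<subseteq> (\<Union>b\<in>Basis. {y. R / ?D \<le> \<bar>y \<bullet> b\<bar>})"
  proof (rule ccontr)
    assume "\<not> ?thesis"
    then obtain y :: 'b where y: "R \<le> norm y" "\<And>b. b \<in> Basis \<Longrightarrow> \<bar>y \<bullet> b\<bar> < R / ?D"
      unfolding subset_eq by (simp add: not_le) blast
    have "norm y \<le> (\<Sum>b\<in>Basis. \<bar>y \<bullet> b\<bar>)" by (rule norm_le_l1)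
    also have "\<dots> < (\<Sum>b\<in>(Basis::'b set). R / ?D)"
      by (rule sum_strict_mono) (use y in auto)
    also have "\<dots> = R" by simp
    finally show False using y by simp
  qed
  then have "measure M {y. R \<le> norm y} \<le> measure M (\<Union>b\<in>Basis. {y. R / ?D \<le> \<bar>y \<bullet> b\<bar>})"
    by (rule finite_measure_mono, intro sets.finite_UN finite_Basis) measurable
  also have "\<dots> \<le> (\<Sum>b\<in>Basis. measure M {y. R / ?D \<le> \<bar>y \<bullet> b\<bar>})"
    by (rule finite_measure_subadditive_finite) auto
  also have "\<dots> \<le> (\<Sum>b\<in>(Basis::'b set). tail_const \<alpha> * h * (R / ?D) powr (-\<alpha>))"
    by (intro sum_mono tail_le) (use R D in auto)
  also have "\<dots> = tail_const \<alpha> * h * R powr (-\<alpha>) * (?D * ?D powr \<alpha>)"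
    using R D by (simp add: powr_divide powr_minus field_simps)
  also have "\<dots> \<le> tail_const \<alpha> * h * R powr (-\<alpha>) * (?D * ?D\<^sup>2)"
    using powr_mono[of \<alpha> 2 ?D] index D tail_const_pos[OF index(1)] time
    by (intro mult_left_mono) auto
  finally show ?thesis by (simp add: power3_eq_cube power2_eq_square mult_ac)
qed

lemma tail_ge:
  assumes R: "R > 0" and b: "norm b = 1" and hR: "h \<le> R powr \<alpha>"
  shows "((1/6) powr (\<alpha> / (2 - \<alpha>)) / 8) * h * R powr (-\<alpha>) \<le> measure M {y. R \<le> \<bar>y \<bullet> b\<bar>}"
proof -
  \<comment> \<open>For a frequency \<open>\<epsilon> / R\<close> with small \<open>\<epsilon>\<close>, the truncated second moment, of order \<open>\<epsilon>\<^sup>2\<close>, is beaten by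
    the exponent of the characteristic function, of order \<open>\<epsilon>\<^bsup>\<alpha>\<^esup>\<close>.\<close>
  define \<epsilon> where "\<epsilon> = (1/6::real) powr (1 / (2 - \<alpha>))"
  have \<epsilon>: "0 < \<epsilon>" "\<epsilon> \<le> 1" unfolding \<epsilon>_def using index by (auto intro: powr_le1)
  have \<epsilon>2: "\<epsilon>\<^sup>2 = \<epsilon> powr \<alpha> / 6"
  proof -
    have "\<epsilon> powr (2 - \<alpha>) = 1/6" unfolding \<epsilon>_def using index by (simp add: powr_powr)
    then have "\<epsilon> powr \<alpha> / 6 = \<epsilon> powr \<alpha> * \<epsilon> powr (2 - \<alpha>)" by simp
    also have "\<dots> = \<epsilon> powr 2" by (simp add: powr_add[symmetric])
    finally show ?thesis using \<epsilon> by simp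
  qed
  let ?x = "h * (\<epsilon> / R) powr \<alpha>"
  have x: "?x = \<epsilon> powr \<alpha> * (h * R powr (-\<alpha>))" using R \<epsilon> by (simp add: powr_divide powr_minus field_simps)
  have x01: "0 \<le> ?x" "?x \<le> 1"
  proof -
    have "h * R powr (-\<alpha>) \<le> 1" using hR R by (simp add: powr_minus field_simps)
    moreover have "\<epsilon> powr \<alpha> \<le> 1" using \<epsilon> index by (intro powr_le1) auto
    ultimately show "?x \<le> 1" unfolding x using time mult_mono[of "\<epsilon> powr \<alpha>" 1 "h * R powr (-\<alpha>)" 1] by simp
  qed (use time in simp)
  \<comment> \<open>The hypothesis \<open>hR\<close> gives \<open>?x\<close> \<le> 1, the range in
    which 1 - exp(-x) keeps half of its linear term.\<close>
  have "?x / 2 \<le> 1 - exp (- ?x)"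
  proof -
    have "exp (- ?x) \<le> 1 / (1 + ?x)"
      using exp_ge_add_one_self[of ?x] x01(1) by (simp add: exp_minus inverse_eq_divide frac_le)
    moreover have "?x / 2 \<le> 1 - 1 / (1 + ?x)"
      using x01 mult_left_mono[OF x01(2) x01(1)] by (simp add: field_simps)
    ultimately show ?thesis by linarith
  qed
  also have "1 - exp (- ?x) = (\<integral>y. 1 - cos (((\<epsilon> / R) *\<^sub>R b) \<bullet> y) \<partial>M)"
    unfolding integral_one_minus_cos using \<epsilon> R b by simp
  also have "\<dots> \<le> (\<integral>y. (\<epsilon>\<^sup>2 / (2 * R\<^sup>2)) * (indicator {y. \<bar>y \<bullet> b\<bar> \<le> R} y * (y \<bullet> b)\<^sup>2)
       + 2 * indicator {y. R \<le> \<bar>y \<bullet> b\<bar>} y \<partial>M)"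
  proof (rule integral_mono)
    show "integrable M (\<lambda>y. (\<epsilon>\<^sup>2 / (2 * R\<^sup>2)) * (indicator {y. \<bar>y \<bullet> b\<bar> \<le> R} y * (y \<bullet> b)\<^sup>2)
       + 2 * indicator {y. R \<le> \<bar>y \<bullet> b\<bar>} y)"
      by (intro Bochner_Integration.integrable_add integrable_mult_right integrable_trunc_square R
          integrable_real_indicator) (auto simp: emeasure_eq_measure)
    fix y
    have "1 - cos (((\<epsilon> / R) *\<^sub>R b) \<bullet> y) \<le> 2"
      using cos_ge_minus_one[of "((\<epsilon> / R) *\<^sub>R b) \<bullet> y"] by linarith
    moreover have "1 - cos (((\<epsilon> / R) *\<^sub>R b) \<bullet> y) \<le> \<epsilon>\<^sup>2 / (2 * R\<^sup>2) * (y \<bullet> b)\<^sup>2"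
      using one_minus_cos_bounds(2)[of "((\<epsilon> / R) *\<^sub>R b) \<bullet> y"]
      by (simp add: power_mult_distrib power_divide inner_commute)
    moreover have "0 \<le> \<epsilon>\<^sup>2 / (2 * R\<^sup>2) * (y \<bullet> b)\<^sup>2" by simp
    ultimately show "1 - cos (((\<epsilon> / R) *\<^sub>R b) \<bullet> y) \<le> (\<epsilon>\<^sup>2 / (2 * R\<^sup>2)) * (indicator {y. \<bar>y \<bullet> b\<bar> \<le> R} y * (y \<bullet> b)\<^sup>2)
       + 2 * indicator {y. R \<le> \<bar>y \<bullet> b\<bar>} y"
      by (auto simp: indicator_def)
  qed (rule integrable_one_minus_cos)
  also have "\<dots> = (\<epsilon>\<^sup>2 / (2 * R\<^sup>2)) * (\<integral>y. indicator {y. \<bar>y \<bullet> b\<bar> \<le> R} y * (y \<bullet> b)\<^sup>2 \<partial>M)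
       + 2 * measure M {y. R \<le> \<bar>y \<bullet> b\<bar>}"
    by (subst Bochner_Integration.integral_add)
      (auto intro!: integrable_trunc_square R integrable_real_indicator simp: emeasure_eq_measure)
  \<comment> \<open>By the choice of \<epsilon> the truncated second moment uses up a quarter of
    \<open>?x\<close>; the other quarter of the lower bound must come from twice the tail
    probability.\<close>
  also have "(\<epsilon>\<^sup>2 / (2 * R\<^sup>2)) * (\<integral>y. indicator {y. \<bar>y \<bullet> b\<bar> \<le> R} y * (y \<bullet> b)\<^sup>2 \<partial>M)
       \<le> (\<epsilon>\<^sup>2 / (2 * R\<^sup>2)) * (3 * h * R powr (2 - \<alpha>))"
    by (intro mult_left_mono trunc_square_le R b) auto
  also have "\<dots> = ?x / 4"
    unfolding x \<epsilon>2 using R by (simp add: powr_diff powr_minus field_simps)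
  finally have "?x / 8 \<le> measure M {y. R \<le> \<bar>y \<bullet> b\<bar>}" by simp
  moreover have "\<epsilon> powr \<alpha> = (1/6) powr (\<alpha> / (2 - \<alpha>))"
    unfolding \<epsilon>_def by (simp add: powr_powr)
  ultimately show ?thesis unfolding x by simp
qed

text \<open>An orthogonal map changes the frequency but not its norm, and the characteristic
  function sees only the norm. This is the purpose of \<open>euclidean_char_unique\<close>.\<close>

lemma orthogonal_invariant:
  assumes f: "orthogonal_transformation f"
  shows "distr M borel f = M"
proof (rule euclidean_char_unique)
  have lin: "linear f" using f by (simp add: orthogonal_transformation_def)
  have bij: "bij f" using f by (rule orthogonal_transformation_bij)
  have fm [measurable]: "f \<in> borel_measurable borel"
    using lin by (intro borel_measurable_continuous_onI linear_continuous_on linear_conv_bounded_linear[THEN iffD1])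
  interpret D: prob_space "distr M borel f" by (rule prob_space_distr) simp
  show "finite_measure (distr M borel f)" "finite_measure M" by unfold_locales
  show "(\<integral>y. cis (\<xi> \<bullet> y) \<partial>distr M borel f) = (\<integral>y. cis (\<xi> \<bullet> y) \<partial>M)" for \<xi>
  proof -
    obtain \<eta> where \<eta>: "\<xi> = f \<eta>" using bij by (metis bij_pointE)
    have "(\<integral>y. cis (\<xi> \<bullet> y) \<partial>distr M borel f) = (\<integral>y. cis (\<eta> \<bullet> y) \<partial>M)"
      using f by (subst integral_distr) (auto simp: \<eta> orthogonal_transformation_def)
    also have "\<dots> = (\<integral>y. cis (\<xi> \<bullet> y) \<partial>M)"
      unfolding char \<eta> using orthogonal_transformation_norm[OF f] by simp
    finally show ?thesis .
  qed
qed (simp_all add: sets_M)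

lemma symmetric: "distr M borel uminus = M"
  by (rule orthogonal_invariant) (simp add: orthogonal_transformation_def linear_iff)

text \<open>Removes the first-order term of expansions over a symmetric range; without this
  cancellation that term need not be of order \<open>h\<close>.\<close>

lemma integral_odd_eq_0:
  fixes g :: "'b \<Rightarrow> real"
  assumes [measurable]: "g \<in> borel_measurable borel" and odd: "\<And>y. g (- y) = - g y"
  shows "(\<integral>y. g y \<partial>M) = 0"
proof -
  have "(\<integral>y. g y \<partial>M) = (\<integral>y. g y \<partial>distr M borel uminus)" by (simp only: symmetric)
  also have "\<dots> = (\<integral>y. - g y \<partial>M)" by (subst integral_distr) (auto simp: odd)
  finally show ?thesis by simp
qed

end

section \<open>Congruent cones and jumps close to the first axis\<close>

lemma reflection_exists:
  fixes u v :: "'a::euclidean_space"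
  assumes "norm u = norm v"
  obtains f where "orthogonal_transformation f" "f u = v" "f v = u"
proof (cases "u = v")
  case True
  then show ?thesis using that[of id] by (simp add: orthogonal_transformation_def linear_id)
next
  case False
  \<comment> \<open>The Householder reflection in the hyperplane orthogonal to u - v interchanges u
    and v because their norms agree.\<close>
  define w where "w = u - v"
  have w: "w \<bullet> w \<noteq> 0" using False by (simp add: w_def)
  define f where "f y = y - (2 * (w \<bullet> y) / (w \<bullet> w)) *\<^sub>R w" for y
  have uv: "u \<bullet> u = v \<bullet> v" using assms by (simp add: norm_eq_sqrt_inner)
  have "2 * (w \<bullet> u) = w \<bullet> w" "2 * (w \<bullet> v) = - (w \<bullet> w)"
    using uv by (simp_all add: w_def inner_diff_left inner_diff_right inner_commute)
  then have "f u = v" "f v = u" using w by (simp_all add: f_def w_def)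
  moreover have "orthogonal_transformation f"
    unfolding orthogonal_transformation_def
  proof
    show "linear f"
      by (rule linearI) (simp_all add: f_def inner_add_right algebra_simps add_divide_distrib)
    show "\<forall>x y. f x \<bullet> f y = x \<bullet> y"
    proof (intro allI)
      fix x y
      show "f x \<bullet> f y = x \<bullet> y"
        using w by (simp add: f_def inner_diff_left inner_diff_right inner_commute[of x w])
    qed
  qed
  ultimately show ?thesis using that by blast
qed

text \<open>For a unit vector \<open>u\<close> and \<epsilon> > 0 this is the solid half-cone about
  \<open>u\<close> whose angle with the axis has tangent \<epsilon>. The vertex 0 is common to all
  of them.\<close>

definition circular_cone :: "real \<Rightarrow> 'a::real_inner \<Rightarrow> 'a set" where
  "circular_cone \<epsilon> u = {y. norm (y - (y \<bullet> u) *\<^sub>R u) \<le> \<epsilon> * (y \<bullet> u)}"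

lemma orthogonal_transformation_circular_cone:
  assumes f: "orthogonal_transformation f" and "f u = v"
  shows "f y \<in> circular_cone \<epsilon> v \<longleftrightarrow> y \<in> circular_cone \<epsilon> u"
proof -
  have l: "linear f" and i: "f y \<bullet> v = y \<bullet> u" using f assms(2) unfolding orthogonal_transformation_def by auto
  have "f y - (f y \<bullet> v) *\<^sub>R v = f (y - (y \<bullet> u) *\<^sub>R u)"
    by (simp add: linear_diff[OF l] linear_scale[OF l] assms(2) i)
  then show ?thesis
    by (simp add: circular_cone_def i orthogonal_transformation_norm[OF f])
qed

lemma circular_cone_measurable [measurable]: "circular_cone \<epsilon> u \<in> sets (borel :: 'a::euclidean_space measure)"
  unfolding circular_cone_def by measurable

text \<open>Reflections carry the cones into each other, so they have equal mass outside the ball of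
  radius R; there they are disjoint, as R > 0 removes the common vertex.\<close>

lemma (in stable_distribution) cone_packing:
  fixes U :: "'b set"
  assumes U: "finite U" "\<And>u. u \<in> U \<Longrightarrow> norm u = 1" and u0: "norm u0 = 1" and R: "R > 0"
    and disj: "\<And>u v y. u \<in> U \<Longrightarrow> v \<in> U \<Longrightarrow> y \<in> circular_cone \<epsilon> u \<Longrightarrow> y \<in> circular_cone \<epsilon> v \<Longrightarrow> y \<noteq> 0 \<Longrightarrow> u = v"
  shows "card U * measure M ({y. R \<le> norm y} \<inter> circular_cone \<epsilon> u0) \<le> measure M {y. R \<le> norm y}"
proof -
  let ?C = "\<lambda>u. {y. R \<le> norm y} \<inter> circular_cone \<epsilon> u"
  have eq: "measure M (?C u) = measure M (?C u0)" if u: "u \<in> U" for u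
  proof -
    obtain f where f: "orthogonal_transformation f" "f u = u0"
      using reflection_exists[of u u0] U(2)[OF u] u0 by metis
    have [measurable]: "f \<in> borel_measurable borel"
      using f by (intro borel_measurable_continuous_onI linear_continuous_on linear_conv_bounded_linear[THEN iffD1])
       (simp add: orthogonal_transformation_def)
    have "measure M (?C u0) = measure (distr M borel f) (?C u0)"
      by (simp only: orthogonal_invariant[OF f(1)])
    also have "\<dots> = measure M (f -` ?C u0 \<inter> space M)" by (rule measure_distr) auto
    also have "f -` ?C u0 \<inter> space M = ?C u"
      using orthogonal_transformation_circular_cone[OF f] orthogonal_transformation_norm[OF f(1)] by auto
    finally show ?thesis by simp
  qed
  have "card U * measure M (?C u0) = (\<Sum>u\<in>U. measure M (?C u))" by (simp add: eq)
  also have "\<dots> = measure M (\<Union>u\<in>U. ?C u)"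
  proof (rule finite_measure_finite_Union[symmetric])
    show "disjoint_family_on ?C U"
      using disj R unfolding disjoint_family_on_def by fastforce
  qed (use U in auto)
  also have "\<dots> \<le> measure M {y. R \<le> norm y}"
    by (rule finite_measure_mono) auto
  finally show ?thesis .
qed

lemma card_bounded_functions: "card {k :: 'n::finite \<Rightarrow> nat. \<forall>i. k i < m} = m ^ CARD('n)"
proof -
  have eq: "PiE (UNIV :: 'n set) (\<lambda>_. {..<m}) = {k. \<forall>i. k i < m}"
    by (simp add: PiE_UNIV_domain Pi_def)
  show ?thesis
    unfolding eq[symmetric] by (subst card_PiE) simp_all
qed

text \<open>Write y = a u + z with \<open>u\<close> the axis and |z| \<le> \<epsilon> a. Since |(1,
  w)| \<le> D and \<epsilon> \<le> 1/(2D), the first coordinate is at least a/(2D), so the slope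
  \<open>snd y / fst y\<close> is close to \<open>w\<close>. This separates cones whose axes have
  different slopes.\<close>

lemma cone_slope:
  fixes y :: "real \<times> (real ^ 'n)" and w :: "real ^ 'n"
  defines "D \<equiv> 1 + real CARD('n)"
  assumes y: "y \<in> circular_cone \<epsilon> ((1 / norm (1::real, w)) *\<^sub>R (1, w))" "y \<noteq> 0"
    and \<epsilon>: "0 < \<epsilon>" "\<epsilon> \<le> 1 / (2 * D)" and w: "norm w \<le> real CARD('n)"
  shows "fst y > 0" "norm (snd y - fst y *\<^sub>R w) \<le> 2 * D\<^sup>2 * \<epsilon> * fst y"
proof -
  define v where "v = (1::real, w)"
  define u where "u = (1 / norm v) *\<^sub>R v"
  define a where "a = y \<bullet> u"
  define z where "z = y - a *\<^sub>R u"
  have D1: "D \<ge> 1" by (simp add: D_def)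
  have nv: "norm v \<le> D"
    using norm_Pair_le[of "1::real" w] w norm_one[where 'a=real] unfolding v_def D_def by linarith
  have nv0: "norm v > 0" by (simp add: v_def zero_prod_def)
  have z: "norm z \<le> \<epsilon> * a" using y by (simp add: circular_cone_def z_def a_def u_def v_def)
  have a0: "a > 0"
  proof (rule ccontr)
    assume "\<not> a > 0"
    moreover have "0 \<le> \<epsilon> * a" using norm_ge_zero[of z] z by linarith
    ultimately have "a = 0" using \<epsilon>(1) by (simp add: zero_le_mult_iff)
    then show False using z y(2) by (simp add: z_def)
  qed
  have fy: "fst y = a / norm v + fst z" and sy: "snd y = (a / norm v) *\<^sub>R w + snd z"
    by (simp_all add: z_def u_def v_def)
  have fz: "\<bar>fst z\<bar> \<le> \<epsilon> * a" and sz: "norm (snd z) \<le> \<epsilon> * a"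
proof -
    have "\<bar>fst z\<bar> \<le> norm z" by (metis norm_fst_le prod.collapse real_norm_def)
    moreover have "norm (snd z) \<le> norm z" by (metis norm_snd_le prod.collapse)
    ultimately show "\<bar>fst z\<bar> \<le> \<epsilon> * a" "norm (snd z) \<le> \<epsilon> * a" using z by auto
  qed
  have "a / D \<le> a / norm v" using a0 nv nv0 by (simp add: frac_le)
  moreover have "\<epsilon> * a \<le> a / (2 * D)" using mult_right_mono[OF \<epsilon>(2), of a] a0 by simp
  ultimately have fy2: "a / (2 * D) \<le> fst y"
  proof -
    have "a / D = a / (2 * D) + a / (2 * D)" by simp
    moreover assume "a / D \<le> a / norm v" "\<epsilon> * a \<le> a / (2 * D)"
    ultimately show ?thesis using fy fz by linarith
  qed
  then show "fst y > 0" using a0 D1 by (smt (verit) divide_pos_pos)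
  have "snd y - fst y *\<^sub>R w = snd z - fst z *\<^sub>R w" by (simp add: fy sy algebra_simps)
  also have "norm \<dots> \<le> norm (snd z) + \<bar>fst z\<bar> * norm w"
    using norm_triangle_ineq4[of "snd z" "fst z *\<^sub>R w"] by simp
  also have "\<dots> \<le> \<epsilon> * a + (\<epsilon> * a) * real CARD('n)"
    using sz fz w a0 \<epsilon> by (intro add_mono mult_mono) auto
  also have "\<dots> = D * \<epsilon> * a" by (simp add: D_def algebra_simps)
  also have "\<dots> \<le> D * \<epsilon> * (2 * D * fst y)"
    using fy2 D1 \<epsilon> by (intro mult_left_mono) (auto simp: field_simps)
  finally show "norm (snd y - fst y *\<^sub>R w) \<le> 2 * D\<^sup>2 * \<epsilon> * fst y"
    by (simp add: power2_eq_square mult_ac)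
qed

text \<open>The base 10 (1 + n)^2 is 2 \<kappa> / \<epsilon> for the mesh \<kappa> in
  \<open>cone_tail_le\<close>; the other factor is the constant of \<open>norm_tail_le\<close> in
  dimension 1 + n.\<close>

definition cone_const :: "nat \<Rightarrow> real \<Rightarrow> real" where
  "cone_const n \<alpha> = (10 * (1 + real n)\<^sup>2) ^ n * ((1 + real n) ^ 3 * tail_const \<alpha>)"

lemma cone_const_pos: "0 < \<alpha> \<Longrightarrow> cone_const n \<alpha> > 0"
  unfolding cone_const_def using tail_const_pos[of \<alpha>] by (intro mult_pos_pos zero_less_power) auto

text \<open>For small \<epsilon> the cone about the first axis is congruent to about \<epsilon>^(-n)
  disjoint cones, so it receives a share of order at most \<epsilon>^n of the norm tail. This takes
  the place of a bound for the density of long jumps.\<close>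

lemma cone_tail_le:
  fixes M :: "(real \<times> (real ^ 'n)) measure"
  assumes "stable_distribution M \<alpha> h" and R: "R > 0" and \<epsilon>: "\<epsilon> > 0"
  shows "measure M {y. R \<le> fst y \<and> norm (snd y) \<le> \<epsilon> * fst y}
      \<le> cone_const CARD('n) \<alpha> * \<epsilon> ^ CARD('n) * h * R powr (-\<alpha>)"
proof -
  interpret stable_distribution M \<alpha> h by fact
  define n where "n = CARD('n)"
  define D where "D = 1 + real n"
  define T where "T = D ^ 3 * tail_const \<alpha> * h * R powr (-\<alpha>)"
  define u0 where "u0 = (1::real, 0::real ^ 'n)"
  have D1: "D \<ge> 1" by (simp add: D_def)
  have DIM: "real DIM(real \<times> (real ^ 'n)) = D" by (simp add: D_def n_def)
  have T0: "T \<ge> 0" unfolding T_def using D1 tail_const_pos[OF index(1)] time by (intro mult_nonneg_nonneg) auto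
  have c0: "{y. R \<le> fst y \<and> norm (snd y) \<le> \<epsilon> * fst y} \<subseteq> {y. R \<le> norm y} \<inter> circular_cone \<epsilon> u0"
  proof
    fix y :: "real \<times> (real ^ 'n)" assume "y \<in> {y. R \<le> fst y \<and> norm (snd y) \<le> \<epsilon> * fst y}"
    then have y: "R \<le> fst y" "norm (snd y) \<le> \<epsilon> * fst y" by auto
    have "\<bar>fst y\<bar> \<le> norm y" by (metis norm_fst_le prod.collapse real_norm_def)
    then have "R \<le> norm y" using y by linarith
    moreover have "y - (y \<bullet> u0) *\<^sub>R u0 = (0, snd y)" "y \<bullet> u0 = fst y"
      by (simp_all add: u0_def prod_eq_iff inner_prod_def)
    ultimately show "y \<in> {y. R \<le> norm y} \<inter> circular_cone \<epsilon> u0"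
      using y by (simp add: circular_cone_def)
  qed
  let ?P = "measure M ({y. R \<le> norm y} \<inter> circular_cone \<epsilon> u0)"
  have full: "measure M {y. R \<le> norm y} \<le> T"
    using norm_tail_le[OF R] unfolding T_def DIM .
  \<comment> \<open>The packing uses directions whose slopes lie on a grid of mesh \<open>\<kappa>\<close>. By \<open>cone_slope\<close>, two of their cones can
    only meet if the slopes differ by at most \<open>4 D\<^sup>2 \<epsilon> < \<kappa>\<close>.\<close>
  define \<kappa> where "\<kappa> = 5 * D\<^sup>2 * \<epsilon>"
  have \<kappa>0: "\<kappa> > 0" using D1 \<epsilon> by (simp add: \<kappa>_def)
  have "?P \<le> (2 * \<kappa>) ^ n * T"
  \<comment> \<open>For \<kappa> > 1 the factor (2 \<kappa>)^n is at least 1, and the whole norm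
    tail is already a good enough bound.\<close>
  proof (cases "\<kappa> \<le> 1")
    case False
    have "?P \<le> measure M {y. R \<le> norm y}" by (rule finite_measure_mono) auto
    also note full
    also have "T \<le> (2 * \<kappa>) ^ n * T" using mult_right_mono[OF one_le_power[of "2 * \<kappa>" n] T0] False by simp
    finally show ?thesis .
  next
    case True
    \<comment> \<open>Indices below \<open>m\<close> keep all coordinates of the slopes in [0, 1],
      which gives the norm bound of \<open>cone_slope\<close>. Rounding down loses at most a factor
      2, the 2 in (2 \<kappa>)^n.\<close>
    define m where "m = nat \<lfloor>1 / \<kappa>\<rfloor>"
    have "1 \<le> 1 / \<kappa>" using True \<kappa>0 by simp
    then have "1 \<le> \<lfloor>1 / \<kappa>\<rfloor>" by linarith
    then have m: "real m \<le> 1 / \<kappa>" "1 / \<kappa> < real m + 1" "1 \<le> m"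
      unfolding m_def by linarith+
    then have m2: "1 / (2 * \<kappa>) \<le> real m" by simp
    define w where "w k = (\<chi> i. \<kappa> * real (k i))" for k :: "'n \<Rightarrow> nat"
    define u where "u k = (1 / norm (1::real, w k)) *\<^sub>R (1::real, w k)" for k
    define K where "K = {k :: 'n \<Rightarrow> nat. \<forall>i. k i < m}"
    have cK: "card K = m ^ n" by (simp add: K_def n_def card_bounded_functions)
    have K: "finite K" using cK m by (simp add: card_ge_0_finite)
    have \<epsilon>D: "\<epsilon> \<le> 1 / (2 * D)"
    proof -
      have "D * \<epsilon> \<le> D\<^sup>2 * \<epsilon>" using D1 \<epsilon> by (simp add: power2_eq_square)
      moreover have "5 * (D\<^sup>2 * \<epsilon>) \<le> 1" using True by (simp add: \<kappa>_def mult.assoc)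
      moreover have "0 < D * \<epsilon>" using D1 \<epsilon> by simp
      ultimately have "2 * (D * \<epsilon>) \<le> 1" by linarith
      then show ?thesis using D1 by (simp add: field_simps)
    qed
    have nw: "norm (w k) \<le> real CARD('n)" if "k \<in> K" for k
    proof -
      have "norm (w k) \<le> (\<Sum>i\<in>UNIV. \<bar>w k $ i\<bar>)" by (rule norm_le_l1_cart)
      also have "\<dots> \<le> (\<Sum>i\<in>(UNIV::'n set). 1)"
      proof (rule sum_mono)
        fix i
        have "real (k i) \<le> 1 / \<kappa>" 
        proof -
          have "k i < m" using that by (simp add: K_def)
          then show ?thesis using m(1) by linarith
        qed
        then show "\<bar>w k $ i\<bar> \<le> 1" using \<kappa>0 by (simp add: w_def field_simps)
      qed
      finally show ?thesis by simp
    qed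
    have disj: "k = l" if k: "k \<in> K" and l: "l \<in> K" and y: "y \<in> circular_cone \<epsilon> (u k)" "y \<in> circular_cone \<epsilon> (u l)" "y \<noteq> 0" for k l y
    proof (rule ccontr)
      assume "k \<noteq> l"
      then obtain i where i: "k i \<noteq> l i" by auto
      note sk = cone_slope[OF y(1)[unfolded u_def] y(3) \<epsilon> _ nw[OF k]]
      note sl = cone_slope[OF y(2)[unfolded u_def] y(3) \<epsilon> _ nw[OF l]]
      have D': "1 + real CARD('n) = D" by (simp add: D_def n_def)
      have fy: "fst y > 0" and k': "norm (snd y - fst y *\<^sub>R w k) \<le> 2 * D\<^sup>2 * \<epsilon> * fst y"
        and l': "norm (snd y - fst y *\<^sub>R w l) \<le> 2 * D\<^sup>2 * \<epsilon> * fst y"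
        using sk sl \<epsilon>D unfolding D' by auto
      have "1 \<le> \<bar>real (k i) - real (l i)\<bar>" using i by linarith
      then have "fst y * \<kappa> * 1 \<le> fst y * \<kappa> * \<bar>real (k i) - real (l i)\<bar>"
        using fy \<kappa>0 by (intro mult_left_mono) auto
      also have "\<dots> = \<bar>fst y * (\<kappa> * (real (k i) - real (l i)))\<bar>"
        using fy \<kappa>0 by (simp add: abs_mult)
      also have "\<dots> = \<bar>((snd y - fst y *\<^sub>R w l) - (snd y - fst y *\<^sub>R w k)) $ i\<bar>"
        by (simp add: w_def algebra_simps)
      also have "\<dots> \<le> norm ((snd y - fst y *\<^sub>R w l) - (snd y - fst y *\<^sub>R w k))"
        by (rule component_le_norm_cart)
      also have "\<dots> \<le> 2 * D\<^sup>2 * \<epsilon> * fst y + 2 * D\<^sup>2 * \<epsilon> * fst y"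
        by (rule order_trans[OF norm_triangle_ineq4 add_mono[OF l' k']])
      finally have "fst y * \<kappa> \<le> fst y * (4 * D\<^sup>2 * \<epsilon>)" by (simp add: mult_ac)
      then have "\<kappa> \<le> 4 * D\<^sup>2 * \<epsilon>" using fy by simp
      moreover have "D\<^sup>2 * \<epsilon> > 0" using D1 \<epsilon> by simp
      ultimately show False unfolding \<kappa>_def mult.assoc by linarith
    qed
    have nu: "norm (u k) = 1" for k
    proof -
      have "norm (1::real, w k) \<noteq> 0" by (simp add: zero_prod_def)
      then show ?thesis unfolding u_def norm_scaleR by simp
    qed
    have inj: "inj_on u K"
    proof (rule inj_onI)
      fix k l assume kl: "k \<in> K" "l \<in> K" "u k = u l"
      have "u k \<bullet> u k = 1" using nu[of k] by (simp add: norm_eq_1)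
      then have "u k \<in> circular_cone \<epsilon> (u k)" using \<epsilon> by (simp add: circular_cone_def)
      moreover have "u k \<noteq> 0" using nu[of k] by auto
      ultimately show "k = l" using disj[OF kl(1,2)] kl(3) by metis
    qed
    have "norm u0 = 1" by (simp add: u0_def norm_Pair)
    then have "card (u ` K) * ?P \<le> measure M {y. R \<le> norm y}"
      using disj K nu R by (intro cone_packing) blast+
    then have "real (m ^ n) * ?P \<le> T" using full by (simp add: card_image[OF inj] cK)
    moreover have "1 / (2 * \<kappa>) ^ n \<le> real (m ^ n)"
      using power_mono[OF m2, of n] \<kappa>0 by (simp add: power_divide)
    ultimately have "1 / (2 * \<kappa>) ^ n * ?P \<le> T"
      using mult_right_mono[of "1 / (2 * \<kappa>) ^ n" "real (m ^ n)" ?P] by simp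
    then show ?thesis using \<kappa>0 by (simp add: field_simps)
  qed
  moreover have "measure M {y. R \<le> fst y \<and> norm (snd y) \<le> \<epsilon> * fst y} \<le> ?P"
    by (rule finite_measure_mono[OF c0]) auto
  moreover have "(2 * \<kappa>) ^ n * T = cone_const CARD('n) \<alpha> * \<epsilon> ^ CARD('n) * h * R powr (-\<alpha>)"
    by (simp add: \<kappa>_def T_def cone_const_def D_def n_def power_mult_distrib mult_ac)
  ultimately show ?thesis by linarith
qed

section \<open>The barrier\<close>

lemma borel_measurable_fst_borel [measurable]:
  "fst \<in> borel_measurable (borel :: ('a::second_countable_topology \<times> 'b::second_countable_topology) measure)"
  by (intro borel_measurable_continuous_onI continuous_intros)

lemma borel_measurable_snd_borel [measurable]:
  "snd \<in> borel_measurable (borel :: ('a::second_countable_topology \<times> 'b::second_countable_topology) measure)"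
  by (intro borel_measurable_continuous_onI continuous_intros)

text \<open>Second-order Taylor expansion: for |t| \<le> 1/2 both 1 + t and its inverse are at most
  2, so 2 to the power |q - 2| bounds the power in the second derivative for either sign of q -
  2.\<close>

lemma powr_one_plus_le_quadratic:
  fixes q :: real
  obtains C where "C \<ge> 0" "\<And>u. \<bar>u\<bar> \<le> 1/2 \<Longrightarrow> (1 + u) powr q \<le> 1 + q * u + C * u\<^sup>2"
proof
  define C where "C = \<bar>q * (q - 1)\<bar> * 2 powr \<bar>q - 2\<bar>"
  show "C \<ge> 0" by (simp add: C_def)
  fix u :: real assume u: "\<bar>u\<bar> \<le> 1/2"
  show "(1 + u) powr q \<le> 1 + q * u + C * u\<^sup>2"
  proof (cases "u = 0")
    case False
    define d where "d m x = (if m = 0 then (1 + x) powr q else if m = 1 then q * (1 + x) powr (q - 1)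
      else q * (q - 1) * (1 + x) powr (q - 2))" for m :: nat and x :: real
    have P: "DERIV (\<lambda>x. (1 + x) powr r) t :> r * (1 + t) powr (r - 1)" if "-1 < t" for r t :: real
    proof -
      have "((\<lambda>x. 1 + x) has_real_derivative 1) (at t)" by (auto intro!: derivative_eq_intros)
      from DERIV_chain2[OF has_real_derivative_powr[of "1 + t" r] this] that show ?thesis by simp
    qed
    have D: "\<forall>m t. m < 2 \<and> -1/2 \<le> t \<and> t \<le> 1/2 \<longrightarrow> DERIV (d m) t :> d (Suc m) t"
    proof (intro allI impI)
      fix m :: nat and t :: real
      assume m: "m < 2 \<and> -1/2 \<le> t \<and> t \<le> 1/2"
      then have t: "-1 < t" by linarith
      from m consider "m = 0" | "m = 1" by linarith
      then show "DERIV (d m) t :> d (Suc m) t"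
      proof cases
        case 1
        then show ?thesis using P[OF t, of q] by (simp add: d_def[abs_def])
      next
        case 2
        then show ?thesis using DERIV_cmult[OF P[OF t, of "q - 1"], of q]
          by (simp add: d_def[abs_def] mult.assoc)
      qed
    qed
    have "\<exists>t. (if u < 0 then u < t \<and> t < 0 else 0 < t \<and> t < u) \<and>
        d 0 u = (\<Sum>m<2. (d m 0 / fact m) * (u - 0) ^ m) + (d 2 t / fact 2) * (u - 0) ^ 2"
      by (rule Taylor[of 2 d "d 0" "-1/2" "1/2" 0 u]) (use D u False in auto)
    then obtain t where t: "if u < 0 then u < t \<and> t < 0 else 0 < t \<and> t < u"
      and e: "d 0 u = (\<Sum>m<2. (d m 0 / fact m) * u ^ m) + (d 2 t / fact 2) * u ^ 2" by auto
    have t': "\<bar>t\<bar> \<le> 1/2" using t u by (auto split: if_splits)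
    have "(1 + t) powr (q - 2) \<le> 2 powr \<bar>q - 2\<bar>"
    proof (cases "q \<ge> 2")
      case True
      then show ?thesis using t' by (simp add: powr_mono2)
    next
      case False
      then have "(1 + t) powr (q - 2) = (1 / (1 + t)) powr (2 - q)"
        using t' by (simp add: powr_divide powr_minus_divide[symmetric])
      also have "\<dots> \<le> 2 powr (2 - q)"
        using t' False by (intro powr_mono2) (auto simp: field_simps)
      finally show ?thesis using False by simp
    qed
    then have "q * (q - 1) * (1 + t) powr (q - 2) \<le> C"
      unfolding C_def by (intro mult_mono) auto
    then have "d 2 t / fact 2 \<le> C"
      using \<open>C \<ge> 0\<close> by (simp add: d_def)
    then have "(d 2 t / fact 2) * u\<^sup>2 \<le> C * u\<^sup>2" by (intro mult_right_mono) auto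
    moreover have "(\<Sum>m<2. (d m 0 / fact m) * u ^ m) = 1 + q * u"
      by (simp add: d_def eval_nat_numeral)
    ultimately show ?thesis using e by (simp add: d_def)
  qed simp
qed

text \<open>This is the expansion of the ratio of two values of \<open>profile\<close>: u is the
  jump relative to r + t, v the jump relative to s - t, and \<kappa> the jump relative to the
  smaller of the two.\<close>

lemma powr_prod_le_quadratic:
  fixes a p :: real
  assumes "0 \<le> a" "0 \<le> p"
  obtains C where "C \<ge> 0" "\<And>u v \<kappa>. \<bar>u\<bar> \<le> \<kappa> \<Longrightarrow> \<bar>v\<bar> \<le> \<kappa> \<Longrightarrow> \<kappa> \<le> 1/2 \<Longrightarrow>
    (1 + u) powr a * (1 - v) powr (-p) \<le> 1 + (a * u + p * v) + C * \<kappa>\<^sup>2"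
proof -
  obtain C1 where C1: "C1 \<ge> 0" "\<And>u. \<bar>u\<bar> \<le> 1/2 \<Longrightarrow> (1 + u) powr a \<le> 1 + a * u + C1 * u\<^sup>2"
    using powr_one_plus_le_quadratic by blast
  obtain C2 where C2: "C2 \<ge> 0" "\<And>u. \<bar>u\<bar> \<le> 1/2 \<Longrightarrow> (1 + u) powr (-p) \<le> 1 + (-p) * u + C2 * u\<^sup>2"
    using powr_one_plus_le_quadratic by blast
  \<comment> \<open>The last product bounds the cross term \<open>E1 * E2\<close>; it is of order
    \<kappa>^2 because each factor is of order \<kappa>, by \<kappa>^2 \<le> \<kappa>.\<close>
  define C where "C = C1 + C2 + (a + C1) * (p + C2)"
  show thesis
  proof (rule that)
    show "C \<ge> 0" using C1 C2 assms by (simp add: C_def)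
    fix u v \<kappa> :: real assume uv: "\<bar>u\<bar> \<le> \<kappa>" "\<bar>v\<bar> \<le> \<kappa>" "\<kappa> \<le> 1/2"
    have k0: "0 \<le> \<kappa>" using uv by linarith
    have u: "(1 + u) powr a \<le> 1 + a * u + C1 * \<kappa>\<^sup>2"
      using C1(2)[of u] uv mult_left_mono[OF _ C1(1), of "u\<^sup>2" "\<kappa>\<^sup>2"] abs_le_square_iff[of u \<kappa>] k0 by force
    have v: "(1 - v) powr (-p) \<le> 1 + p * v + C2 * \<kappa>\<^sup>2"
      using C2(2)[of "-v"] uv mult_left_mono[OF _ C2(1), of "v\<^sup>2" "\<kappa>\<^sup>2"] abs_le_square_iff[of v \<kappa>] k0 by force
    define E1 E2 where "E1 = a * u + C1 * \<kappa>\<^sup>2" and "E2 = p * v + C2 * \<kappa>\<^sup>2"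
    have kk: "\<kappa>\<^sup>2 \<le> \<kappa>" using k0 uv by (simp add: power2_eq_square mult_left_le)
    have e1: "\<bar>E1\<bar> \<le> (a + C1) * \<kappa>"
    proof -
      have "\<bar>E1\<bar> \<le> a * \<bar>u\<bar> + C1 * \<kappa>\<^sup>2" unfolding E1_def using assms C1 abs_triangle_ineq[of "a * u" "C1 * \<kappa>\<^sup>2"] by (simp add: abs_mult)
      also have "\<dots> \<le> a * \<kappa> + C1 * \<kappa>" using assms C1 uv kk by (intro add_mono mult_left_mono) auto
      finally show ?thesis by (simp add: algebra_simps)
    qed
    have e2: "\<bar>E2\<bar> \<le> (p + C2) * \<kappa>"
    proof -
      have "\<bar>E2\<bar> \<le> p * \<bar>v\<bar> + C2 * \<kappa>\<^sup>2" unfolding E2_def using assms C2 abs_triangle_ineq[of "p * v" "C2 * \<kappa>\<^sup>2"] by (simp add: abs_mult)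
      also have "\<dots> \<le> p * \<kappa> + C2 * \<kappa>" using assms C2 uv kk by (intro add_mono mult_left_mono) auto
      finally show ?thesis by (simp add: algebra_simps)
    qed
    have "E1 * E2 \<le> \<bar>E1\<bar> * \<bar>E2\<bar>" by (metis abs_ge_self abs_mult)
    also have "\<dots> \<le> ((a + C1) * \<kappa>) * ((p + C2) * \<kappa>)"
      using e1 e2 by (intro mult_mono) auto
    finally have e12: "E1 * E2 \<le> ((a + C1) * (p + C2)) * \<kappa>\<^sup>2" by (simp add: power2_eq_square mult_ac)
    have "(1 + u) powr a * (1 - v) powr (-p) \<le> (1 + E1) * (1 + E2)"
    proof (rule mult_mono)
      show "(1 + u) powr a \<le> 1 + E1" "(1 - v) powr (-p) \<le> 1 + E2" using u v by (simp_all add: E1_def E2_def)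
      then show "0 \<le> 1 + E1" by (meson order_trans powr_ge_zero)
    qed simp
    also have "\<dots> = 1 + E1 + E2 + E1 * E2" by (simp add: algebra_simps)
    also have "\<dots> \<le> 1 + (a * u + p * v) + C * \<kappa>\<^sup>2"
      using e12 by (simp add: E1_def E2_def C_def algebra_simps)
    finally show "(1 + u) powr a * (1 - v) powr (-p) \<le> 1 + (a * u + p * v) + C * \<kappa>\<^sup>2" .
  qed
qed

text \<open>In order: the constant of one cone, the factor 2 in the tube radius raised to
  \<open>n\<close>, the loss from replacing R by 2R within a dyadic slice, and the geometric series
  over the slices.\<close>

definition tube_const :: "nat \<Rightarrow> real \<Rightarrow> real \<Rightarrow> real \<Rightarrow> real" where
  "tube_const n \<alpha> \<beta> q = cone_const n \<alpha> * 2 ^ n * 2 powr (q + \<beta> * real n)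
      * (1 / (1 - 2 powr (q + \<beta> * real n - (real n + \<alpha>))))"

lemma tube_const_pos:
  "0 < \<alpha> \<Longrightarrow> q + \<beta> * real n < real n + \<alpha> \<Longrightarrow> tube_const n \<alpha> \<beta> q > 0"
  unfolding tube_const_def using cone_const_pos[of \<alpha> n]
  by (intro mult_pos_pos) (auto simp: powr_less_one)

text \<open>The slice R \<le> \<open>fst y\<close> \<le> 2R of the tube lies in a cone of slope 2 (c
  + 2R)^\<beta> / R, so \<open>cone_tail_le\<close> applies; \<open>conv\<close> makes the slices
  summable. The cut at \<open>B\<close> keeps the sum finite, with a bound independent of
  \<open>B\<close>. The weight is the growth of the profile along the jump.\<close>

lemma tube_moment_le:
  fixes M :: "(real \<times> (real ^ 'n)) measure"
  assumes "stable_distribution M \<alpha> h" and r: "r > 0" and c: "c > 0" and \<beta>: "\<beta> > 0" and q: "0 \<le> q"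
    and conv: "q + \<beta> * real CARD('n) < real CARD('n) + \<alpha>"
  shows "(\<integral>y. indicator {y. r \<le> fst y \<and> fst y < B \<and> norm (snd y) \<le> 2 * (c + fst y) powr \<beta>} y
          * (1 + fst y / c) powr q \<partial>M)
      \<le> tube_const CARD('n) \<alpha> \<beta> q * h * c powr (\<beta> * real CARD('n)) * r powr (- (real CARD('n) + \<alpha>))
          * (1 + r / c) powr (q + \<beta> * real CARD('n))"
proof -
  interpret stable_distribution M \<alpha> h by fact
  define n where "n = CARD('n)"
  define p where "p = real n + \<alpha>"
  define e where "e = q + \<beta> * real n"
  have e: "0 \<le> e" "e < p" using q \<beta> conv by (simp_all add: e_def p_def n_def)
  define E where "E = {y :: real \<times> (real ^ 'n). r \<le> fst y \<and> fst y < B \<and> norm (snd y) \<le> 2 * (c + fst y) powr \<beta>}"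
  define S where "S k = {y :: real \<times> (real ^ 'n). 2^k * r \<le> fst y \<and> fst y \<le> 2 * (2^k * r) \<and> norm (snd y) \<le> 2 * (c + fst y) powr \<beta>}" for k :: nat
  define w where "w k = (1 + 2 * (2^k * r) / c) powr q" for k :: nat
  have [measurable]: "E \<in> sets borel" "\<And>k. S k \<in> sets borel" unfolding E_def S_def by measurable
  obtain N where N: "B / r < 2 ^ N" using real_arch_pow[of 2 "B / r"] by auto
  have point: "indicator E y * (1 + fst y / c) powr q \<le> (\<Sum>k<N. w k * indicator (S k) y)" for y
  proof (cases "y \<in> E")
    case False
    then show ?thesis by (simp add: sum_nonneg w_def)
  next
    case True
    then have y: "r \<le> fst y" "fst y < B" "norm (snd y) \<le> 2 * (c + fst y) powr \<beta>" by (auto simp: E_def)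
    have 1: "1 \<le> fst y / r" "fst y / r < 2 ^ N" using y r N by (auto simp: field_simps) 
    define m where "m = (LEAST n. fst y / r < 2 ^ n)"
    have m: "fst y / r < 2 ^ m" "m \<le> N" unfolding m_def using 1 by (auto intro: LeastI Least_le)
    have "m \<noteq> 0" using m 1 by (intro notI) simp
    then obtain k where k: "m = Suc k" using not0_implies_Suc by blast
    have "\<not> fst y / r < 2 ^ k"
      using not_less_Least[of k "\<lambda>n. fst y / r < 2 ^ n"] k unfolding m_def by simp
    then have yk: "y \<in> S k" using m k r y(3) by (auto simp: S_def field_simps)
    have "(1 + fst y / c) powr q \<le> w k"
      unfolding w_def using yk c r q y(1) by (intro powr_mono2) (auto simp: S_def divide_right_mono)
    also have "\<dots> = w k * indicator (S k) y" using yk by simp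
    also have "\<dots> \<le> (\<Sum>k<N. w k * indicator (S k) y)"
      using m(2) k by (intro member_le_sum) (auto simp: w_def)
    finally show ?thesis using True by simp
  qed
  have slice: "w k * measure M (S k) \<le> (cone_const n \<alpha> * 2 ^ n * 2 powr e * h * c powr (\<beta> * real n) * r powr (-p) * (1 + r / c) powr e)
        * (2 powr (e - p)) ^ k" for k
  proof -
    define R where "R = 2 ^ k * r"
    have R: "R > 0" "R \<ge> r" using r by (simp_all add: R_def)
    define \<epsilon> where "\<epsilon> = 2 * (c + 2 * R) powr \<beta> / R"
    have \<epsilon>0: "\<epsilon> > 0" using c R by (simp add: \<epsilon>_def)
    have "S k \<subseteq> {y. R \<le> fst y \<and> norm (snd y) \<le> \<epsilon> * fst y}"
    proof
      fix y assume "y \<in> S k"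
      then have y: "R \<le> fst y" "fst y \<le> 2 * R" "norm (snd y) \<le> 2 * (c + fst y) powr \<beta>" by (auto simp: S_def R_def)
      note y(3)
      also have "2 * (c + fst y) powr \<beta> \<le> 2 * (c + 2 * R) powr \<beta>"
        using y c R \<beta> by (intro mult_left_mono powr_mono2) auto
      also have "\<dots> = \<epsilon> * R" using R by (simp add: \<epsilon>_def)
      also have "\<dots> \<le> \<epsilon> * fst y" using y(1) \<epsilon>0 by simp
      finally show "y \<in> {y. R \<le> fst y \<and> norm (snd y) \<le> \<epsilon> * fst y}" using y by simp
    qed
    then have "measure M (S k) \<le> measure M {y. R \<le> fst y \<and> norm (snd y) \<le> \<epsilon> * fst y}"
      by (rule finite_measure_mono) measurable
    also have "\<dots> \<le> cone_const n \<alpha> * \<epsilon> ^ n * h * R powr (-\<alpha>)"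
      unfolding n_def by (rule cone_tail_le[OF assms(1) R(1) \<epsilon>0])
    finally have "w k * measure M (S k) \<le> w k * (cone_const n \<alpha> * \<epsilon> ^ n * h * R powr (-\<alpha>))"
      by (intro mult_left_mono) (auto simp: w_def)
    also have "\<dots> = cone_const n \<alpha> * 2 ^ n * h * (w k * (c + 2 * R) powr (\<beta> * real n)) * R powr (-p)"
    proof -
      have "((c + 2 * R) powr \<beta>) ^ n = (c + 2 * R) powr (\<beta> * real n)"
        using c R by (simp add: powr_powr powr_realpow[symmetric])
      moreover have "R powr (-p) = R powr (-\<alpha>) / R ^ n"
        using R by (simp add: p_def powr_diff powr_minus powr_add powr_realpow field_simps)
      ultimately show ?thesis
        by (simp add: \<epsilon>_def power_divide power_mult_distrib)
    qed
    also have "w k * (c + 2 * R) powr (\<beta> * real n) = c powr (\<beta> * real n) * (1 + 2 * R / c) powr e"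
    proof -
      have "(c + 2 * R) = c * (1 + 2 * R / c)" using c by (simp add: field_simps)
      then have "(c + 2 * R) powr (\<beta> * real n) = c powr (\<beta> * real n) * (1 + 2 * R / c) powr (\<beta> * real n)"
        using c R by (simp add: powr_mult)
      then show ?thesis by (simp add: w_def e_def R_def powr_add)
    qed
    \<comment> \<open>Separates the slice from the ratio r/c: 1 + 2R/c \<le> 2^(k+1) (1 +
      r/c).\<close>
    also have "cone_const n \<alpha> * 2 ^ n * h * (c powr (\<beta> * real n) * (1 + 2 * R / c) powr e) * R powr (-p)
       \<le> cone_const n \<alpha> * 2 ^ n * h * (c powr (\<beta> * real n) * ((2 * 2 ^ k) * (1 + r / c)) powr e) * R powr (-p)"
    proof (intro mult_right_mono mult_left_mono powr_mono2)
      have "(1::real) \<le> 2 * 2 ^ k" by (metis one_le_numeral one_le_power power_Suc)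
      then show "1 + 2 * R / c \<le> (2 * 2 ^ k) * (1 + r / c)" using c by (simp add: R_def field_simps)
      show "0 \<le> cone_const n \<alpha> * 2 ^ n * h" using cone_const_pos[OF index(1), of n] time by simp
    qed (use e c R in auto)
    also have "((2 * 2 ^ k) * (1 + r / c)) powr e = 2 powr e * (2 powr e) ^ k * (1 + r / c) powr e"
      using c r by (simp add: powr_mult powr_powr powr_realpow[symmetric] mult.commute)
    also have "R powr (-p) = (2 powr (-p)) ^ k * r powr (-p)"
      unfolding R_def using r by (simp add: powr_mult powr_powr powr_realpow[symmetric] mult.commute)
    finally have "w k * measure M (S k) \<le> cone_const n \<alpha> * 2 ^ n * h * (c powr (\<beta> * real n)
        * (2 powr e * (2 powr e) ^ k * (1 + r / c) powr e)) * ((2 powr (-p)) ^ k * r powr (-p))" .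
    moreover have "(2 powr (e - p)) ^ k = (2 powr e) ^ k * (2 powr (-p) :: real) ^ k"
      by (simp add: power_mult_distrib[symmetric] powr_add[symmetric])
    ultimately show ?thesis
      by (simp only: mult_ac)
  qed
  define Z where "Z = cone_const n \<alpha> * 2 ^ n * 2 powr e * h * c powr (\<beta> * real n) * r powr (-p) * (1 + r / c) powr e"
  have Z: "Z \<ge> 0" unfolding Z_def using cone_const_pos[OF index(1), of n] time by simp
  have "(\<integral>y. indicator E y * (1 + fst y / c) powr q \<partial>M) \<le> (\<integral>y. (\<Sum>k<N. w k * indicator (S k) y) \<partial>M)"
  proof (rule integral_mono)
    show i2: "integrable M (\<lambda>y. \<Sum>k<N. w k * indicator (S k) y)"
      by (intro Bochner_Integration.integrable_sum integrable_mult_right integrable_real_indicator)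
        (auto simp: emeasure_eq_measure)
    show "integrable M (\<lambda>y. indicator E y * (1 + fst y / c) powr q)"
      by (rule Bochner_Integration.integrable_bound[OF i2])
        (use point in \<open>auto intro!: AE_I2 simp: abs_mult intro: order_trans[OF _ abs_ge_self]\<close>)
  qed (rule point)
  also have "\<dots> = (\<Sum>k<N. w k * measure M (S k))"
    by (subst Bochner_Integration.integral_sum)
      (auto intro!: integrable_mult_right integrable_real_indicator simp: emeasure_eq_measure)
  also have "\<dots> \<le> (\<Sum>k<N. Z * (2 powr (e - p)) ^ k)"
    using slice unfolding Z_def by (intro sum_mono) auto
  also have "\<dots> \<le> Z * (1 / (1 - 2 powr (e - p)))"
  proof -
    have lt: "2 powr (e - p) < (1::real)" using e by (simp add: powr_less_one)
    have "(\<Sum>k<N. (2 powr (e - p)) ^ k) \<le> (\<Sum>k. (2 powr (e - p)) ^ k :: real)"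
      by (rule sum_le_suminf) (use lt in \<open>auto intro!: summable_geometric\<close>)
    also have "\<dots> = 1 / (1 - 2 powr (e - p))" using lt by (simp add: suminf_geometric)
    finally show ?thesis using mult_left_mono[OF _ Z] by (simp only: sum_distrib_left[symmetric])
  qed
  finally show ?thesis
    by (simp add: Z_def E_def tube_const_def e_def p_def n_def mult_ac)
qed

text \<open>The moment bound with exponent 0, from which the cut-off is removed by continuity from
  below.\<close>

lemma tube_measure_le:
  fixes M :: "(real \<times> (real ^ 'n)) measure"
  assumes "stable_distribution M \<alpha> h" and r: "r > 0" and c: "c > 0" and \<beta>: "\<beta> > 0"
    and conv: "\<beta> * real CARD('n) < real CARD('n) + \<alpha>"
  shows "measure M {y. r \<le> fst y \<and> norm (snd y) \<le> 2 * (c + fst y) powr \<beta>}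
      \<le> tube_const CARD('n) \<alpha> \<beta> 0 * h * (c + r) powr (\<beta> * real CARD('n)) * r powr (- (real CARD('n) + \<alpha>))"
    (is "measure M ?E \<le> ?b")
proof -
  interpret stable_distribution M \<alpha> h by fact
  let ?T = "\<lambda>k. {y :: real \<times> (real ^ 'n). r \<le> fst y \<and> fst y < real k \<and> norm (snd y) \<le> 2 * (c + fst y) powr \<beta>}"
  have [measurable]: "?T k \<in> sets M" for k by measurable
  have "(\<lambda>k. measure M (?T k)) \<longlonglongrightarrow> measure M (\<Union>k. ?T k)"
    by (rule finite_Lim_measure_incseq) (auto simp: incseq_def)
  also have "(\<Union>k. ?T k) = ?E"
    by (auto intro: reals_Archimedean2)
  finally show ?thesis
  proof (rule LIMSEQ_le_const2)
    have "measure M (?T k) \<le> ?b" for k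
    proof -
      \<comment> \<open>Positivity matters since \<open>x powr 0\<close> is 1 only for nonzero
        \<open>x\<close>.\<close>
      have pos: "0 < c + fst y" if "y \<in> ?T k" for y using that r c by auto
      have "measure M (?T k) = (\<integral>y. indicator (?T k) y * (1 + fst y / c) powr 0 \<partial>M)"
      proof -
        have eq: "indicator (?T k) y * (1 + fst y / c) powr 0 = (indicator (?T k) y :: real)" for y
          using pos[of y] c by (cases "y \<in> ?T k") (auto simp: field_simps)
        show ?thesis unfolding eq by simp
      qed
      also have "\<dots> \<le> tube_const CARD('n) \<alpha> \<beta> 0 * h * c powr (\<beta> * real CARD('n)) * r powr (- (real CARD('n) + \<alpha>))
          * (1 + r / c) powr (0 + \<beta> * real CARD('n))"
        by (rule tube_moment_le[OF assms(1-4)]) (use conv in auto)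
      also have "\<dots> = ?b"
      proof -
        have "c + r = c * (1 + r / c)" using c by (simp add: field_simps)
        then have "(c + r) powr (\<beta> * real CARD('n)) = c powr (\<beta> * real CARD('n)) * (1 + r / c) powr (\<beta> * real CARD('n))"
          using c r by (simp add: powr_mult)
        then show ?thesis by simp
      qed
      finally show ?thesis .
    qed
    then show "\<exists>N. \<forall>n\<ge>N. measure M (?T n) \<le> ?b" by blast
  qed
qed

section \<open>Sideways jumps and short jumps\<close>

definition lower_const :: "real \<Rightarrow> real" where
  "lower_const \<alpha> = (1/6) powr (\<alpha> / (2 - \<alpha>)) / 8"

lemma lower_const_pos: "lower_const \<alpha> > 0"
  by (simp add: lower_const_def)

text \<open>\<open>L\<close> is so large that at most half of the lower bound of
  \<open>tail_ge\<close> is lost to jumps with a first coordinate beyond L r. The restriction keeps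
  the counted jumps in the range where the profile is expanded, so that leaving the tube is a true
  loss against the expansion.\<close>

lemma sideways_ge:
  fixes M :: "(real \<times> (real ^ 'n)) measure" and k :: 'n
  assumes "stable_distribution M \<alpha> h" and r: "r > 0" "h \<le> r powr \<alpha>"
    and L: "L > 0" "tail_const \<alpha> * L powr (-\<alpha>) \<le> lower_const \<alpha> / 2"
  shows "lower_const \<alpha> / 2 * h * r powr (-\<alpha>) \<le> measure M {y. r \<le> \<bar>snd y $ k\<bar> \<and> \<bar>fst y\<bar> < L * r}"
proof -
  interpret stable_distribution M \<alpha> h by fact
  let ?e = "(0::real, axis k (1::real))" and ?f = "(1::real, 0 :: real ^ 'n)"
  have n: "norm ?e = 1" "norm ?f = 1" by (simp_all add: norm_Pair)
  have i: "y \<bullet> ?e = snd y $ k" "y \<bullet> ?f = fst y" for y :: "real \<times> (real ^ 'n)"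
    by (simp_all add: inner_prod_def inner_axis)
  have k [measurable]: "(\<lambda>y. snd y $ k) \<in> borel_measurable (borel :: (real \<times> (real ^ 'n)) measure)"
    by (intro borel_measurable_continuous_onI continuous_intros)
  have "lower_const \<alpha> * h * r powr (-\<alpha>) \<le> measure M {y. r \<le> \<bar>snd y $ k\<bar>}"
    using tail_ge[OF r(1) n(1) r(2)] unfolding i lower_const_def .
  also have "\<dots> \<le> measure M ({y. r \<le> \<bar>snd y $ k\<bar> \<and> \<bar>fst y\<bar> < L * r} \<union> {y. L * r \<le> \<bar>fst y\<bar>})"
    by (rule finite_measure_mono) auto
  also have "\<dots> \<le> measure M {y. r \<le> \<bar>snd y $ k\<bar> \<and> \<bar>fst y\<bar> < L * r} + measure M {y. L * r \<le> \<bar>fst y\<bar>}"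
    by (rule measure_Un_le) auto
  also have "measure M {y. L * r \<le> \<bar>fst y\<bar>} \<le> tail_const \<alpha> * h * (L * r) powr (-\<alpha>)"
    using tail_le[of "L * r", OF _ n(2)] L r unfolding i by simp
  also have "\<dots> = (tail_const \<alpha> * L powr (-\<alpha>)) * (h * r powr (-\<alpha>))"
    using L r by (simp add: powr_mult)
  also have "\<dots> \<le> lower_const \<alpha> / 2 * (h * r powr (-\<alpha>))"
    using L(2) time by (intro mult_right_mono) auto
  finally show ?thesis by simp
qed

text \<open>By symmetry of the range the linear term integrates to 0; what remains is the mass, at
  most 1, and the truncated second moment, of order \<open>h\<close>.\<close>

lemma local_part_le:
  fixes M :: "(real \<times> (real ^ 'n)) measure"
  assumes "stable_distribution M \<alpha> h" and \<rho>: "\<rho> > 0" and D: "D \<ge> 0"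
  shows "integrable M (\<lambda>y. indicator {y. \<bar>fst y\<bar> \<le> \<rho>} y * (1 + b * fst y + D * (fst y)\<^sup>2))"
    and "(\<integral>y. indicator {y. \<bar>fst y\<bar> \<le> \<rho>} y * (1 + b * fst y + D * (fst y)\<^sup>2) \<partial>M)
      \<le> 1 + D * (3 * h * \<rho> powr (2 - \<alpha>))"
proof -
  interpret stable_distribution M \<alpha> h by fact
  let ?f = "(1::real, 0 :: real ^ 'n)" and ?I = "{y :: real \<times> (real ^ 'n). \<bar>fst y\<bar> \<le> \<rho>}"
  have n: "norm ?f = 1" by (simp add: norm_Pair)
  have i: "y \<bullet> ?f = fst y" for y :: "real \<times> (real ^ 'n)"
    by (simp add: inner_prod_def)
  note sq = integrable_trunc_square[OF \<rho>, of ?f, unfolded i] trunc_square_le[OF \<rho> n, unfolded i]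
  have e: "indicator ?I y * (1 + b * fst y + D * (fst y)\<^sup>2) = indicator ?I y + (b * (indicator ?I y * fst y) + D * (indicator ?I y * (fst y)\<^sup>2))" for y
    by (simp add: algebra_simps)
  have i1: "integrable M (\<lambda>y. indicator ?I y :: real)"
    by (intro integrable_real_indicator) (auto simp: emeasure_eq_measure)
  have i2: "integrable M (\<lambda>y. indicator ?I y * fst y)"
    by (rule integrable_const_bound[where B="\<rho>"]) (use \<rho> in \<open>auto simp: indicator_def\<close>)
  show "integrable M (\<lambda>y. indicator ?I y * (1 + b * fst y + D * (fst y)\<^sup>2))"
    unfolding e by (intro Bochner_Integration.integrable_add integrable_mult_right i1 i2 sq)
  have "(\<integral>y. indicator ?I y * fst y \<partial>M) = 0"
    by (rule integral_odd_eq_0) (auto simp: indicator_def)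
  then have "(\<integral>y. indicator ?I y * (1 + b * fst y + D * (fst y)\<^sup>2) \<partial>M)
      = measure M ?I + D * (\<integral>y. indicator ?I y * (fst y)\<^sup>2 \<partial>M)"
    unfolding e
    by (simp add: Bochner_Integration.integral_add Bochner_Integration.integrable_add i1 i2 sq)
  also have "\<dots> \<le> 1 + D * (3 * h * \<rho> powr (2 - \<alpha>))"
    by (intro add_mono mult_left_mono D sq prob_le_1)
  finally show "(\<integral>y. indicator ?I y * (1 + b * fst y + D * (fst y)\<^sup>2) \<partial>M) \<le> 1 + D * (3 * h * \<rho> powr (2 - \<alpha>))" .
qed

text \<open>Heuristically \<open>(r + t)\<^bsup>\<alpha>\<beta>\<^esup>\<close> is the time spent inside the tube near height \<open>t\<close>, and
  \<open>s\<^bsup>-(n(1-\<beta>)+\<alpha>)\<^esup>\<close> is the rate of jumps from height \<open>0\<close> into the tube beyond height \<open>s\<close>. The last factor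
  replaces the jump length \<open>s\<close> by \<open>s - t\<close>.\<close>

definition profile :: "nat \<Rightarrow> real \<Rightarrow> real \<Rightarrow> real \<Rightarrow> real \<Rightarrow> real \<Rightarrow> real \<Rightarrow> real" where
  "profile n \<alpha> \<beta> A r s t =
     A * s powr (- (real n * (1 - \<beta>) + \<alpha>)) * (r + t) powr (\<alpha> * \<beta>) * (1 - t / s) powr (- (real n + \<alpha>))"

text \<open>The radius (r + t)^\<beta> exceeds that of the parabola and, for r \<ge> 1, the number
  1. The cap at 1 disposes of heights close to \<open>s\<close>, where the profile blows up.\<close>

definition barrier :: "real \<Rightarrow> real \<Rightarrow> real \<Rightarrow> real \<Rightarrow> real \<Rightarrow> real \<times> (real ^ 'n) \<Rightarrow> real" where
  "barrier \<alpha> \<beta> A r s z =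
     (if 0 < fst z \<and> norm (snd z) < (r + fst z) powr \<beta>
      then if fst z < s then min 1 (profile CARD('n) \<alpha> \<beta> A r s (fst z)) else 1
      else 0)"

lemma profile_nonneg: "0 \<le> A \<Longrightarrow> 0 \<le> profile n \<alpha> \<beta> A r s t"
  by (simp add: profile_def)

lemma barrier_bounds: "0 \<le> A \<Longrightarrow> 0 \<le> barrier \<alpha> \<beta> A r s z" "barrier \<alpha> \<beta> A r s z \<le> 1"
  by (simp_all add: barrier_def profile_nonneg)

lemma barrier_measurable [measurable]:
  "barrier \<alpha> \<beta> A r s \<in> borel_measurable (borel :: (real \<times> (real ^ 'n)) measure)"
  unfolding barrier_def profile_def by measurable

lemma profile_mono:
  assumes "0 \<le> A" "0 < s" "0 < r" "0 < \<alpha>" "0 < \<beta>" "0 \<le> t" "t \<le> u" "u < s"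
  shows "profile n \<alpha> \<beta> A r s t \<le> profile n \<alpha> \<beta> A r s u"
proof -
  have "u / s < 1" "t / s \<le> u / s" using assms by (simp_all add: divide_right_mono)
  then have "(1 - t / s) powr (- (real n + \<alpha>)) \<le> (1 - u / s) powr (- (real n + \<alpha>))"
    using assms by (intro powr_mono2') auto
  moreover have "(r + t) powr (\<alpha> * \<beta>) \<le> (r + u) powr (\<alpha> * \<beta>)"
    using assms by (intro powr_mono2) auto
  ultimately show ?thesis
    unfolding profile_def using assms by (intro mult_mono mult_left_mono) auto
qed

text \<open>\<open>\<delta>\<close> is the scale on which the profile varies. Jumps below \<open>\<delta> / 2\<close> are controlled by a
  quadratic expansion, whose linear term integrates to \<open>0\<close> by symmetry. Sideways jumps, which leave
  the tube, give the only negative term.\<close>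

lemma barrier_pointwise:
  fixes x y :: "real \<times> (real ^ 'n)" and k :: 'n
  defines "n \<equiv> real CARD('n)"
  assumes par: "0 < \<alpha>" "0 < \<beta>" "\<beta> < 1" "0 < A" "1 \<le> r" "0 < s"
    and x: "0 < fst x" "fst x < s" "norm (snd x) < (r + fst x) powr \<beta>"
    and c_def: "c = r + fst x" and l_def: "\<delta> = min c (s - fst x)"
    and G_def: "G = profile CARD('n) \<alpha> \<beta> A r s (fst x)"
    and C: "C \<ge> 0" "\<And>u v \<kappa>. \<bar>u\<bar> \<le> \<kappa> \<Longrightarrow> \<bar>v\<bar> \<le> \<kappa> \<Longrightarrow> \<kappa> \<le> 1/2 \<Longrightarrow>
      (1 + u) powr (\<alpha> * \<beta>) * (1 - v) powr (-(n + \<alpha>)) \<le> 1 + (\<alpha> * \<beta> * u + (n + \<alpha>) * v) + C * \<kappa>\<^sup>2"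
    and L: "L \<ge> 1" "8 * L * c powr \<beta> \<le> \<delta>" "8 * L * (\<alpha> * \<beta> + (n + \<alpha>)) * c powr \<beta> \<le> \<delta>"
  shows "barrier \<alpha> \<beta> A r s (x + y) \<le>
    G * (indicator {y. \<bar>fst y\<bar> \<le> \<delta> / 2} y *
            (1 + (\<alpha> * \<beta> / c + (n + \<alpha>) / (s - fst x)) * fst y + C / \<delta>\<^sup>2 * (fst y)\<^sup>2)
        - 1 / 2 * indicator {y. 4 * c powr \<beta> \<le> \<bar>snd y $ k\<bar> \<and> \<bar>fst y\<bar> < L * (4 * c powr \<beta>)} y
        + indicator {y. \<delta> / 2 \<le> \<bar>fst y\<bar>} y
        + 2 powr (n + \<alpha>) * (indicator {y. \<delta> / 2 \<le> fst y \<and> fst y < (s - fst x) / 2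
             \<and> norm (snd y) \<le> 2 * (c + fst y) powr \<beta>} y * (1 + fst y / c) powr (\<alpha> * \<beta>)))
    + indicator {y. (s - fst x) / 2 \<le> fst y \<and> norm (snd y) \<le> 2 * (c + fst y) powr \<beta>} y"
    (is "_ \<le> G * (indicator ?A1 y * ?B - 1/2 * indicator ?S y + indicator ?A2 y
      + 2 powr _ * (indicator ?A4 y * ?w)) + indicator ?A3 y")
proof -
  define t W a p where "t = fst x" and "W = c powr \<beta>" and "a = \<alpha> * \<beta>" and "p = n + \<alpha>"
  have c: "c \<ge> 1" "c > 0" using par x by (simp_all add: c_def)
  have st: "s - t > 0" using x by (simp add: t_def)
  have l: "\<delta> > 0" "\<delta> \<le> c" "\<delta> \<le> s - t" using c st by (simp_all add: l_def t_def)
  have a: "a \<ge> 0" and p: "p > 0" using par by (simp_all add: a_def p_def n_def add_nonneg_pos)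
  have ts: "1 - t / s > 0" using st par by (simp add: field_simps)
  have G0: "G > 0" unfolding G_def profile_def using par c ts by (simp add: c_def t_def)
  have W: "W \<ge> 1" unfolding W_def using c par by (simp add: ge_one_powr_ge_zero)
  have LW: "8 * L * W \<le> \<delta>" "8 * L * (a + p) * W \<le> \<delta>" using L by (simp_all add: W_def a_def p_def)
  \<comment> \<open>A sideways jump is short on the scale \<delta>, hence within the range of the
    expansion, and its linear term has modulus at most 1/2.\<close>
  have S: "\<bar>fst y\<bar> \<le> \<delta> / 2" "\<bar>(a / c + p / (s - t)) * fst y\<bar> \<le> 1 / 2" if "y \<in> ?S"
  proof -
    have y: "\<bar>fst y\<bar> < L * (4 * W)" using that by (simp add: W_def)
    then show "\<bar>fst y\<bar> \<le> \<delta> / 2" using LW by simp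
    have "a / c + p / (s - t) \<le> a / \<delta> + p / \<delta>"
      using l a p st c by (intro add_mono divide_left_mono) auto
    then have "\<bar>(a / c + p / (s - t)) * fst y\<bar> \<le> (a / \<delta> + p / \<delta>) * (L * (4 * W))"
      unfolding abs_mult using y a p c st l by (intro mult_mono) auto
    also have "\<dots> = (8 * L * (a + p) * W) / (2 * \<delta>)" using l by (simp add: field_simps)
    also have "\<dots> \<le> \<delta> / (2 * \<delta>)" using LW l by (intro divide_right_mono) auto
    finally show "\<bar>(a / c + p / (s - t)) * fst y\<bar> \<le> 1 / 2" using l by simp
  qed
  \<comment> \<open>Such a jump starts within W of the axis and ends at distance at least 3 W from
    it, while the tube at the new height has radius at most 2 W.\<close>
  have S_out: "barrier \<alpha> \<beta> A r s (x + y) = 0" if "y \<in> ?S"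
  proof -
    have "4 * W \<le> \<bar>snd y $ k\<bar>" using that by (simp add: W_def)
    also have "\<dots> \<le> norm (snd y)" by (rule component_le_norm_cart)
    also have "\<dots> \<le> norm (snd (x + y)) + norm (snd x)"
      using norm_triangle_ineq4[of "snd (x + y)" "snd x"] by simp
    finally have 1: "3 * W \<le> norm (snd (x + y))" using x(3) unfolding W_def c_def by simp
    have "(c + fst y) powr \<beta> \<le> 2 * W" if "0 \<le> c + fst y"
    proof -
      have "(c + fst y) powr \<beta> \<le> (2 * c) powr \<beta>" using that S(1)[OF \<open>y \<in> ?S\<close>] l par by (intro powr_mono2) auto
      also have "\<dots> = 2 powr \<beta> * W" using c by (simp add: powr_mult W_def)
      also have "\<dots> \<le> 2 * W" using powr_mono[of \<beta> 1 2] par W by (intro mult_right_mono) auto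
      finally show ?thesis .
    qed
    then show ?thesis using 1 W par x by (auto simp: barrier_def c_def add.assoc)
  qed
  have ratio: "profile CARD('n) \<alpha> \<beta> A r s (t + v) = G * ((1 + v / c) powr a * (1 - v / (s - t)) powr (-p))"
    if v: "0 < c + v" "t + v < s" for v
  proof -
    have 1: "r + (t + v) = c * (1 + v / c)" using c by (simp add: c_def t_def field_simps)
    have 2: "1 - (t + v) / s = (1 - t / s) * (1 - v / (s - t))" using st par by (simp add: field_simps)
    have "1 + v / c > 0" "1 - v / (s - t) > 0" using v c st by (simp_all add: field_simps)
    then show ?thesis
      unfolding G_def profile_def 1 2 using c ts
      by (simp add: powr_mult c_def t_def a_def p_def n_def)
  qed
  \<comment> \<open>On sideways jumps the barrier vanishes although the expansion still counts at
    least 1/2; this surplus pays for the term with -1/2. Elsewhere the expansion is nonnegative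
    because it dominates a product of powers.\<close>
  have B0: "?B \<ge> 0" "y \<in> ?S \<Longrightarrow> ?B \<ge> 1/2" if "\<bar>fst y\<bar> \<le> \<delta> / 2"
  proof -
    show "y \<in> ?S \<Longrightarrow> ?B \<ge> 1/2"
    proof -
      assume "y \<in> ?S"
      have "0 \<le> C / \<delta>\<^sup>2 * (fst y)\<^sup>2" using C by simp
      then show ?thesis using S(2)[OF \<open>y \<in> ?S\<close>] unfolding a_def p_def t_def by linarith
    qed
    have "0 \<le> (1 + fst y / c) powr a * (1 - fst y / (s - t)) powr (-p)" by simp
    also have "\<dots> \<le> 1 + (a * (fst y / c) + p * (fst y / (s - t))) + C * (\<bar>fst y\<bar> / \<delta>)\<^sup>2"
      unfolding a_def p_def
    proof (rule C(2))
      show "\<bar>fst y / c\<bar> \<le> \<bar>fst y\<bar> / \<delta>" "\<bar>fst y / (s - t)\<bar> \<le> \<bar>fst y\<bar> / \<delta>"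
        using l c st by (auto simp: abs_divide intro!: divide_left_mono)
      show "\<bar>fst y\<bar> / \<delta> \<le> 1 / 2" using that l by (simp add: field_simps)
    qed
    also have "\<dots> = ?B" by (simp add: a_def p_def t_def power_divide algebra_simps)
    finally show "?B \<ge> 0" .
  qed
  have local_le: "profile CARD('n) \<alpha> \<beta> A r s (t + fst y) \<le> G * ?B" if "\<bar>fst y\<bar> \<le> \<delta> / 2"
  proof -
    have "0 < c + fst y" "t + fst y < s" using that l by linarith+
    note ratio[OF this]
    also have "(1 + fst y / c) powr a * (1 - fst y / (s - t)) powr (-p)
        \<le> 1 + (a * (fst y / c) + p * (fst y / (s - t))) + C * (\<bar>fst y\<bar> / \<delta>)\<^sup>2"
      unfolding a_def p_def
    proof (rule C(2))
      show "\<bar>fst y / c\<bar> \<le> \<bar>fst y\<bar> / \<delta>" "\<bar>fst y / (s - t)\<bar> \<le> \<bar>fst y\<bar> / \<delta>"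
        using l c st by (auto simp: abs_divide intro!: divide_left_mono)
      show "\<bar>fst y\<bar> / \<delta> \<le> 1 / 2" using that l by (simp add: field_simps)
    qed
    also have "\<dots> = ?B" by (simp add: a_def p_def t_def power_divide algebra_simps)
    finally show ?thesis using G0 by simp
  qed
  have sum_ge: "0 \<le> 1 * B - 1 / 2 * (1::real)" if "1 / 2 \<le> B" for B
    using that by simp
  have sum_ge0: "0 \<le> v1 - 1 / 2 * i + v2 + v4" if "0 \<le> v1 - 1 / 2 * i" "0 \<le> v2" "0 \<le> v4" for v1 v2 v4 i :: real
    using that by simp
  have sum_ge0': "0 \<le> v1 - 1 / 2 * 0 + v2 + v4" if "0 \<le> v1" "0 \<le> v2" "0 \<le> v4" for v1 v2 v4 :: real
    using that by simp
  have sum_ge1: "B \<le> 1 * B - 1 / 2 * 0 + v2 + v4" if "0 \<le> v2" "0 \<le> v4" for B v2 v4 :: real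
    using that by simp
  have sum_ge2: "1 \<le> v1 - 1 / 2 * 0 + 1 + v4" if "0 \<le> v1" "0 \<le> v4" for v1 v4 :: real
    using that by simp
  have sum_ge3: "w * q \<le> v1 - 1 / 2 * 0 + v2 + q * (1 * w)" if "0 \<le> v1" "0 \<le> v2" for v1 v2 w q :: real
    using that by (simp add: mult.commute)
  have A2: "0 \<le> (indicator ?A2 y :: real)" and A4: "0 \<le> 2 powr (n + \<alpha>) * (indicator ?A4 y * ?w)" by simp_all
  let ?rhs = "G * (indicator ?A1 y * ?B - 1/2 * indicator ?S y + indicator ?A2 y
      + 2 powr (n + \<alpha>) * (indicator ?A4 y * ?w)) + indicator ?A3 y"
  have rhs: "G * X \<le> ?rhs" if "X \<le> indicator ?A1 y * ?B - 1/2 * indicator ?S y + indicator ?A2 y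
      + 2 powr (n + \<alpha>) * (indicator ?A4 y * ?w)" for X
    by (rule add_increasing2[OF indicator_pos_le mult_left_mono[OF that]]) (use G0 in simp)
  show ?thesis
  proof (cases "y \<in> ?S")
    case True
    have "0 \<le> indicator ?A1 y * ?B - 1/2 * indicator ?S y + indicator ?A2 y
      + 2 powr (n + \<alpha>) * (indicator ?A4 y * ?w)"
    proof -
      have "0 \<le> indicator ?A1 y * ?B - 1/2 * indicator ?S y"
      proof -
        have i: "indicator ?A1 y = (1::real)" "indicator ?S y = (1::real)" using True S(1)[OF True] by simp_all
        show ?thesis unfolding i by (rule sum_ge[OF B0(2)[OF S(1)[OF True] True]])
      qed
      then show ?thesis by (rule sum_ge0[OF _ A2 A4])
    qed
    from rhs[OF this] show ?thesis unfolding S_out[OF True] by simp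
  next
    case False
    then have S0: "indicator ?S y = (0::real)" by simp
    have nonneg: "0 \<le> indicator ?A1 y * ?B" using B0(1) by (cases "y \<in> ?A1") auto
    have "0 \<le> ?rhs"
    proof -
      have "0 \<le> indicator ?A1 y * ?B - 1/2 * indicator ?S y + indicator ?A2 y
             + 2 powr (n + \<alpha>) * (indicator ?A4 y * ?w)" unfolding S0 by (rule sum_ge0'[OF nonneg A2 A4])
      from rhs[OF this] show ?thesis by simp
    qed
    show ?thesis
    proof (cases "0 < fst (x + y) \<and> norm (snd (x + y)) < (r + fst (x + y)) powr \<beta>")
      case out: False
      then have "barrier \<alpha> \<beta> A r s (x + y) = 0"
        unfolding barrier_def by (rule if_not_P)
      then show ?thesis using \<open>0 \<le> ?rhs\<close> by simp
    next
      case F: True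
      have le1: "barrier \<alpha> \<beta> A r s (x + y) \<le> profile CARD('n) \<alpha> \<beta> A r s (t + fst y)" if "t + fst y < s"
        unfolding barrier_def if_P[OF F] using that by (simp add: t_def)
      \<comment> \<open>Both end points lie in the tube, whose radius increases with the height;
        this is the factor 2 in the tube sets.\<close>
      have tube: "norm (snd y) \<le> 2 * (c + fst y) powr \<beta>" if "0 \<le> fst y"
      proof -
        have "norm (snd y) \<le> norm (snd (x + y)) + norm (snd x)"
          using norm_triangle_ineq4[of "snd (x + y)" "snd x"] by simp
        also have "norm (snd (x + y)) \<le> (c + fst y) powr \<beta>" using F by (simp add: c_def add.assoc)
        also have "norm (snd x) \<le> (c + fst y) powr \<beta>"
        proof -
          have "c powr \<beta> \<le> (c + fst y) powr \<beta>" using that c par by (intro powr_mono2) auto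
          then show ?thesis using x(3) by (simp add: c_def)
        qed
        finally show ?thesis by simp
      qed
      \<comment> \<open>Half of the remaining height s - t separates the last two cases: below it
        the singular factor of the profile grows at most by 2^p, and above it the barrier is bounded
        by 1, since such jumps are rare enough.\<close>
      consider (near) "\<bar>fst y\<bar> \<le> \<delta> / 2" | (behind) "fst y < - (\<delta> / 2)"
        | (mid) "\<delta> / 2 < fst y" "fst y < (s - t) / 2" | (far) "\<delta> / 2 < fst y" "(s - t) / 2 \<le> fst y"
        by linarith
      then show ?thesis
      proof cases
        case near
        have "t + fst y < s" using near l by linarith
        note le1[OF this]
        also note local_le[OF near]
        also have "G * ?B \<le> ?rhs"
        proof (rule rhs)
          show "?B \<le> indicator ?A1 y * ?B - 1/2 * indicator ?S y + indicator ?A2 y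
             + 2 powr (n + \<alpha>) * (indicator ?A4 y * ?w)"
          proof -
            have i: "indicator ?A1 y = (1::real)" using near by simp
            show ?thesis unfolding i S0 by (rule sum_ge1[OF A2 A4])
          qed
        qed
        finally show ?thesis .
      next
        case behind
        have "t + fst y < s" using behind l x t_def by linarith
        note le1[OF this]
        also have "profile CARD('n) \<alpha> \<beta> A r s (t + fst y) \<le> G"
          unfolding G_def t_def by (rule profile_mono) (use F behind par x l in auto)
        also have "G * 1 \<le> ?rhs"
        proof (rule rhs)
          show "1 \<le> indicator ?A1 y * ?B - 1/2 * indicator ?S y + indicator ?A2 y
             + 2 powr (n + \<alpha>) * (indicator ?A4 y * ?w)"
          proof -
            have i: "indicator ?A2 y = (1::real)" using behind l by simp
            show ?thesis unfolding i S0 by (rule sum_ge2[OF nonneg A4])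
          qed
        qed
        finally show ?thesis by simp
      next
        case mid
        have "fst y < s - t" using mid(2) st by simp
        then have ys: "t + fst y < s" "0 < c + fst y" using mid(1) l(1) c(2) by simp_all
        note le1[OF ys(1)]
        also note ratio[OF ys(2,1)]
        also have "G * ((1 + fst y / c) powr a * (1 - fst y / (s - t)) powr (-p)) \<le> G * (?w * 2 powr p)"
        proof (intro mult_left_mono mult_mono)
          have "1 / 2 \<le> 1 - fst y / (s - t)" using mid st by (simp add: field_simps)
          then have "(1 - fst y / (s - t)) powr (-p) \<le> (1/2) powr (-p)" using p by (intro powr_mono2') auto
          also have "\<dots> = 2 powr p" by (simp add: powr_divide powr_minus_divide)
          finally show "(1 - fst y / (s - t)) powr (-p) \<le> 2 powr p" .
        qed (use G0 in \<open>auto simp: a_def\<close>)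
        also have "\<dots> \<le> ?rhs"
        proof (rule rhs)
          have i: "indicator ?A4 y = (1::real)" using mid tube l by (auto simp: t_def)
          show "?w * 2 powr p \<le> indicator ?A1 y * ?B - 1/2 * indicator ?S y + indicator ?A2 y
             + 2 powr (n + \<alpha>) * (indicator ?A4 y * ?w)"
            unfolding i S0 p_def by (rule sum_ge3[OF nonneg A2])
        qed
        finally show ?thesis .
      next
        case far
        then have "y \<in> ?A3" using tube l by (auto simp: t_def)
        moreover have "0 \<le> G * (indicator ?A1 y * ?B - 1/2 * indicator ?S y + indicator ?A2 y
             + 2 powr (n + \<alpha>) * (indicator ?A4 y * ?w))"
          unfolding S0 using G0 by (intro mult_nonneg_nonneg sum_ge0' nonneg A2 A4) simp
        ultimately have "1 \<le> ?rhs" by simp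
        then show ?thesis using barrier_bounds(2)[of \<alpha> \<beta> A r s "x + y"] by linarith
      qed
    qed
  qed
qed

lemma barrier_abs_le: "0 \<le> A \<Longrightarrow> \<bar>barrier \<alpha> \<beta> A r s z\<bar> \<le> 1"
  using barrier_bounds(1)[of A \<alpha> \<beta> r s z] barrier_bounds(2)[of \<alpha> \<beta> A r s z] by linarith

text \<open>All terms of the pointwise bound are brought to the common unit h c^(-\<alpha>\<beta>),
  the order of the sideways probability. Then only the sign of the bracket matters: its positive
  terms can be made small by \<Lambda>, r and A, one after the other, and its negative term is
  fixed.\<close>

lemma barrier_integral_le:
  fixes M :: "(real \<times> (real ^ 'n)) measure" and x :: "real \<times> (real ^ 'n)"
  defines "n \<equiv> real CARD('n)"
  assumes M: "stable_distribution M \<alpha> h" and h: "h \<le> 1"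
    and par: "0 < \<beta>" "\<beta> < 1" "0 < A" "1 \<le> r" "r \<le> s"
    and x: "0 < fst x" "fst x < s" "norm (snd x) < (r + fst x) powr \<beta>"
    and c_def: "c = r + fst x" and \<delta>_def: "\<delta> = min c (s - fst x)"
    and G_def: "G = profile CARD('n) \<alpha> \<beta> A r s (fst x)"
    and C: "C \<ge> 0" "\<And>u v \<kappa>. \<bar>u\<bar> \<le> \<kappa> \<Longrightarrow> \<bar>v\<bar> \<le> \<kappa> \<Longrightarrow> \<kappa> \<le> 1/2 \<Longrightarrow>
      (1 + u) powr (\<alpha> * \<beta>) * (1 - v) powr (-(n + \<alpha>)) \<le> 1 + (\<alpha> * \<beta> * u + (n + \<alpha>) * v) + C * \<kappa>\<^sup>2"
    and L: "L \<ge> 1" "tail_const \<alpha> * L powr (-\<alpha>) \<le> lower_const \<alpha> / 2"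
    and \<Lambda>: "8 * L \<le> \<Lambda>" "8 * L * (\<alpha> * \<beta> + (n + \<alpha>)) \<le> \<Lambda>" "\<Lambda> * c powr \<beta> \<le> \<delta>"
  shows "(\<integral>y. barrier \<alpha> \<beta> A r s (x + y) \<partial>M) \<le> G * (1 + h * c powr (- (\<alpha> * \<beta>)) *
    ((3 * C + 4 * tail_const \<alpha>) * \<Lambda> powr (-\<alpha>)
      + 2 powr (n + \<alpha>) * (tube_const CARD('n) \<alpha> \<beta> (\<alpha> * \<beta>) * 2 powr (n + \<alpha>) * (3/2) powr (\<beta> * (n + \<alpha>)))
           * r powr (- ((1 - \<beta>) * (n + \<alpha>)))
      + tube_const CARD('n) \<alpha> \<beta> 0 * 2 powr (\<beta> * n) * 2 powr (n + \<alpha>) / A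
      - lower_const \<alpha> / 64))"
proof -
  interpret stable_distribution M \<alpha> h by (rule M)
  define t a p W where "t = fst x" and "a = \<alpha> * \<beta>" and "p = n + \<alpha>" and "W = c powr \<beta>"
  define k :: 'n where "k = undefined"
  have s: "0 < s" using par by simp
  have c: "c \<ge> 1" "c > 0" "c \<ge> r" using par x by (simp_all add: c_def)
  have st: "s - t > 0" using x by (simp add: t_def)
  have \<delta>: "\<delta> > 0" "\<delta> \<le> c" "\<delta> \<le> s - t" using c st by (simp_all add: \<delta>_def t_def)
  have n: "n \<ge> 1" by (simp add: n_def Suc_leI)
  have a: "a > 0" and p: "p > 0" using par index n by (simp_all add: a_def p_def)
  have ts: "1 - t / s > 0" using st s by (simp add: field_simps)
  have G0: "G > 0" unfolding G_def profile_def using par c ts s by (simp add: c_def t_def)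
  have W: "W \<ge> 1" unfolding W_def using c par by (simp add: ge_one_powr_ge_zero)
  have \<Lambda>0: "\<Lambda> > 0" using \<Lambda>(1) L(1) by linarith
  have K: "tail_const \<alpha> > 0" using tail_const_pos index by simp
  have Wa: "W powr (-\<alpha>) = c powr (-a)" using c by (simp add: W_def powr_powr a_def mult.commute)
  \<comment> \<open>The condition on \<Lambda> says that the profile varies on a scale at least
    \<Lambda> times the tube radius; up to constants, jumps beyond \<delta> are therefore rarer than
    sideways jumps by the factor \<Lambda>^(-\<alpha>).\<close>
  have \<delta>a: "\<delta> powr (-\<alpha>) \<le> \<Lambda> powr (-\<alpha>) * c powr (-a)"
  proof -
    have "\<delta> powr (-\<alpha>) \<le> (\<Lambda> * W) powr (-\<alpha>)"
      using \<Lambda>(3) \<Lambda>0 W index unfolding W_def[symmetric] by (intro powr_mono2') auto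
    then show ?thesis using \<Lambda>0 W by (simp add: powr_mult Wa)
  qed
  have LW: "8 * L * c powr \<beta> \<le> \<delta>" "8 * L * (\<alpha> * \<beta> + (n + \<alpha>)) * c powr \<beta> \<le> \<delta>"
    using mult_right_mono[OF \<Lambda>(1), of "c powr \<beta>"] mult_right_mono[OF \<Lambda>(2), of "c powr \<beta>"] \<Lambda>(3) by simp_all

  define A1 A2 A3 A4 S where
    "A1 = {y :: real \<times> (real ^ 'n). \<bar>fst y\<bar> \<le> \<delta> / 2}" and
    "A2 = {y :: real \<times> (real ^ 'n). \<delta> / 2 \<le> \<bar>fst y\<bar>}" and
    "A3 = {y :: real \<times> (real ^ 'n). (s - t) / 2 \<le> fst y \<and> norm (snd y) \<le> 2 * (c + fst y) powr \<beta>}" and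
    "A4 = {y :: real \<times> (real ^ 'n). \<delta> / 2 \<le> fst y \<and> fst y < (s - t) / 2 \<and> norm (snd y) \<le> 2 * (c + fst y) powr \<beta>}" and
    "S = {y :: real \<times> (real ^ 'n). 4 * W \<le> \<bar>snd y $ k\<bar> \<and> \<bar>fst y\<bar> < L * (4 * W)}"
  define b D where "b = a / c + p / (s - t)" and "D = C / \<delta>\<^sup>2"
  have D: "D \<ge> 0" using C by (simp add: D_def)
  have [measurable]: "(\<lambda>y. snd y $ k) \<in> borel_measurable (borel :: (real \<times> (real ^ 'n)) measure)"
    by (intro borel_measurable_continuous_onI continuous_intros)
  have [measurable]: "A1 \<in> sets borel" "A2 \<in> sets borel" "A3 \<in> sets borel" "A4 \<in> sets borel" "S \<in> sets borel"
    unfolding A1_def A2_def A3_def A4_def S_def by measurable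
  have I1: "integrable M (\<lambda>y. indicator A1 y * (1 + b * fst y + D * (fst y)\<^sup>2))"
    "(\<integral>y. indicator A1 y * (1 + b * fst y + D * (fst y)\<^sup>2) \<partial>M) \<le> 1 + D * (3 * h * (\<delta> / 2) powr (2 - \<alpha>))"
    unfolding A1_def using local_part_le[OF M, of "\<delta> / 2" D b] \<delta> D by auto
  have II: "integrable M (\<lambda>y. indicator X y :: real)" if "X \<in> sets borel" for X
    by (intro integrable_real_indicator) (use that in \<open>auto simp: emeasure_eq_measure sets_M\<close>)
  have mi: "(\<integral>y. indicator X y \<partial>M) = measure M X" if "X \<in> sets borel" for X
    using that by (simp add: sets_M)
  have I4: "integrable M (\<lambda>y. indicator A4 y * (1 + fst y / c) powr a)"
  proof (rule integrable_const_bound[where B="(1 + (s - t) / 2 / c) powr a"])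
    have "indicator A4 y * (1 + fst y / c) powr a \<le> (1 + (s - t) / 2 / c) powr a" for y
    proof (cases "y \<in> A4")
      case True
      then have y: "0 \<le> fst y" "fst y \<le> (s - t) / 2" using \<delta> by (auto simp: A4_def)
      then have "(1 + fst y / c) powr a \<le> (1 + (s - t) / 2 / c) powr a"
        using a c divide_right_mono[OF y(2), of c] by (intro powr_mono2) auto
      then show ?thesis using True by simp
    qed simp
    then show "AE y in M. norm (indicator A4 y * (1 + fst y / c) powr a) \<le> (1 + (s - t) / 2 / c) powr a"
      by simp
  qed simp
  have point: "barrier \<alpha> \<beta> A r s (x + y) \<le> G * (indicator A1 y * (1 + b * fst y + D * (fst y)\<^sup>2)
        - 1 / 2 * indicator S y + indicator A2 y
        + 2 powr p * (indicator A4 y * (1 + fst y / c) powr a)) + indicator A3 y" for y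
    unfolding A1_def A2_def A3_def A4_def S_def W_def t_def b_def D_def a_def p_def n_def
    by (rule barrier_pointwise[OF index(1) par(1-4) s x c_def \<delta>_def G_def C[unfolded n_def] L(1) LW[unfolded n_def]])
  have "(\<integral>y. barrier \<alpha> \<beta> A r s (x + y) \<partial>M) \<le> (\<integral>y. G * (indicator A1 y * (1 + b * fst y + D * (fst y)\<^sup>2)
        - 1 / 2 * indicator S y + indicator A2 y
        + 2 powr p * (indicator A4 y * (1 + fst y / c) powr a)) + indicator A3 y \<partial>M)"
  proof (rule integral_mono[OF _ _ point])
    show "integrable M (\<lambda>y. barrier \<alpha> \<beta> A r s (x + y))"
      by (rule integrable_const_bound[where B=1]) (use par in \<open>simp_all add: barrier_abs_le\<close>)
    show "integrable M (\<lambda>y. G * (indicator A1 y * (1 + b * fst y + D * (fst y)\<^sup>2)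
        - 1 / 2 * indicator S y + indicator A2 y
        + 2 powr p * (indicator A4 y * (1 + fst y / c) powr a)) + indicator A3 y)"
      by (intro Bochner_Integration.integrable_add Bochner_Integration.integrable_diff integrable_mult_right I1 I4 II) measurable
  qed
  also have "\<dots> = G * ((\<integral>y. indicator A1 y * (1 + b * fst y + D * (fst y)\<^sup>2) \<partial>M) - 1 / 2 * measure M S + measure M A2
      + 2 powr p * (\<integral>y. indicator A4 y * (1 + fst y / c) powr a \<partial>M)) + measure M A3"
    by (simp only: Bochner_Integration.integral_add Bochner_Integration.integral_diff Bochner_Integration.integrable_add
      Bochner_Integration.integrable_diff integrable_mult_right integral_mult_right_zero I1 I4 II
      \<open>A2 \<in> sets borel\<close> \<open>A3 \<in> sets borel\<close> \<open>S \<in> sets borel\<close> mi)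
  also have "\<dots> \<le> G * ((1 + 3 * C * \<Lambda> powr (-\<alpha>) * (h * c powr (-a))) - lower_const \<alpha> / 64 * (h * c powr (-a))
     + 4 * tail_const \<alpha> * \<Lambda> powr (-\<alpha>) * (h * c powr (-a))
     + 2 powr p * (tube_const CARD('n) \<alpha> \<beta> a * 2 powr p * (3/2) powr (\<beta> * p) * r powr (- ((1 - \<beta>) * p)) * (h * c powr (-a))))
     + tube_const CARD('n) \<alpha> \<beta> 0 * 2 powr (\<beta> * n) * 2 powr p / A * (h * (G * c powr (-a)))"
  proof (intro add_mono mult_left_mono diff_mono)
    have "D * (3 * h * (\<delta> / 2) powr (2 - \<alpha>)) \<le> D * (3 * h * \<delta> powr (2 - \<alpha>))"
      using \<delta> index time D by (intro mult_left_mono powr_mono2) auto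
    also have "\<dots> = 3 * C * h * \<delta> powr (-\<alpha>)"
      using \<delta> by (simp add: D_def powr_diff powr_minus field_simps)
    also have "\<dots> \<le> 3 * C * h * (\<Lambda> powr (-\<alpha>) * c powr (-a))"
      using \<delta>a C time by (intro mult_left_mono) auto
    finally show "(\<integral>y. indicator A1 y * (1 + b * fst y + D * (fst y)\<^sup>2) \<partial>M) \<le> 1 + 3 * C * \<Lambda> powr (-\<alpha>) * (h * c powr (-a))"
      using I1(2) by (simp add: mult_ac)
  next
    \<comment> \<open>Here the mesh h \<le> 1 meets the radius W \<ge> 1: the lower tail bound is
      valid only for times shorter than the jump length to the power \<alpha>.\<close>
    have hW: "h \<le> (4 * W) powr \<alpha>"
    proof -
      have "1 \<le> (4 * W) powr \<alpha>" using W index by (intro ge_one_powr_ge_zero) auto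
      then show ?thesis using h by simp
    qed
    \<comment> \<open>The final 1/64 is composed of the weight 1/2 of \<open>S\<close>, the 1/2 of
      \<open>sideways_ge\<close> and 4^(-\<alpha>) \<ge> 1/16.\<close>
    have "lower_const \<alpha> / 2 * h * (W powr (-\<alpha>) / 16) \<le> lower_const \<alpha> / 2 * h * (4 * W) powr (-\<alpha>)"
    proof (rule mult_left_mono)
      have "4 powr \<alpha> \<le> (4::real) powr 2" using index by (intro powr_mono) auto
      then have "W powr (-\<alpha>) / 16 \<le> W powr (-\<alpha>) / 4 powr \<alpha>" by (intro divide_left_mono) auto
      then show "W powr (-\<alpha>) / 16 \<le> (4 * W) powr (-\<alpha>)" using W by (simp add: powr_mult powr_minus field_simps)
    qed (use lower_const_pos[of \<alpha>] time in simp)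
    also have "\<dots> \<le> measure M S"
      unfolding S_def using sideways_ge[OF M _ hW _ L(2), of k] W L by simp
    finally show "lower_const \<alpha> / 64 * (h * c powr (-a)) \<le> 1 / 2 * measure M S"
      unfolding Wa by (simp add: mult_ac)
  next
    have "measure M A2 \<le> tail_const \<alpha> * h * (\<delta> / 2) powr (-\<alpha>)"
      using tail_le[of "\<delta> / 2" "(1, 0 :: real ^ 'n)"] \<delta> by (simp add: A2_def norm_Pair inner_prod_def)
    also have "(\<delta> / 2) powr (-\<alpha>) = 2 powr \<alpha> * \<delta> powr (-\<alpha>)"
      using \<delta> by (simp add: powr_divide powr_minus field_simps)
    also have "tail_const \<alpha> * h * (2 powr \<alpha> * \<delta> powr (-\<alpha>)) \<le> tail_const \<alpha> * h * (4 * (\<Lambda> powr (-\<alpha>) * c powr (-a)))"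
    proof (intro mult_left_mono mult_mono)
      have "2 powr \<alpha> \<le> (2::real) powr 2" using index by (intro powr_mono) auto
      then show "2 powr \<alpha> \<le> (4::real)" by simp
    qed (use \<delta>a K time in auto)
    finally show "measure M A2 \<le> 4 * tail_const \<alpha> * \<Lambda> powr (-\<alpha>) * (h * c powr (-a))" by (simp add: mult_ac)
  next
    have conv: "a + \<beta> * real CARD('n) < real CARD('n) + \<alpha>"
    proof -
      have "\<beta> * p < 1 * p" using par p by (intro mult_strict_right_mono) auto
      then show ?thesis by (simp add: a_def p_def n_def algebra_simps)
    qed
    have TC: "tube_const CARD('n) \<alpha> \<beta> a \<ge> 0"
      using tube_const_pos[of \<alpha> a \<beta> "CARD('n)"] conv index by simp
    show "(\<integral>y. indicator A4 y * (1 + fst y / c) powr a \<partial>M) \<le>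
      tube_const CARD('n) \<alpha> \<beta> a * 2 powr p * (3/2) powr (\<beta> * p) * r powr (- ((1 - \<beta>) * p)) * (h * c powr (-a))"
    \<comment> \<open>If c > s - t then \<delta> = s - t, and the range between \<delta>/2 and (s -
      t)/2 is empty.\<close>
    proof (cases "c \<le> s - t")
      case True
      then have d: "\<delta> = c" by (simp add: \<delta>_def t_def)
      have "(\<integral>y. indicator A4 y * (1 + fst y / c) powr a \<partial>M)
        \<le> tube_const CARD('n) \<alpha> \<beta> a * h * c powr (\<beta> * real CARD('n)) * (\<delta> / 2) powr (- (real CARD('n) + \<alpha>))
          * (1 + (\<delta> / 2) / c) powr (a + \<beta> * real CARD('n))"
        unfolding A4_def by (rule tube_moment_le[OF M]) (use \<delta> c par a conv in auto)
      also have "1 + (\<delta> / 2) / c = 3 / 2" using c d by simp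
      also have "(\<delta> / 2) powr (- (real CARD('n) + \<alpha>)) = 2 powr p * c powr (-p)"
        using c unfolding d p_def n_def powr_minus powr_divide by (simp add: powr_divide divide_inverse)
      also have "a + \<beta> * real CARD('n) = \<beta> * p" by (simp add: a_def p_def n_def algebra_simps)
      also have "tube_const CARD('n) \<alpha> \<beta> a * h * c powr (\<beta> * real CARD('n)) * (2 powr p * c powr (-p)) * (3 / 2) powr (\<beta> * p)
         = tube_const CARD('n) \<alpha> \<beta> a * 2 powr p * (3/2) powr (\<beta> * p) * (c powr (\<beta> * n) * c powr (-p)) * h"
        by (simp add: n_def mult_ac)
      \<comment> \<open>By \<beta> n - p = -(1 - \<beta>) p - a, jumps along the tube are smaller
        than the unit c^(-a) by c^(-(1-\<beta>)p), which a large \<open>r\<close> makes small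
        because c \<ge> r.\<close>
      also have "c powr (\<beta> * n) * c powr (-p) = c powr (- ((1 - \<beta>) * p)) * c powr (-a)"
        unfolding powr_add[symmetric] by (simp add: a_def p_def algebra_simps)
      also have "tube_const CARD('n) \<alpha> \<beta> a * 2 powr p * (3/2) powr (\<beta> * p) * (c powr (- ((1 - \<beta>) * p)) * c powr (-a)) * h
         \<le> tube_const CARD('n) \<alpha> \<beta> a * 2 powr p * (3/2) powr (\<beta> * p) * (r powr (- ((1 - \<beta>) * p)) * c powr (-a)) * h"
        using TC time c par p by (intro mult_left_mono mult_right_mono powr_mono2') auto
      finally show ?thesis by (simp add: mult_ac)
    next
      case False
      then have "A4 = {}" by (auto simp: A4_def \<delta>_def t_def)
      then show ?thesis using TC time by simp
    qed
  next
    define \<sigma> where "\<sigma> = (s - t) / 2"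
    have \<sigma>: "\<sigma> > 0" using st by (simp add: \<sigma>_def)
    have conv: "\<beta> * real CARD('n) < real CARD('n) + \<alpha>"
    proof -
      have "\<beta> * n < 1 * n" using par n by (intro mult_strict_right_mono) auto
      then have "\<beta> * n < n + \<alpha>" using index by linarith
      then show ?thesis by (simp only: n_def)
    qed
    have TC: "tube_const CARD('n) \<alpha> \<beta> 0 \<ge> 0"
      using tube_const_pos[of \<alpha> 0 \<beta> "CARD('n)"] conv index by simp
    have "measure M A3 \<le> tube_const CARD('n) \<alpha> \<beta> 0 * h * (c + \<sigma>) powr (\<beta> * real CARD('n)) * \<sigma> powr (- (real CARD('n) + \<alpha>))"
      unfolding A3_def \<sigma>_def by (rule tube_measure_le[OF M]) (use st c par conv in auto)
    also have "\<dots> \<le> tube_const CARD('n) \<alpha> \<beta> 0 * h * (2 * s) powr (\<beta> * real CARD('n)) * \<sigma> powr (- (real CARD('n) + \<alpha>))"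
proof -
      have "c + \<sigma> \<le> 2 * s" using par x by (simp add: c_def \<sigma>_def t_def field_simps)
      then show ?thesis using TC time par c \<sigma> by (intro mult_left_mono mult_right_mono powr_mono2) auto
    qed
    also have "\<dots> = tube_const CARD('n) \<alpha> \<beta> 0 * 2 powr (\<beta> * n) * h * (s powr (\<beta> * n) * \<sigma> powr (-p))"
      using s by (simp add: powr_mult n_def p_def)
    \<comment> \<open>This identity is the origin of the exponents of \<open>s\<close> and of 1 -
      t/s in \<open>profile\<close>: the bound for a jump to the top becomes exactly a multiple of G
      c^(-a), and the factor \<open>A\<close> in G turns up as 1/A.\<close>
    also have "s powr (\<beta> * n) * \<sigma> powr (-p) = 2 powr p / A * (G * c powr (-a))"
    proof -
      have "1 - t / s = 2 * \<sigma> / s" using s by (simp add: \<sigma>_def field_simps)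
      then have "(1 - t / s) powr (-p) = 2 powr (-p) * \<sigma> powr (-p) * s powr p"
        using \<sigma> s by (simp add: powr_divide powr_mult powr_minus field_simps)
      then have "G * c powr (-a) = A * (s powr (- (n * (1 - \<beta>) + \<alpha>)) * s powr p) * (2 powr (-p) * \<sigma> powr (-p)) * (c powr a * c powr (-a))"
        unfolding G_def profile_def by (simp add: n_def c_def t_def a_def p_def mult_ac)
      also have "s powr (- (n * (1 - \<beta>) + \<alpha>)) * s powr p = s powr (\<beta> * n)"
        unfolding powr_add[symmetric] by (simp add: p_def algebra_simps)
      also have "c powr a * c powr (-a) = 1" using c by (simp add: powr_minus)
      finally have "G * c powr (-a) = A * s powr (\<beta> * n) * (2 powr (-p) * \<sigma> powr (-p))" by simp
      then have "2 powr p / A * (G * c powr (-a)) = (2 powr p * 2 powr (-p)) * (s powr (\<beta> * n) * \<sigma> powr (-p))"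
        using par by simp
      also have "2 powr p * 2 powr (-p) = (1::real)" by (simp add: powr_minus)
      finally show ?thesis by simp
    qed
    finally show "measure M A3 \<le> tube_const CARD('n) \<alpha> \<beta> 0 * 2 powr (\<beta> * n) * 2 powr p / A * (h * (G * c powr (-a)))"
      by (simp add: mult_ac)
  qed (use G0 in auto)
  also have "\<dots> = G * (1 + h * c powr (-a) * ((3 * C + 4 * tail_const \<alpha>) * \<Lambda> powr (-\<alpha>)
      + 2 powr p * (tube_const CARD('n) \<alpha> \<beta> a * 2 powr p * (3/2) powr (\<beta> * p)) * r powr (- ((1 - \<beta>) * p))
      + tube_const CARD('n) \<alpha> \<beta> 0 * 2 powr (\<beta> * n) * 2 powr p / A - lower_const \<alpha> / 64))"
  proof -
    have "G * ((1 + 3 * C * w * (h * q)) - l / 64 * (h * q) + 4 * k * w * (h * q) + P * (T * v * (h * q))) + U * (h * (G * q))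
      = G * (1 + h * q * ((3 * C + 4 * k) * w + P * T * v + U - l / 64))" for w q l k P T v U :: real
      by (simp add: algebra_simps)
    then show ?thesis .
  qed
  finally show ?thesis
    unfolding a_def p_def .
qed

section \<open>Choice of the constants\<close>

lemma ex_powr_small:
  fixes e \<epsilon> K :: real
  assumes "e > 0" "\<epsilon> > 0" "K \<ge> 0"
  obtains X where "X \<ge> 1" "\<And>y. y \<ge> X \<Longrightarrow> K * y powr (-e) \<le> \<epsilon>"
proof
  define X where "X = max 1 ((K / \<epsilon>) powr (1 / e))"
  show "X \<ge> 1" by (simp add: X_def)
  fix y assume y: "y \<ge> X"
  then have y1: "y \<ge> 1" by (simp add: X_def)
  have "K / \<epsilon> = ((K / \<epsilon>) powr (1 / e)) powr e" using assms by (simp add: powr_powr)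
  also have "\<dots> \<le> y powr e" using y assms by (intro powr_mono2) (auto simp: X_def)
  finally show "K * y powr (-e) \<le> \<epsilon>" using assms y1 by (simp add: powr_minus field_simps)
qed

text \<open>Each of the three error terms receives a third, l/192, of the loss l/64. First \<Lambda>
  is fixed, then \<open>r\<close> and \<open>A\<close> in terms of it. Where the profile is at least
  1 the barrier has its maximal value and the inequality is trivial, so the integral bound serves
  only where the profile is below 1.\<close>

theorem barrier_supersolution:
  fixes \<alpha> \<beta> :: real
  assumes "0 < \<alpha>" "\<alpha> < 2" "0 < \<beta>" "\<beta> < 1"
  obtains A r where "A > 0" "r \<ge> 1"
    "\<And>(M :: (real \<times> (real ^ 'n)) measure) h s x. stable_distribution M \<alpha> h \<Longrightarrow> h \<le> 1 \<Longrightarrow> r \<le> s \<Longrightarrow>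
       0 < fst x \<Longrightarrow> fst x < s \<Longrightarrow> norm (snd x) < (r + fst x) powr \<beta> \<Longrightarrow>
       (\<integral>y. barrier \<alpha> \<beta> A r s (x + y) \<partial>M) \<le> barrier \<alpha> \<beta> A r s x"
proof -
  define n where "n = real CARD('n)"
  define p where "p = n + \<alpha>"
  define l where "l = lower_const \<alpha>"
  have n: "n \<ge> 1" by (simp add: n_def Suc_leI)
  have p: "p > 0" using assms n by (simp add: p_def)
  have l: "l > 0" by (simp add: l_def lower_const_pos)
  have K: "tail_const \<alpha> > 0" using assms tail_const_pos by simp
  have "\<exists>C\<ge>0. \<forall>u v \<kappa>. \<bar>u\<bar> \<le> \<kappa> \<longrightarrow> \<bar>v\<bar> \<le> \<kappa> \<longrightarrow> \<kappa> \<le> 1/2 \<longrightarrow>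
      (1 + u) powr (\<alpha> * \<beta>) * (1 - v) powr (-p) \<le> 1 + (\<alpha> * \<beta> * u + p * v) + C * \<kappa>\<^sup>2"
  proof (rule powr_prod_le_quadratic[of "\<alpha> * \<beta>" p])
    show "0 \<le> \<alpha> * \<beta>" "0 \<le> p" using assms p by simp_all
  qed blast
  then obtain C where C0: "C \<ge> 0" and C1: "\<forall>u v \<kappa>. \<bar>u\<bar> \<le> \<kappa> \<longrightarrow> \<bar>v\<bar> \<le> \<kappa> \<longrightarrow> \<kappa> \<le> 1/2 \<longrightarrow>
      (1 + u) powr (\<alpha> * \<beta>) * (1 - v) powr (-p) \<le> 1 + (\<alpha> * \<beta> * u + p * v) + C * \<kappa>\<^sup>2" by blast
  note C = C0 C1[rule_format]
  obtain L where L: "L \<ge> 1" "\<And>y. y \<ge> L \<Longrightarrow> tail_const \<alpha> * y powr (-\<alpha>) \<le> l / 2"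
    by (rule ex_powr_small[of \<alpha> "l / 2" "tail_const \<alpha>"]) (use assms l K in auto)
  note L = L(1) L(2)[OF order_refl]
  obtain X where X: "X \<ge> 1" "\<And>y. y \<ge> X \<Longrightarrow> (3 * C + 4 * tail_const \<alpha>) * y powr (-\<alpha>) \<le> l / 192"
    by (rule ex_powr_small[of \<alpha> "l / 192" "3 * C + 4 * tail_const \<alpha>"]) (use assms l K C(1) in auto)
  define \<Lambda> where "\<Lambda> = max X (max (8 * L) (8 * L * (\<alpha> * \<beta> + p)))"
  have \<Lambda>: "\<Lambda> \<ge> 1" "8 * L \<le> \<Lambda>" "8 * L * (\<alpha> * \<beta> + p) \<le> \<Lambda>" "(3 * C + 4 * tail_const \<alpha>) * \<Lambda> powr (-\<alpha>) \<le> l / 192"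
    using X by (auto simp: \<Lambda>_def)
  define T1 where "T1 = 2 powr p * (tube_const CARD('n) \<alpha> \<beta> (\<alpha> * \<beta>) * 2 powr p * (3/2) powr (\<beta> * p))"
  define T0 where "T0 = tube_const CARD('n) \<alpha> \<beta> 0 * 2 powr (\<beta> * n) * 2 powr p"
  have bp: "\<beta> * p < p" using assms p by simp
  have bn: "\<beta> * n < n + \<alpha>"
  proof -
    have "\<beta> * n < 1 * n" using assms n by (intro mult_strict_right_mono) auto
    then show ?thesis using assms by simp
  qed
  have T1: "T1 > 0" unfolding T1_def
    using tube_const_pos[of \<alpha> "\<alpha> * \<beta>" \<beta> "CARD('n)"] assms bp by (simp add: p_def n_def algebra_simps)
  have T0: "T0 > 0" unfolding T0_def
    using tube_const_pos[of \<alpha> 0 \<beta> "CARD('n)"] assms bn by (simp add: n_def)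
  have e1: "(1 - \<beta>) * p > 0" using assms p by simp
  obtain Y where Y: "Y \<ge> 1" "\<And>y. y \<ge> Y \<Longrightarrow> T1 * y powr (- ((1 - \<beta>) * p)) \<le> l / 192"
    by (rule ex_powr_small[OF e1, of "l / 192" T1]) (use l T1 in auto)
  \<comment> \<open>The second entry yields \<Lambda> c^\<beta> \<le> c for all c \<ge> r: the tube
    is thin compared with its shifted height.\<close>
  define r where "r = max Y (\<Lambda> powr (1 / (1 - \<beta>)))"
  have r: "r \<ge> 1" "T1 * r powr (- ((1 - \<beta>) * p)) \<le> l / 192" using Y by (auto simp: r_def)
  have r\<Lambda>: "\<Lambda> \<le> r powr (1 - \<beta>)"
  proof -
    have "\<Lambda> = (\<Lambda> powr (1 / (1 - \<beta>))) powr (1 - \<beta>)" using \<Lambda>(1) assms by (simp add: powr_powr)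
    also have "\<dots> \<le> r powr (1 - \<beta>)" using assms by (intro powr_mono2) (auto simp: r_def)
    finally show ?thesis .
  qed
  \<comment> \<open>The second entry makes the profile at least 1 wherever s - t \<le> \<Lambda>
    c^\<beta>. Conversely, a profile below 1 guarantees room between the current height and
    \<open>s\<close>.\<close>
  define A where "A = max (192 * T0 / l) (\<Lambda> powr p * 2 powr (\<beta> * n))"
  have A: "A > 0" using \<Lambda>(1) by (simp add: A_def less_max_iff_disj)
  have AT: "T0 / A \<le> l / 192"
  proof -
    have "192 * T0 / l \<le> A" by (simp add: A_def)
    then show ?thesis using l A by (simp add: field_simps)
  qed
  show thesis
  proof (rule that[OF A r(1)])
    fix M :: "(real \<times> (real ^ 'n)) measure" and h s and x :: "real \<times> (real ^ 'n)"
    assume M: "stable_distribution M \<alpha> h" and h: "h \<le> 1" and s: "r \<le> s"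
      and x: "0 < fst x" "fst x < s" "norm (snd x) < (r + fst x) powr \<beta>"
    interpret stable_distribution M \<alpha> h by (rule M)
    define G where "G = profile CARD('n) \<alpha> \<beta> A r s (fst x)"
    have bx: "barrier \<alpha> \<beta> A r s x = min 1 G" using x by (simp add: barrier_def G_def)
    have s1: "s \<ge> 1" using s r by simp
    show "(\<integral>y. barrier \<alpha> \<beta> A r s (x + y) \<partial>M) \<le> barrier \<alpha> \<beta> A r s x"
    proof (cases "G < 1")
      case False
      have "(\<integral>y. barrier \<alpha> \<beta> A r s (x + y) \<partial>M) \<le> (\<integral>y. 1 \<partial>M)"
      proof (rule integral_mono)
        show "integrable M (\<lambda>y. barrier \<alpha> \<beta> A r s (x + y))"
          by (rule integrable_const_bound[where B=1]) (use A in \<open>simp_all add: barrier_abs_le\<close>)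
      qed (rule integrable_const, rule barrier_bounds(2))
      then show ?thesis using False bx prob_space by simp
    next
      case True
      define c where "c = r + fst x"
      define \<delta> where "\<delta> = min c (s - fst x)"
      have c: "c \<ge> r" "c \<ge> 1" "c \<le> 2 * s" using x r s by (simp_all add: c_def)
      have \<Lambda>c: "\<Lambda> * c powr \<beta> \<le> c"
      proof -
        have "\<Lambda> \<le> c powr (1 - \<beta>)"
          using r\<Lambda> powr_mono2[of "1 - \<beta>" r c] assms c r by simp
        then have "\<Lambda> * c powr \<beta> \<le> c powr (1 - \<beta>) * c powr \<beta>" by (intro mult_right_mono) auto
        then show ?thesis using c by (simp add: powr_add[symmetric])
      qed
      have \<Lambda>s: "\<Lambda> * c powr \<beta> \<le> s - fst x"
      proof (rule ccontr)
        assume "\<not> ?thesis"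
        then have lt: "s - fst x \<le> \<Lambda> * c powr \<beta>" by simp
        have d0: "0 < s - fst x" using x by simp
        have "1 - fst x / s = (s - fst x) / s" using s1 by (simp add: field_simps)
        then have "(1 - fst x / s) powr (-p) = s powr p * (s - fst x) powr (-p)"
          using d0 s1 by (simp add: powr_divide powr_minus field_simps)
        then have Geq: "G = A * (s powr (- (n * (1 - \<beta>) + \<alpha>)) * s powr p) * c powr (\<alpha> * \<beta>) * (s - fst x) powr (-p)"
          by (simp add: G_def profile_def n_def p_def c_def mult_ac)
        have "s powr (- (n * (1 - \<beta>) + \<alpha>)) * s powr p = s powr (\<beta> * n)"
          unfolding powr_add[symmetric] by (simp add: p_def algebra_simps)
        then have Geq: "G = A * s powr (\<beta> * n) * c powr (\<alpha> * \<beta>) * (s - fst x) powr (-p)" using Geq by simp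
        \<comment> \<open>This is the formula for \<open>G\<close> with the second entry of
          \<open>A\<close>, with c/2 for \<open>s\<close> and with \<Lambda> c^\<beta> for s - t.
          The powers of \<open>c\<close> cancel because \<beta> n + \<alpha>\<beta> = \<beta>
          p.\<close>
        have "1 = (\<Lambda> powr p * 2 powr (\<beta> * n)) * ((c / 2) powr (\<beta> * n)) * c powr (\<alpha> * \<beta>) * (\<Lambda> * c powr \<beta>) powr (-p)"
        proof -
          have e1: "(c / 2) powr (\<beta> * n) = c powr (\<beta> * n) / 2 powr (\<beta> * n)" using c by (simp add: powr_divide)
          have e2: "(\<Lambda> * c powr \<beta>) powr (-p) = \<Lambda> powr (-p) * c powr (- (\<beta> * p))"
            using c \<Lambda> by (simp add: powr_mult powr_powr)
          have e3: "c powr (\<beta> * n) * c powr (\<alpha> * \<beta>) * c powr (- (\<beta> * p)) = 1"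
            unfolding powr_add[symmetric] using c by (simp add: p_def algebra_simps)
          have e4: "\<Lambda> powr p * \<Lambda> powr (-p) = 1" using \<Lambda> by (simp add: powr_minus)
          have "1 = (u * b) * (x / b) * z * (v * y)" if "b \<noteq> 0" "u * v = 1" "x * z * y = 1" for u b x z v y :: real
          proof -
            have "(u * b) * (x / b) * z * (v * y) = (u * v) * (x * z * y)" using that(1) by simp
            then show ?thesis using that by simp
          qed
          from this[OF _ e4 e3, of "2 powr (\<beta> * n)"] show ?thesis unfolding e1 e2 by simp
        qed
        also have "\<dots> \<le> A * s powr (\<beta> * n) * c powr (\<alpha> * \<beta>) * (s - fst x) powr (-p)"
        proof (intro mult_mono)
          show "\<Lambda> powr p * 2 powr (\<beta> * n) \<le> A" by (simp add: A_def)
          show "(c / 2) powr (\<beta> * n) \<le> s powr (\<beta> * n)" using c assms n by (intro powr_mono2) auto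
          show "(\<Lambda> * c powr \<beta>) powr (-p) \<le> (s - fst x) powr (-p)" using lt d0 p by (intro powr_mono2') auto
        qed (use A in auto)
        finally show False using True Geq by simp
      qed
      have \<Lambda>\<delta>: "\<Lambda> * c powr \<beta> \<le> \<delta>" using \<Lambda>c \<Lambda>s by (simp add: \<delta>_def)
      have "(\<integral>y. barrier \<alpha> \<beta> A r s (x + y) \<partial>M) \<le> G * (1 + h * c powr (- (\<alpha> * \<beta>)) *
        ((3 * C + 4 * tail_const \<alpha>) * \<Lambda> powr (-\<alpha>) + T1 * r powr (- ((1 - \<beta>) * p)) + T0 / A - l / 64))"
        unfolding T1_def T0_def l_def p_def n_def
        by (rule barrier_integral_le[OF M h assms(3,4) A r(1) s x c_def \<delta>_def G_def C[unfolded p_def n_def]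
            L[unfolded l_def] \<Lambda>(2) \<Lambda>(3)[unfolded p_def n_def] \<Lambda>\<delta>])
      also have "\<dots> \<le> G * (1 + h * c powr (- (\<alpha> * \<beta>)) * 0)"
      proof (intro mult_left_mono add_left_mono)
        show "(3 * C + 4 * tail_const \<alpha>) * \<Lambda> powr (-\<alpha>) + T1 * r powr (- ((1 - \<beta>) * p)) + T0 / A - l / 64 \<le> 0"
          using \<Lambda>(4) r(2) AT by linarith
      qed (use time A in \<open>auto simp: G_def profile_nonneg\<close>)
      finally show ?thesis using True bx by simp
    qed
  qed
qed

section \<open>Exit of the process from an open set\<close>

text \<open>Optional stopping for a nonnegative supermartingale, done by hand: the expectation
  \<open>a k\<close> of \<open>f\<close> over paths that stayed in \<open>U\<close> before time
  \<open>k\<close> pays for the event \<open>E k\<close> and for \<open>a (Suc k)\<close>. Values in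
  \<open>ennreal\<close> avoid integrability questions.\<close>

lemma (in prob_space) walk_exit_le:
  fixes S :: "nat \<Rightarrow> 'a \<Rightarrow> 'b::euclidean_space" and f :: "'b \<Rightarrow> ennreal"
  assumes S [measurable]: "\<And>k. random_variable borel (S k)"
    and start: "AE \<omega> in M. S 0 \<omega> = x"
    and indep: "\<And>n. indep_vars (\<lambda>_. borel) (\<lambda>k \<omega>. S (Suc k) \<omega> - S k \<omega>) {..<n}"
    and law: "\<And>k. distr M borel (\<lambda>\<omega>. S (Suc k) \<omega> - S k \<omega>) = \<mu>"
    and f [measurable]: "f \<in> borel_measurable borel"
    and UT [measurable]: "U \<in> sets borel" "T \<in> sets borel" and disj: "U \<inter> T = {}"
    and f_T: "\<And>z. z \<in> T \<Longrightarrow> 1 \<le> f z"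
    and f_U: "\<And>z. z \<in> U \<Longrightarrow> (\<integral>\<^sup>+y. f (z + y) \<partial>\<mu>) \<le> f z"
  shows "emeasure M (\<Union>k. {\<omega> \<in> space M. S k \<omega> \<in> T \<and> (\<forall>j<k. S j \<omega> \<in> U)}) \<le> f x"
proof -
  define D where "D k \<omega> = S (Suc k) \<omega> - S k \<omega>" for k \<omega>
  have [measurable]: "random_variable borel (D k)" for k unfolding D_def by measurable
  define A where "A k = {\<omega> \<in> space M. \<forall>j<k. S j \<omega> \<in> U}" for k
  define E where "E k = {\<omega> \<in> space M. S k \<omega> \<in> T \<and> (\<forall>j<k. S j \<omega> \<in> U)}" for k
  have [measurable]: "A k \<in> sets M" "E k \<in> sets M" for k unfolding A_def E_def by measurable
  define a where "a k = (\<integral>\<^sup>+\<omega>. indicator (A k) \<omega> * f (S k \<omega>) \<partial>M)" for k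
  \<comment> \<open>At time \<open>k\<close> such a path is in \<open>T\<close>, where f \<ge> 1 and
    it stops, or in \<open>U\<close>, where it continues, or elsewhere, where its value is
    dropped.\<close>
  have split: "emeasure M (E k) + (\<integral>\<^sup>+\<omega>. indicator (A (Suc k)) \<omega> * f (S k \<omega>) \<partial>M) \<le> a k" for k
  proof -
    have "emeasure M (E k) + (\<integral>\<^sup>+\<omega>. indicator (A (Suc k)) \<omega> * f (S k \<omega>) \<partial>M) =
        (\<integral>\<^sup>+\<omega>. indicator (E k) \<omega> + indicator (A (Suc k)) \<omega> * f (S k \<omega>) \<partial>M)"
      by (subst nn_integral_add) auto
    also have "\<dots> \<le> a k"
      unfolding a_def
    proof (rule nn_integral_mono)
      fix \<omega> assume "\<omega> \<in> space M"
      then show "indicator (E k) \<omega> + indicator (A (Suc k)) \<omega> * f (S k \<omega>) \<le> indicator (A k) \<omega> * f (S k \<omega>)"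
        using f_T[of "S k \<omega>"] disj by (auto simp: E_def A_def less_Suc_eq indicator_def)
    qed
    finally show ?thesis .
  qed
  have step: "a (Suc k) \<le> (\<integral>\<^sup>+\<omega>. indicator (A (Suc k)) \<omega> * f (S k \<omega>) \<partial>M)" for k
  proof -
    let ?P = "Pi\<^sub>M {..<k} (\<lambda>_. borel :: 'b measure)"
    define V where "V \<omega> = restrict (\<lambda>i. D i \<omega>) {..<k}" for \<omega>
    define \<sigma> where "\<sigma> j v = x + (\<Sum>i<j. v i)" for j and v :: "nat \<Rightarrow> 'b"
    have \<sigma>_meas [measurable]: "\<sigma> j \<in> borel_measurable ?P" if "j \<le> k" for j
      unfolding \<sigma>_def by (intro borel_measurable_add borel_measurable_const borel_measurable_sum
          measurable_component_singleton) (use that in auto)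
    have V_meas [measurable]: "V \<in> measurable M ?P"
      unfolding V_def by (rule measurable_restrict) measurable
    \<comment> \<open>The last increment is kept as a function on the one-point index set because
      \<open>indep_var_restrict\<close> yields independence of blocks of this form.\<close>
    let ?Q = "Pi\<^sub>M {k} (\<lambda>_. borel :: 'b measure)"
    define W where "W \<omega> = restrict (\<lambda>i. D i \<omega>) {k}" for \<omega>
    have W_meas [measurable]: "W \<in> measurable M ?Q"
      unfolding W_def by (rule measurable_restrict) measurable
    have "indep_var ?P V ?Q W"
      unfolding V_def W_def D_def by (rule indep_var_restrict[OF indep[of "Suc k"]]) auto
    then have joint: "distr M ?P V \<Otimes>\<^sub>M distr M ?Q W = distr M (?P \<Otimes>\<^sub>M ?Q) (\<lambda>\<omega>. (V \<omega>, W \<omega>))"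
      by (simp add: indep_var_distribution_eq)
    interpret W: prob_space "distr M ?Q W" by (rule prob_space_distr) measurable
    have law': "distr M borel (D k) = \<mu>" using law unfolding D_def .
    have sets_\<mu> [measurable_cong]: "sets \<mu> = sets borel" unfolding law'[symmetric] by simp
    define B where "B = {v \<in> space ?P. \<forall>j\<le>k. \<sigma> j v \<in> U}"
    have [measurable]: "B \<in> sets ?P"
    proof -
      have "B = (\<Inter>j\<in>{..k}. \<sigma> j -` U \<inter> space ?P)" by (auto simp: B_def)
      also have "\<dots> \<in> sets ?P"
        by (intro sets.finite_INT measurable_sets[OF \<sigma>_meas UT(1)]) auto
      finally show ?thesis .
    qed
    have [measurable]: "\<sigma> k \<in> borel_measurable ?P" by (rule \<sigma>_meas) simp
    \<comment> \<open>The increments determine the walk only almost surely, as its starting point is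
      \<open>x\<close> only almost surely.\<close>
    have S_eq: "AE \<omega> in M. \<forall>j\<le>k. S j \<omega> = \<sigma> j (V \<omega>)"
      using start
    proof eventually_elim
      case (elim \<omega>)
      have "S j \<omega> = \<sigma> j (V \<omega>)" if "j \<le> k" for j
        using that
      proof (induction j)
        case 0
        then show ?case using elim by (simp add: \<sigma>_def)
      next
        case (Suc j)
        then have "S (Suc j) \<omega> = \<sigma> j (V \<omega>) + D j \<omega>" by (simp add: D_def)
        also have "\<dots> = \<sigma> (Suc j) (V \<omega>)" using Suc.prems by (simp add: \<sigma>_def V_def add.assoc)
        finally show ?case .
      qed
      then show ?case by simp
    qed
    have A_eq: "AE \<omega> in M. indicator (A (Suc k)) \<omega> = (indicator B (V \<omega>) :: ennreal) \<and> S k \<omega> = \<sigma> k (V \<omega>)"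
      using S_eq AE_space
    proof eventually_elim
      case (elim \<omega>)
      then have "V \<omega> \<in> space ?P" using V_meas by (meson measurable_space)
      then show ?case using elim by (auto simp: A_def B_def indicator_def less_Suc_eq_le)
    qed
    have "a (Suc k) = (\<integral>\<^sup>+\<omega>. indicator B (V \<omega>) * f (\<sigma> k (V \<omega>) + W \<omega> k) \<partial>M)"
      unfolding a_def
    proof (rule nn_integral_cong_AE)
      show "AE \<omega> in M. indicator (A (Suc k)) \<omega> * f (S (Suc k) \<omega>) = indicator B (V \<omega>) * f (\<sigma> k (V \<omega>) + W \<omega> k)"
        using A_eq
      proof eventually_elim
        case (elim \<omega>)
        have "S (Suc k) \<omega> = S k \<omega> + W \<omega> k" by (simp add: D_def W_def)
        then show ?case using elim by simp
      qed
    qed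
    also have "\<dots> = (\<integral>\<^sup>+z. indicator B (fst z) * f (\<sigma> k (fst z) + snd z k) \<partial>distr M (?P \<Otimes>\<^sub>M ?Q) (\<lambda>\<omega>. (V \<omega>, W \<omega>)))"
      by (subst nn_integral_distr) auto
    also have "\<dots> = (\<integral>\<^sup>+v. \<integral>\<^sup>+w. indicator B v * f (\<sigma> k v + w k) \<partial>distr M ?Q W \<partial>distr M ?P V)"
      unfolding joint[symmetric] by (subst W.nn_integral_fst[symmetric]) auto
    also have "\<dots> = (\<integral>\<^sup>+v. indicator B v * (\<integral>\<^sup>+y. f (\<sigma> k v + y) \<partial>\<mu>) \<partial>distr M ?P V)"
    proof (rule nn_integral_cong)
      fix v
      have "(\<integral>\<^sup>+w. indicator B v * f (\<sigma> k v + w k) \<partial>distr M ?Q W) = indicator B v * (\<integral>\<^sup>+w. f (\<sigma> k v + w k) \<partial>distr M ?Q W)"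
        by (intro nn_integral_cmult) auto
      also have "(\<integral>\<^sup>+w. f (\<sigma> k v + w k) \<partial>distr M ?Q W) = (\<integral>\<^sup>+y. f (\<sigma> k v + y) \<partial>\<mu>)"
        unfolding law'[symmetric] by (simp add: nn_integral_distr W_def)
      finally show "(\<integral>\<^sup>+w. indicator B v * f (\<sigma> k v + w k) \<partial>distr M ?Q W)
        = indicator B v * (\<integral>\<^sup>+y. f (\<sigma> k v + y) \<partial>\<mu>)" .
    qed
    also have "\<dots> \<le> (\<integral>\<^sup>+v. indicator B v * f (\<sigma> k v) \<partial>distr M ?P V)"
    proof (rule nn_integral_mono)
      fix v
      show "indicator B v * (\<integral>\<^sup>+y. f (\<sigma> k v + y) \<partial>\<mu>) \<le> indicator B v * f (\<sigma> k v)"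
        using f_U[of "\<sigma> k v"] by (auto simp: indicator_def B_def)
    qed
    also have "\<dots> = (\<integral>\<^sup>+\<omega>. indicator B (V \<omega>) * f (\<sigma> k (V \<omega>)) \<partial>M)"
      by (subst nn_integral_distr) auto
    also have "\<dots> = (\<integral>\<^sup>+\<omega>. indicator (A (Suc k)) \<omega> * f (S k \<omega>) \<partial>M)"
      by (rule nn_integral_cong_AE) (use A_eq in eventually_elim, simp)
    finally show ?thesis .
  qed
  have sum_le: "(\<Sum>k<N. emeasure M (E k)) + a N \<le> f x" for N
  proof (induction N)
    case 0
    have "a 0 = (\<integral>\<^sup>+\<omega>. f x \<partial>M)"
      unfolding a_def
    proof (rule nn_integral_cong_AE)
      show "AE \<omega> in M. indicator (A 0) \<omega> * f (S 0 \<omega>) = f x"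
        using start AE_space by eventually_elim (simp add: A_def)
    qed
    then show ?case by (simp add: emeasure_space_1)
  next
    case (Suc N)
    have "emeasure M (E N) + a (Suc N) \<le> a N"
      using add_left_mono[OF step[of N], of "emeasure M (E N)"] split[of N] by (rule order_trans)
    then have "(\<Sum>k<N. emeasure M (E k)) + (emeasure M (E N) + a (Suc N)) \<le> (\<Sum>k<N. emeasure M (E k)) + a N"
      by (rule add_left_mono)
    also note Suc.IH
    finally show ?case by (simp add: add.assoc)
  qed
  have "emeasure M (\<Union>k. E k) \<le> (\<Sum>k. emeasure M (E k))"
    by (rule emeasure_subadditive_countably) auto
  also have "\<dots> \<le> f x"
  proof (rule suminf_le_const[OF summableI])
    show "(\<Sum>k<N. emeasure M (E k)) \<le> f x" for N
      using sum_le[of N] by (meson add_increasing2 order_trans order_refl zero_le le_add_same_cancel1)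
  qed
  finally show ?thesis unfolding E_def .
qed

text \<open>At the exit time the path is in the open set \<open>W\<close>, so right-continuity keeps
  it in \<open>T\<close> for some time afterwards, and every grid finer than this interval has a
  point in it. Strictly before the exit time the path is in \<open>U\<close>, hence a grid point
  outside \<open>U'\<close> is again in \<open>T\<close>.\<close>

lemma exit_grid:
  fixes \<omega> :: "real \<Rightarrow> 'b::topological_space"
  assumes right: "\<And>t. 0 \<le> t \<Longrightarrow> (\<omega> \<longlongrightarrow> \<omega> t) (at_right t)"
    and U: "open U" and exit: "exit_time U \<omega> < \<infinity>" "\<omega> (real_of_ereal (exit_time U \<omega>)) \<in> V"
    and W: "open W" "V - U \<subseteq> W" "W \<subseteq> T" and UT: "U \<subseteq> U' \<union> T" "U' \<inter> T = {}"
  shows "\<exists>N. \<forall>m\<ge>N. \<exists>k. \<omega> (real k * (1 / real (Suc m))) \<in> T \<and> (\<forall>j<k. \<omega> (real j * (1 / real (Suc m))) \<in> U')"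
proof -
  define E where "E = {t. 0 \<le> t \<and> \<omega> t \<notin> U}"
  define \<tau> where "\<tau> = Inf E"
  have ne: "E \<noteq> {}"
  proof
    assume "E = {}"
    then show False using exit(1) by (simp add: exit_time_def E_def[symmetric] top_ereal_def)
  qed
  have bdd: "bdd_below E" by (auto simp: E_def bdd_below_def)
  have et: "exit_time U \<omega> = ereal \<tau>"
    unfolding exit_time_def E_def[symmetric] \<tau>_def using ereal_Inf'[OF bdd ne] by simp
  have \<tau>0: "0 \<le> \<tau>" unfolding \<tau>_def using ne by (intro cInf_greatest) (auto simp: E_def)
  have before: "\<omega> t \<in> U" if "0 \<le> t" "t < \<tau>" for t
  proof (rule ccontr)
    assume "\<omega> t \<notin> U"
    then have "t \<in> E" using that by (simp add: E_def)
    then have "\<tau> \<le> t" unfolding \<tau>_def by (rule cInf_lower[OF _ bdd])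
    then show False using that by simp
  qed
  \<comment> \<open>Were the path in the open set \<open>U\<close> at time \<tau>, it would stay
    there for a while, and the infimum would be larger.\<close>
  have at: "\<omega> \<tau> \<notin> U"
  proof
    assume "\<omega> \<tau> \<in> U"
    then have "eventually (\<lambda>t. \<omega> t \<in> U) (at_right \<tau>)"
      using right[OF \<tau>0] U by (simp add: tendsto_def)
    then obtain b where b: "b > \<tau>" "\<And>t. \<tau> < t \<Longrightarrow> t < b \<Longrightarrow> \<omega> t \<in> U"
      unfolding eventually_at_right_field by blast
    have "b \<le> \<tau>"
      unfolding \<tau>_def
    proof (rule cInf_greatest[OF ne])
      fix t assume t: "t \<in> E"
      then have "\<tau> \<le> t" unfolding \<tau>_def by (rule cInf_lower[OF _ bdd])
      moreover have "\<omega> t \<notin> U" using t by (simp add: E_def)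
      ultimately show "b \<le> t" using b(2)[of t] \<open>\<omega> \<tau> \<in> U\<close> by (cases "t = \<tau>") force+
    qed
    then show False using b by simp
  qed
  have "\<omega> \<tau> \<in> W" using exit(2) at W(2) by (auto simp: et)
  then have "eventually (\<lambda>t. \<omega> t \<in> W) (at_right \<tau>)"
    using right[OF \<tau>0] W(1) by (simp add: tendsto_def)
  then obtain b where b: "b > \<tau>" "\<And>t. \<tau> < t \<Longrightarrow> t < b \<Longrightarrow> \<omega> t \<in> W"
    unfolding eventually_at_right_field by blast
  have after: "\<omega> t \<in> T" if "\<tau> \<le> t" "t < b" for t
    using that b(2)[of t] \<open>\<omega> \<tau> \<in> W\<close> W(3) by (cases "t = \<tau>") auto
  obtain N where N: "inverse (real (Suc N)) < b - \<tau>" using reals_Archimedean[of "b - \<tau>"] b by auto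
  show ?thesis
  proof (rule exI[of _ N], intro allI impI)
    fix m assume m: "m \<ge> N"
    define h where "h = 1 / real (Suc m)"
    have h: "h > 0" "h < b - \<tau>"
    proof -
      have "h \<le> 1 / real (Suc N)" unfolding h_def using m by (intro divide_left_mono) auto
      then show "h < b - \<tau>" using N by (simp add: inverse_eq_divide)
    qed (simp add: h_def)
    define k0 where "k0 = nat \<lceil>\<tau> / h\<rceil>"
    have "0 \<le> \<tau> / h" using \<tau>0 h by simp
    then have k0: "\<tau> / h \<le> real k0" "real k0 < \<tau> / h + 1"
      unfolding k0_def by linarith+
    have "\<tau> \<le> real k0 * h" "real k0 * h < \<tau> + h"
      using k0 h by (simp_all add: field_simps)
    then have T0: "\<omega> (real k0 * h) \<in> T" using h by (intro after) auto
    \<comment> \<open>The first grid time outside \<open>U'\<close> may precede \<open>k0\<close>,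
      since \<open>T\<close> can be visited before the exit from \<open>U\<close>.\<close>
    define k where "k = (LEAST k. \<omega> (real k * h) \<notin> U')"
    have "\<omega> (real k0 * h) \<notin> U'" using T0 UT by auto
    then have k: "\<omega> (real k * h) \<notin> U'" "k \<le> k0"
      unfolding k_def by (rule LeastI, rule Least_le)
    have jk: "\<omega> (real j * h) \<in> U'" if "j < k" for j
      using not_less_Least[of j "\<lambda>k. \<omega> (real k * h) \<notin> U'"] that unfolding k_def by blast
    have "\<omega> (real k * h) \<in> T"
    proof (cases "k = k0")
      case False
      then have "real k \<le> real k0 - 1" using k(2) by linarith
      then have "real k < \<tau> / h" using k0 by linarith
      then have "real k * h < \<tau>" using h by (simp add: field_simps)
      then have "\<omega> (real k * h) \<in> U" using h by (intro before) auto
      then show ?thesis using k(1) UT(1) by blast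
    qed (use T0 in simp)
    then show "\<exists>k. \<omega> (real k * (1 / real (Suc m))) \<in> T \<and> (\<forall>j<k. \<omega> (real j * (1 / real (Suc m))) \<in> U')"
      using jk unfolding h_def by blast
  qed
qed

section \<open>From random walks on grids to the process\<close>

context isotropic_stable_law
begin

lemma space_eq: "space P = space path_space"
  by (rule sets_eq_imp_space_eq[OF sets_eq])

lemma coordinate_measurable:
  assumes "0 \<le> t"
  shows "(\<lambda>\<omega>. \<omega> t) \<in> borel_measurable P"
proof -
  have "(\<lambda>\<omega>. \<omega> t) \<in> borel_measurable (path_space :: (real \<Rightarrow> 'b) measure)"
    unfolding path_space_def
    by (intro measurable_restrict_space1 measurable_component_singleton) (use assms in auto)
  then show ?thesis by (simp add: measurable_cong_sets[OF sets_eq refl])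
qed

lemma increment_law:
  assumes "0 < \<alpha>" "\<alpha> < 2" and h: "0 < h"
  shows "stable_distribution (distr P borel (\<lambda>\<omega>. \<omega> h - \<omega> 0)) \<alpha> h"
proof -
  note [measurable] = coordinate_measurable[of 0, simplified] coordinate_measurable[of h]
  have [measurable]: "(\<lambda>\<omega>. \<omega> h) \<in> borel_measurable P" using coordinate_measurable h by simp
  interpret D: prob_space "distr P borel (\<lambda>\<omega>. \<omega> h - \<omega> 0)" by (rule prob_space_distr) measurable
  show ?thesis
  proof unfold_locales
    fix \<xi>
    have "(\<integral>y. cis (\<xi> \<bullet> y) \<partial>distr P borel (\<lambda>\<omega>. \<omega> h - \<omega> 0)) = (\<integral>\<omega>. cis (\<xi> \<bullet> (\<omega> h - \<omega> 0)) \<partial>P)"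
      by (subst integral_distr) auto
    also have "\<dots> = (\<integral>\<omega>. exp (\<i> * complex_of_real (\<xi> \<bullet> (\<omega> h - x))) \<partial>P)"
    proof (rule integral_cong_AE)
      show "AE \<omega> in P. cis (\<xi> \<bullet> (\<omega> h - \<omega> 0)) = exp (\<i> * complex_of_real (\<xi> \<bullet> (\<omega> h - x)))"
        using start by eventually_elim (simp add: cis_conv_exp)
      show "(\<lambda>\<omega>. cis (\<xi> \<bullet> (\<omega> h - \<omega> 0))) \<in> borel_measurable P"
        by (rule measurable_compose[OF _ borel_measurable_cis_inner]) measurable
      show "(\<lambda>\<omega>. exp (\<i> * complex_of_real (\<xi> \<bullet> (\<omega> h - x)))) \<in> borel_measurable P"
        unfolding cis_conv_exp[symmetric]
        by (rule measurable_compose[OF _ borel_measurable_cis_inner]) measurable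
    qed
    also have "\<dots> = complex_of_real (exp (- (h * norm \<xi> powr \<alpha>)))"
      by (rule characteristic_function) (use h in simp)
    finally show "(\<integral>y. cis (\<xi> \<bullet> y) \<partial>distr P borel (\<lambda>\<omega>. \<omega> h - \<omega> 0)) = complex_of_real (exp (- (h * norm \<xi> powr \<alpha>)))" .
  qed (use assms in auto)
qed

text \<open>The bound \<open>f x\<close> for the sampled walks does not depend on the mesh, so it
  passes to the event that all sufficiently fine grids detect the exit. That event is measurable and
  contains the exit event, which is enough for the completion.\<close>

lemma exit_prob_le:
  fixes f :: "'b \<Rightarrow> real"
  assumes \<alpha>: "0 < \<alpha>" "\<alpha> < 2"
    and U: "open U" and W: "open W" "V - U \<subseteq> W" "W \<subseteq> T" and UT: "U \<subseteq> U' \<union> T" "U' \<inter> T = {}"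
    and [measurable]: "U' \<in> sets borel" "T \<in> sets borel"
    and f [measurable]: "f \<in> borel_measurable borel" and f01: "\<And>z. 0 \<le> f z" "\<And>z. f z \<le> 1" "\<And>z. z \<in> T \<Longrightarrow> f z = 1"
    and super: "\<And>M h z. stable_distribution M \<alpha> h \<Longrightarrow> h \<le> 1 \<Longrightarrow> z \<in> U' \<Longrightarrow> (\<integral>y. f (z + y) \<partial>M) \<le> f z"
  shows "exit_prob P U V \<le> f x"
proof -
  define h where "h m = 1 / real (Suc m)" for m
  have h: "0 < h m" "h m \<le> 1" for m by (simp_all add: h_def)
  define E where "E m = (\<Union>k. {\<omega> \<in> space P. \<omega> (real k * h m) \<in> T \<and> (\<forall>j<k. \<omega> (real j * h m) \<in> U')})" for m
  have cm: "(\<lambda>\<omega>. \<omega> (real k * h m)) \<in> borel_measurable P" for k m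
    by (rule coordinate_measurable) (use h[of m] in simp)
  note [measurable] = cm
  have [measurable]: "E m \<in> sets P" for m unfolding E_def by measurable
  have E_le: "measure P (E m) \<le> f x" for m
  proof -
    let ?\<mu> = "distr P borel (\<lambda>\<omega>. \<omega> (h m) - \<omega> 0)"
    interpret \<mu>: stable_distribution ?\<mu> \<alpha> "h m" by (rule increment_law[OF \<alpha> h(1)])
    have "emeasure P (E m) \<le> ennreal (f x)"
      unfolding E_def
    proof (rule walk_exit_le[where \<mu>="?\<mu>" and f="\<lambda>z. ennreal (f z)"])
      show "AE \<omega> in P. \<omega> (real 0 * h m) = x" using start by simp
      show "indep_vars (\<lambda>_. borel) (\<lambda>k \<omega>. \<omega> (real (Suc k) * h m) - \<omega> (real k * h m)) {..<n}" for n
        by (rule independent_increments) (use h[of m] in auto)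
      show "distr P borel (\<lambda>\<omega>. \<omega> (real (Suc k) * h m) - \<omega> (real k * h m)) = ?\<mu>" for k
        using stationary_increments[of "real k * h m" "h m"] h[of m] by (simp add: algebra_simps)
      show "(\<integral>\<^sup>+y. ennreal (f (z + y)) \<partial>?\<mu>) \<le> ennreal (f z)" if "z \<in> U'" for z
      proof -
        have "integrable ?\<mu> (\<lambda>y. f (z + y))"
          by (rule \<mu>.integrable_const_bound[where B=1]) (use f01 in auto)
        then have "(\<integral>\<^sup>+y. ennreal (f (z + y)) \<partial>?\<mu>) = ennreal (\<integral>y. f (z + y) \<partial>?\<mu>)"
          using f01 by (intro nn_integral_eq_integral) auto
        also have "\<dots> \<le> ennreal (f z)"
          by (intro ennreal_leI super[OF _ h(2) that]) (rule increment_law[OF \<alpha> h(1)])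
        finally show ?thesis .
      qed
    qed (use UT f01 cm in auto)
    then show ?thesis using f01 by (simp add: emeasure_eq_measure)
  qed
  \<comment> \<open>These events increase in \<open>n\<close> and each is contained in
    \<open>E n\<close>, so continuity from below is the form of Fatou's lemma that is used.\<close>
  define I where "I n = (\<Inter>m\<in>{n..}. E m)" for n
  have [measurable]: "I n \<in> sets P" for n unfolding I_def by (rule sets.countable_INT') auto
  have sub: "exit_into P U V \<subseteq> (\<Union>n. I n)"
  proof
    fix \<omega> assume \<omega>: "\<omega> \<in> exit_into P U V"
    then have sp: "\<omega> \<in> space P" and ex: "exit_time U \<omega> < \<infinity>" "\<omega> (real_of_ereal (exit_time U \<omega>)) \<in> V"
      by (auto simp: exit_into_def)
    from sp have "cadlag \<omega>" unfolding space_eq path_space_def by (simp add: space_restrict_space)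
    then obtain N where "\<forall>m\<ge>N. \<exists>k. \<omega> (real k * h m) \<in> T \<and> (\<forall>j<k. \<omega> (real j * h m) \<in> U')"
      using exit_grid[OF _ U ex W UT] unfolding h_def cadlag_def by blast
    then have "\<omega> \<in> I N" using sp by (auto simp: I_def E_def)
    then show "\<omega> \<in> (\<Union>n. I n)" by blast
  qed
  have "(\<lambda>n. measure P (I n)) \<longlonglongrightarrow> measure P (\<Union>n. I n)"
    by (rule finite_Lim_measure_incseq) (auto simp: incseq_def I_def)
  moreover have "measure P (I n) \<le> f x" for n
  proof -
    have "measure P (I n) \<le> measure P (E n)" by (rule finite_measure_mono) (auto simp: I_def)
    then show ?thesis using E_le[of n] by simp
  qed
  ultimately have lim: "measure P (\<Union>n. I n) \<le> f x" by (intro LIMSEQ_le_const2) auto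
  show ?thesis
  proof (cases "exit_into P U V \<in> sets (completion P)")
    case True
    interpret c: prob_space "completion P" by (rule prob_space_completion)
    have "measure (completion P) (exit_into P U V) \<le> measure (completion P) (\<Union>n. I n)"
      by (rule c.finite_measure_mono[OF sub]) auto
    also have "\<dots> = measure P (\<Union>n. I n)" by (rule measure_completion) measurable
    finally show ?thesis using lim by (simp add: exit_prob_def)
  next
    \<comment> \<open>\<open>measure\<close> is \<open>0\<close> on sets that are not measurable.\<close>
    case False
    then show ?thesis using f01 by (simp add: exit_prob_def measure_notin_sets)
  qed
qed

end

section \<open>The parabola\<close>

lemma open_parabola: "0 < \<beta> \<Longrightarrow> open (parabola \<beta> :: (real \<times> 'a::real_normed_vector) set)"
proof -
  assume \<beta>: "0 < \<beta>"
  \<comment> \<open>The absolute value changes nothing where \<open>fst x\<close> is positive, but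
    gives \<open>powr\<close> a nonnegative base everywhere, as the continuity rule demands.\<close>
  have "parabola \<beta> = {x :: real \<times> 'a. 0 < fst x} \<inter> {x. norm (snd x) < \<bar>fst x\<bar> powr \<beta>}"
    by (auto simp: parabola_def)
  moreover have "open {x :: real \<times> 'a. 0 < fst x}"
    by (intro open_Collect_less continuous_intros)
  moreover have "open {x :: real \<times> 'a. norm (snd x) < \<bar>fst x\<bar> powr \<beta>}"
    by (intro open_Collect_less continuous_intros continuous_on_powr') (use \<beta> in auto)
  ultimately show ?thesis by auto
qed

theorem lemma5:
  fixes \<alpha> \<beta> :: real
  assumes "0 < \<beta>" and "\<beta> < 1" and "0 < \<alpha>" and "\<alpha> < 2"
  shows "\<exists>C>0. \<forall>(P :: (real \<Rightarrow> real \<times> (real ^ 'n)) measure) (x :: real \<times> (real ^ 'n)) (s :: real).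
           isotropic_stable_law P \<alpha> x \<longrightarrow> 1 \<le> s \<longrightarrow> fst x \<le> s / 2 \<longrightarrow>
             exit_prob P (parabola_between \<beta> 0 (ereal s)) (parabola \<beta>)
               \<le> C * max (fst x) 1 powr (\<alpha> * \<beta>)
                    * s powr (- (\<alpha> * \<beta> * p0 DIM(real \<times> (real ^ 'n)) \<alpha> \<beta>))"
proof -
  define p \<gamma> where "p = real CARD('n) + \<alpha>" and "\<gamma> = real CARD('n) * (1 - \<beta>) + \<alpha>"
  have p0_eq: "\<alpha> * \<beta> * p0 DIM(real \<times> (real ^ 'n)) \<alpha> \<beta> = \<gamma>"
    using assms by (simp add: p0_def \<gamma>_def)
  have \<gamma>: "\<gamma> > 0" and p: "p > 0" using assms by (simp_all add: \<gamma>_def p_def add_nonneg_pos)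
  obtain A r where A: "A > 0" and r: "r \<ge> 1"
    and super: "\<And>(M :: (real \<times> (real ^ 'n)) measure) h s x. stable_distribution M \<alpha> h \<Longrightarrow> h \<le> 1 \<Longrightarrow> r \<le> s \<Longrightarrow>
       0 < fst x \<Longrightarrow> fst x < s \<Longrightarrow> norm (snd x) < (r + fst x) powr \<beta> \<Longrightarrow>
       (\<integral>y. barrier \<alpha> \<beta> A r s (x + y) \<partial>M) \<le> barrier \<alpha> \<beta> A r s x"
    by (rule barrier_supersolution[OF assms(3,4,1,2)]) blast
  define C where "C = A * (4/3) powr \<gamma> * (r + 1) powr (\<alpha> * \<beta>) * 3 powr p + (4/3 * r) powr \<gamma>"
  have C: "C > 0" unfolding C_def using A r by (intro add_pos_pos mult_pos_pos) auto
  show ?thesis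
  proof (intro exI[of _ C] conjI allI impI C, unfold p0_eq)
    fix P :: "(real \<Rightarrow> real \<times> (real ^ 'n)) measure" and x :: "real \<times> (real ^ 'n)" and s :: real
    assume P: "isotropic_stable_law P \<alpha> x" and s: "1 \<le> s" and xs: "fst x \<le> s / 2"
    interpret isotropic_stable_law P \<alpha> x by (rule P)
    define m where "m = max (fst x) 1"
    have m: "m \<ge> 1" "fst x \<le> m" by (simp_all add: m_def)
    show "exit_prob P (parabola_between \<beta> 0 (ereal s)) (parabola \<beta>) \<le> C * m powr (\<alpha> * \<beta>) * s powr (- \<gamma>)"
    proof (cases "r \<le> 3/4 * s")
      case False
      have "exit_prob P (parabola_between \<beta> 0 (ereal s)) (parabola \<beta>) \<le> 1"
        unfolding exit_prob_def by (rule prob_space.prob_le_1[OF prob_space_completion])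
      also have "1 \<le> (4/3 * r) powr \<gamma> * s powr (- \<gamma>)"
      proof -
        have "s powr \<gamma> \<le> (4/3 * r) powr \<gamma>" using False s \<gamma> by (intro powr_mono2) auto
        then show ?thesis using s by (simp add: powr_minus field_simps)
      qed
      also have "\<dots> \<le> C * m powr (\<alpha> * \<beta>) * s powr (- \<gamma>)"
      proof (rule mult_right_mono)
        have "1 \<le> m powr (\<alpha> * \<beta>)" using m assms by (intro ge_one_powr_ge_zero) auto
        then have "C * 1 \<le> C * m powr (\<alpha> * \<beta>)" using C by (intro mult_left_mono) auto
        moreover have "(4/3 * r) powr \<gamma> \<le> C" using A by (simp add: C_def)
        ultimately show "(4/3 * r) powr \<gamma> \<le> C * m powr (\<alpha> * \<beta>)" by simp
      qed simp
      finally show ?thesis .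
    next
      case True
      \<comment> \<open>The barrier is placed below \<open>s\<close> so that points of the parabola
        at height \<open>s\<close> or more lie in the open set \<open>W\<close>. With the ratio 3/4
        the start satisfies x_1 \<le> 2s'/3, which keeps the singular factor of the profile at most
        3^p.\<close>
      define s' where "s' = 3/4 * s"
      have s': "r \<le> s'" "s' < s" "s' > 0" using True s by (simp_all add: s'_def)
      define par :: "(real \<times> (real ^ 'n)) set" where "par = parabola \<beta>"
      have opar: "open par" unfolding par_def using assms by (intro open_parabola)
      define U' T W where "U' = par \<inter> {z. fst z < s'}" and "T = par \<inter> {z. s' \<le> fst z}" and "W = par \<inter> {z. s' < fst z}"
      have U_eq: "parabola_between \<beta> 0 (ereal s) = par \<inter> {z. fst z < s}"
        by (auto simp: parabola_between_def par_def parabola_def)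
      have oless: "open {z :: real \<times> (real ^ 'n). fst z < u}" "open {z :: real \<times> (real ^ 'n). u < fst z}" for u
        by (intro open_Collect_less continuous_intros)+
      have [measurable]: "par \<in> sets borel" using opar by simp
      have "exit_prob P (par \<inter> {z. fst z < s}) par \<le> barrier \<alpha> \<beta> A r s' x"
      proof (rule exit_prob_le[OF assms(3,4), where U'=U' and T=T and W=W])
        show "open (par \<inter> {z. fst z < s})" "open W" unfolding W_def using opar oless by auto
        show "par - par \<inter> {z. fst z < s} \<subseteq> W" "W \<subseteq> T" "par \<inter> {z. fst z < s} \<subseteq> U' \<union> T" "U' \<inter> T = {}"
          using s' by (auto simp: W_def T_def U'_def)
        show "U' \<in> sets borel" "T \<in> sets borel" unfolding U'_def T_def by measurable
        show "barrier \<alpha> \<beta> A r s' \<in> borel_measurable borel" by measurable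
        show "0 \<le> barrier \<alpha> \<beta> A r s' z" "barrier \<alpha> \<beta> A r s' z \<le> 1" for z
          using barrier_bounds(1)[of A \<alpha> \<beta> r s' z] barrier_bounds(2)[of \<alpha> \<beta> A r s' z] A by linarith+
        have wide: "norm (snd z) < (r + fst z) powr \<beta>" "0 < fst z" if "z \<in> par" for z
        proof -
          have z: "0 < fst z" "norm (snd z) < fst z powr \<beta>" using that by (simp_all add: par_def parabola_def)
          moreover have "fst z powr \<beta> \<le> (r + fst z) powr \<beta>" using z r assms by (intro powr_mono2) auto
          ultimately show "norm (snd z) < (r + fst z) powr \<beta>" "0 < fst z" by simp_all
        qed
        show "barrier \<alpha> \<beta> A r s' z = 1" if "z \<in> T" for z
          using wide[of z] that by (simp add: barrier_def T_def)
        show "(\<integral>y. barrier \<alpha> \<beta> A r s' (z + y) \<partial>M) \<le> barrier \<alpha> \<beta> A r s' z"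
          if "stable_distribution M \<alpha> h" "h \<le> 1" "z \<in> U'" for M h z
          by (rule super[OF that(1,2) s'(1)]) (use wide[of z] that(3) in \<open>auto simp: U'_def\<close>)
      qed
      also have "\<dots> \<le> (A * (4/3) powr \<gamma> * (r + 1) powr (\<alpha> * \<beta>) * 3 powr p) * m powr (\<alpha> * \<beta>) * s powr (- \<gamma>)"
      proof (cases "0 < fst x \<and> norm (snd x) < (r + fst x) powr \<beta>")
        case False
        then have "barrier \<alpha> \<beta> A r s' x = 0" unfolding barrier_def by (rule if_not_P)
        then show ?thesis using A by simp
      next
        case inside: True
        have "barrier \<alpha> \<beta> A r s' x \<le> profile CARD('n) \<alpha> \<beta> A r s' (fst x)"
          unfolding barrier_def if_P[OF inside] using xs s by (simp add: s'_def)
        also have "\<dots> \<le> A * ((4/3) powr \<gamma> * s powr (- \<gamma>)) * ((r + 1) * m) powr (\<alpha> * \<beta>) * 3 powr p"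
          unfolding profile_def \<gamma>_def[symmetric] p_def[symmetric]
        proof (intro mult_mono)
          show "s' powr (- \<gamma>) \<le> (4/3) powr \<gamma> * s powr (- \<gamma>)"
            unfolding s'_def using s by (simp add: powr_mult powr_divide powr_minus field_simps)
          have "r + fst x \<le> r * m + m" using m r mult_left_mono[of 1 m r] by linarith
          then show "(r + fst x) powr (\<alpha> * \<beta>) \<le> ((r + 1) * m) powr (\<alpha> * \<beta>)"
            using inside r assms by (intro powr_mono2) (auto simp: algebra_simps)
          have "1/3 \<le> 1 - fst x / s'" using xs s by (simp add: s'_def field_simps)
          then have "(1 - fst x / s') powr (-p) \<le> (1/3) powr (-p)" using p by (intro powr_mono2') auto
          then show "(1 - fst x / s') powr (-p) \<le> 3 powr p" by (simp add: powr_divide powr_minus_divide)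
        qed (use A in auto)
        also have "\<dots> = (A * (4/3) powr \<gamma> * (r + 1) powr (\<alpha> * \<beta>) * 3 powr p) * m powr (\<alpha> * \<beta>) * s powr (- \<gamma>)"
          using m r by (simp add: powr_mult)
        finally show ?thesis .
      qed
      also have "\<dots> \<le> C * m powr (\<alpha> * \<beta>) * s powr (- \<gamma>)"
        by (intro mult_right_mono) (auto simp: C_def)
      finally show ?thesis unfolding U_eq par_def .
    qed
  qed
qed

end
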